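(* Let $u_0\in\mathcal M$ be a Gaussian wave packet with $\|u_0\|_{L^2}=1$ and parameters $q_0,p_0,\mathcal C_0,\zeta_0$. Then the parameters $(q,p,\mathcal C,\zeta)$ of the solution $u(t)\in\mathcal M$ of the variational equation $i\varepsilon\partial_t u(t)=P_{u(t)}(H(t)u(t))$, $u(0)=u_0$, satisfy $$\dot q = p-\langle A\rangle_u,$$ $$\dot p=\tfrac{\varepsilon}{2}\big\langle\nabla\,\mathrm{tr}(J_A^T\mathcal C_R\mathcal C_I^{-1})\big\rangle_u+\langle J_A\rangle_u^T p-\langle\nabla\widetilde V\rangle_u,$$ $$\dot{\mathcal C}=-\mathcal C^2+\langle D^2_{A,p}\rangle_u+\langle J_A\rangle_u^T\mathcal C+\mathcal C\langle J_A\rangle_u-\langle\nabla^2\widetilde V\rangle_u+\tfrac{\varepsilon}{2}\big\langle\nabla^2\mathrm{tr}(J_A^T\mathcal C_R\mathcal C_I^{-1})\big\rangle_u,$$ $$\begin{aligned}\dot\zeta={}&\tfrac12|p|^2+\tfrac{\varepsilon}{2}\big\langle\mathrm{tr}(J_A^T\mathcal C_R\mathcal C_I^{-1})\big\rangle_u+\tfrac{i\varepsilon}{2}\mathrm{tr}(\mathcal C)\\&-\tfrac{\varepsilon}{4}\mathrm{tr}\Big(\mathcal C_I^{-1}\big(\tfrac{\varepsilon}{2}\langle\nabla^2\mathrm{tr}(J_A^T\mathcal C_R\mathcal C_I^{-1})\rangle_u+\langle J_A\rangle_u^T\mathcal C_R+\mathcal C_R\langle J_A\rangle_u+\langle D^2_{A,p}\rangle_u\big)\Big)\\&-\langle\widetilde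 V\rangle_u+\tfrac{\varepsilon}{4}\mathrm{tr}\big(\mathcal C_I^{-1}\langle\nabla^2\widetilde V\rangle_u\big),\end{aligned}$$ with initial data $(q(0),p(0),\mathcal C(0),\zeta(0))=(q_0,p_0,\mathcal C_0,\zeta_0)$.
   Context: Potentials. $A=(A_j)_{j=1}^d:\mathbb R\times\mathbb R^d\to\mathbb R^d$ and $V:\mathbb R\times\mathbb R^d\to\mathbb R$ are functions of $(t,x)$, and $\widetilde V:=\frac12|A|^2+V$. Standing assumption: $A$ and $\widetilde V$ are infinitely often differentiable; $\widetilde V$ is subquadratic in $x$ (i.e. $\nabla^k\widetilde V$ is bounded for all $k\ge2$); $A$ is sublinear in $x$ (i.e. $\nabla^kA$ is bounded for all $k\ge1$) and $\mathrm{div}\,A=0$. Here $\nabla$ denotes spatial derivatives. Hamiltonian. For a semiclassical parameter $\varepsilon\in(0,1]$, $H(t)=\frac12(i\varepsilon\nabla_x+A(t,x))^2+V(t,x)=-\frac{\varepsilon^2}{2}\Delta+i\varepsilon A(t)\cdot\nabla+\widetilde V(t)$. Gaussian wave packets. $\mathcal M$ is the set of functions $g(x)=\exp\big(\frac{i}{\varepsilon}(\frac12(x-q)^T\mathcal C(x-q)+(x-q)^Tp+\zeta)\big)$ with $q,p\in\mathbb R^d$, $\mathcal C=\mathcal C^T\in\mathbb C^{d\times d}$ with positive definite imaginary part, $\zeta\in\mathbb C$. The tangent space at $u\in\mathcal M$ is $\mathcal T_u\mathcal M=\{\varphi u:\varphi$ a $d$-variate complex polynomial of degree at most $2\}$,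 and $P_u:L^2(\mathbb R^d)\to\mathcal T_u\mathcal M$ is the orthogonal projection. Notation. $\mathcal C_R=\mathrm{Re}\,\mathcal C$, $\mathcal C_I=\mathrm{Im}\,\mathcal C$; $J_A$ is the Jacobian matrix of $A$ in $x$, $(J_A)_{jk}=\partial_kA_j$; for $v\in\mathbb R^d$, $(D^2_{A,v})_{k,l}=\sum_{j=1}^d\partial_l\partial_kA_j\,v_j$; $\langle W\rangle_u=\int_{\mathbb R^d}W(x)|u(x)|^2\,dx$ (entrywise for vector- or matrix-valued $W$). The dependence of $A,\widetilde V$ on $t$ is suppressed. *)

theory Defs
  imports "HOL-Analysis.Analysis"
begin

definition pd :: "'n \<Rightarrow> (real^'n::finite \<Rightarrow> 'b::real_normed_vector) \<Rightarrow> real^'n \<Rightarrow> 'b" where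
  "pd j f x = frechet_derivative f (at x) (axis j 1)"

text \<open>The entries of the tensor \<open>\<nabla>\<^sup>k f\<close> are the functions \<open>pds js f\<close> with \<open>length js = k\<close>.\<close>
definition pds :: "'n list \<Rightarrow> (real^'n::finite \<Rightarrow> 'b::real_normed_vector) \<Rightarrow> real^'n \<Rightarrow> 'b" where
  "pds js f = foldr pd js f"

definition grad :: "(real^'n::finite \<Rightarrow> real) \<Rightarrow> real^'n \<Rightarrow> real^'n" where
  "grad f x = (\<chi> j. pd j f x)"

definition hess :: "(real^'n::finite \<Rightarrow> real) \<Rightarrow> real^'n \<Rightarrow> real^'n^'n" where
  "hess f x = (\<chi> k l. pd l (pd k f) x)"

primrec Ck :: "nat \<Rightarrow> ('a::real_normed_vector \<Rightarrow> 'b::real_normed_vector) \<Rightarrow> bool" where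
  "Ck 0 f \<longleftrightarrow> continuous_on UNIV f"
| "Ck (Suc k) f \<longleftrightarrow>
     (\<forall>x. f differentiable (at x)) \<and> (\<forall>v. Ck k (\<lambda>x. frechet_derivative f (at x) v))"

definition smooth :: "('a::real_normed_vector \<Rightarrow> 'b::real_normed_vector) \<Rightarrow> bool" where
  "smooth f \<longleftrightarrow> (\<forall>k. Ck k f)"

definition Vtilde ::
  "(real \<Rightarrow> real^'n \<Rightarrow> real^'n) \<Rightarrow> (real \<Rightarrow> real^'n \<Rightarrow> real) \<Rightarrow> real \<Rightarrow> real^'n::finite \<Rightarrow> real" where
  "Vtilde A V t x = 1/2 * (norm (A t x))\<^sup>2 + V t x"

definition admissible_potentials ::
  "(real \<Rightarrow> real^'n \<Rightarrow> real^'n) \<Rightarrow> (real \<Rightarrow> real^'n::finite \<Rightarrow> real) \<Rightarrow> bool" where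
  "admissible_potentials A V \<longleftrightarrow>
     smooth (\<lambda>(t, x). A t x) \<and> smooth (\<lambda>(t, x). Vtilde A V t x) \<and>
     (\<forall>js. length js \<ge> 2 \<longrightarrow> bounded (range (\<lambda>(t, x). pds js (Vtilde A V t) x))) \<and>
     (\<forall>js. length js \<ge> 1 \<longrightarrow> bounded (range (\<lambda>(t, x). pds js (A t) x))) \<and>
     (\<forall>t x. (\<Sum>j\<in>UNIV. pd j (\<lambda>y. A t y $ j) x) = 0)"

text \<open>The \<open>j\<close>-th component of \<open>i\<epsilon>\<nabla> + A\<close>, at a fixed time.\<close>
definition momentum ::
  "real \<Rightarrow> (real^'n \<Rightarrow> real^'n) \<Rightarrow> 'n \<Rightarrow> (real^'n::finite \<Rightarrow> complex) \<Rightarrow> real^'n \<Rightarrow> complex" where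
  "momentum \<epsilon> A j f x = \<i> * of_real \<epsilon> * pd j f x + of_real (A x $ j) * f x"

definition hamiltonian ::
  "real \<Rightarrow> (real^'n \<Rightarrow> real^'n) \<Rightarrow> (real^'n \<Rightarrow> real) \<Rightarrow>
   (real^'n::finite \<Rightarrow> complex) \<Rightarrow> real^'n \<Rightarrow> complex" where
  "hamiltonian \<epsilon> A V f x =
     1/2 * (\<Sum>j\<in>UNIV. momentum \<epsilon> A j (momentum \<epsilon> A j f) x) + of_real (V x) * f x"

definition gwp ::
  "real \<Rightarrow> real^'n \<Rightarrow> real^'n \<Rightarrow> complex^'n^'n \<Rightarrow> complex \<Rightarrow> real^'n::finite \<Rightarrow> complex" where
  "gwp \<epsilon> q p C \<zeta> x =
     exp (\<i> / of_real \<epsilon> *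
       (1/2 * (\<Sum>j\<in>UNIV. \<Sum>k\<in>UNIV. of_real ((x - q) $ j) * C $ j $ k * of_real ((x - q) $ k))
        + of_real ((x - q) \<bullet> p) + \<zeta>))"

definition width_matrix :: "complex^'n^'n::finite \<Rightarrow> bool" where
  "width_matrix C \<longleftrightarrow>
     transpose C = C \<and> (\<forall>v. v \<noteq> 0 \<longrightarrow> v \<bullet> (map_matrix Im C *v v) > 0)"

definition gwp_manifold :: "real \<Rightarrow> (real^'n::finite \<Rightarrow> complex) set" where
  "gwp_manifold \<epsilon> = {gwp \<epsilon> q p C \<zeta> | q p C \<zeta>. width_matrix C}"

definition tangent_space :: "(real^'n::finite \<Rightarrow> complex) \<Rightarrow> (real^'n \<Rightarrow> complex) set" where
  "tangent_space u =
     {\<lambda>x. (a + (\<Sum>j\<in>UNIV. b $ j * of_real (x $ j))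
             + (\<Sum>j\<in>UNIV. \<Sum>k\<in>UNIV. M $ j $ k * of_real (x $ j) * of_real (x $ k))) * u x
      | (a :: complex) (b :: complex^'n) (M :: complex^'n^'n). True}"

definition L2_inner :: "(real^'n::finite \<Rightarrow> complex) \<Rightarrow> (real^'n \<Rightarrow> complex) \<Rightarrow> complex" where
  "L2_inner f g = integral\<^sup>L lborel (\<lambda>x. cnj (f x) * g x)"

definition L2_norm :: "(real^'n::finite \<Rightarrow> complex) \<Rightarrow> real" where
  "L2_norm f = sqrt (integral\<^sup>L lborel (\<lambda>x. (cmod (f x))\<^sup>2))"

text \<open>
  The elements of the tangent space at a wave packet \<open>u\<close> are continuous, so that the orthogonal
  projection is unique as a function, not only almost everywhere.
\<close>
definition tangent_proj ::
  "(real^'n::finite \<Rightarrow> complex) \<Rightarrow> (real^'n \<Rightarrow> complex) \<Rightarrow> (real^'n \<Rightarrow> complex)" where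
  "tangent_proj u f =
     (THE w. w \<in> tangent_space u \<and> (\<forall>v\<in>tangent_space u. L2_inner v (\<lambda>x. f x - w x) = 0))"

text \<open>
  Here \<open>\<partial>\<^sub>t u\<close> is the classical partial
  derivative (one-sided at an end point of \<open>I\<close>).
\<close>
definition variational_solution ::
  "real \<Rightarrow> (real \<Rightarrow> real^'n \<Rightarrow> real^'n) \<Rightarrow> (real \<Rightarrow> real^'n \<Rightarrow> real) \<Rightarrow> real set \<Rightarrow>
   (real \<Rightarrow> real^'n::finite \<Rightarrow> complex) \<Rightarrow> bool" where
  "variational_solution \<epsilon> A V I u \<longleftrightarrow>
     (\<forall>t\<in>I. u t \<in> gwp_manifold \<epsilon> \<and>
        (\<exists>u'. (\<forall>x. ((\<lambda>s. u s x) has_vector_derivative u' x) (at t within I)) \<and>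
              (\<lambda>x. \<i> * of_real \<epsilon> * u' x) =
                tangent_proj (u t) (hamiltonian \<epsilon> (A t) (V t) (u t))))"

text \<open>
  A wave packet determines \<open>q\<close>, \<open>p\<close> and \<open>C\<close>, but \<open>\<zeta>\<close> only up to integer multiples of \<open>2\<pi>\<epsilon>\<close>.
  Therefore a continuous choice of \<open>\<zeta>\<close> with the prescribed value at time \<open>0\<close> is required.
  No regularity of \<open>q\<close>, \<open>p\<close>, \<open>C\<close> is demanded.
\<close>
definition parameters_of ::
  "real \<Rightarrow> real set \<Rightarrow> (real \<Rightarrow> real^'n::finite \<Rightarrow> complex) \<Rightarrow> complex \<Rightarrow>
   (real \<Rightarrow> real^'n) \<Rightarrow> (real \<Rightarrow> real^'n) \<Rightarrow> (real \<Rightarrow> complex^'n^'n) \<Rightarrow> (real \<Rightarrow> complex) \<Rightarrow> bool" where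
  "parameters_of \<epsilon> I u \<zeta>0 q p C \<zeta> \<longleftrightarrow>
     (\<forall>t\<in>I. width_matrix (C t) \<and> u t = gwp \<epsilon> (q t) (p t) (C t) (\<zeta> t)) \<and>
     continuous_on I \<zeta> \<and> \<zeta> 0 = \<zeta>0"

definition avg ::
  "(real^'n::finite \<Rightarrow> complex) \<Rightarrow> (real^'n \<Rightarrow> 'b::{banach, second_countable_topology}) \<Rightarrow> 'b" where
  "avg u W = integral\<^sup>L lborel (\<lambda>x. (cmod (u x))\<^sup>2 *\<^sub>R W x)"

definition jac :: "(real^'n \<Rightarrow> real^'n) \<Rightarrow> real^'n::finite \<Rightarrow> real^'n^'n" where
  "jac A x = jacobian A (at x)"

definition D2 :: "(real^'n \<Rightarrow> real^'n) \<Rightarrow> real^'n \<Rightarrow> real^'n::finite \<Rightarrow> real^'n^'n" where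
  "D2 A v x = (\<chi> k l. \<Sum>j\<in>UNIV. pd l (pd k (\<lambda>y. A y $ j)) x * v $ j)"

definition tr_term :: "(real^'n \<Rightarrow> real^'n) \<Rightarrow> complex^'n^'n \<Rightarrow> real^'n::finite \<Rightarrow> real" where
  "tr_term A C x =
     trace (transpose (jac A x) ** map_matrix Re C ** matrix_inv (map_matrix Im C))"

abbreviation cmat :: "real^'n^'m \<Rightarrow> complex^'n^'m" where
  "cmat \<equiv> map_matrix complex_of_real"

end

theory Submission
  imports Defs "HOL-Probability.Distributions"
begin

text \<open>
  On a wave packet \<open>u\<close> the Hamiltonian acts as multiplication by a function \<open>h\<close>, so that
  \<open>P\<^sub>u (H u) = w u\<close>, where \<open>w\<close> is the projection of \<open>h\<close> onto the quadratic polynomials with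
  respect to the Gaussian weight \<open>\<bar>u\<bar>\<^sup>2\<close>.  Integration by parts against the weight (Stein's identity)
  shows that a function is orthogonal to all quadratic polynomials as soon as its average and the
  averages of its gradient and of its Hessian vanish.  This gives \<open>w\<close> in terms of averages, and the
  same identity removes the factors \<open>x - q\<close> that the magnetic term contributes to these averages; they are the source
  of the trace terms, and the imaginary part of the trace is the divergence of \<open>A\<close>.

  Conversely, if \<open>u = exp (i \<Phi> / \<epsilon>)\<close>, the variational equation says that \<open>\<partial>\<^sub>t \<Phi> = - w\<close> at every
  point, and comparing the coefficients of the quadratic polynomials \<open>\<Phi>\<close> and \<open>w\<close> gives the equations
  of motion.  The modulus of \<open>u\<close> determines the imaginary part of the coefficients of \<open>\<Phi>\<close>; the real
  part is continuous because \<open>exp (i \<lambda>\<^sub>n x) \<longlongrightarrow> 1\<close> for all real \<open>x\<close> forces \<open>\<lambda>\<^sub>n \<longlongrightarrow> 0\<close>.  The averages are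
  normalised because \<open>Im \<langle>w\<rangle> = Im \<langle>h\<rangle> = 0\<close>, which makes the norm of \<open>u\<close> constant.
\<close>

section \<open>Integration by parts for functions with Gaussian decay\<close>

text \<open>The solution is differentiable in time only pointwise in x, and nothing is assumed about
  q, p and C, so no chain rule is available. The parameters are recovered from finite differences of
  the phase, which are exact for quadratics. Freezing the base point at \<open>q t\<close> makes the
  imaginary part of the phase gradient there equal to Im C(s) (q(t) - q(s)); dividing by s - t gives
  a linear system for the velocity, with the invertible matrix Im C(s).

  The equations presuppose mass one, but mass conservation is itself a consequence of the projection
  formula. Therefore the projection is computed for an arbitrary mass \<open>N\<close>, and
  \<open>N = 1\<close> is inserted only at the end.

  The exact shape of the trace terms comes from one matrix: integration by parts turns a factor C (x
  - q) into a contraction of derivatives with C (Im C)^-1 = Re C (Im C)^-1 + i. The first summand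
  produces the trace term, the identity produces the divergence.\<close>

lemma integrable_exp_neg_square:
  fixes c :: real
  assumes "0 < c"
  shows "integrable lborel (\<lambda>x::real. exp (- c * x\<^sup>2))"
proof -
  define s where "s = sqrt (1 / (2 * c))"
  have s2: "s\<^sup>2 = 1 / (2 * c)" and s: "0 < s"
    using assms by (auto simp: s_def)
  have "integrable lborel (\<lambda>x. sqrt (2 * pi * s\<^sup>2) * normal_density 0 s x)"
    by (intro integrable_mult_right) (use s in auto)
  also have "(\<lambda>x. sqrt (2 * pi * s\<^sup>2) * normal_density 0 s x) = (\<lambda>x. exp (- c * x\<^sup>2))"
    using s assms by (auto simp: normal_density_def s2 fun_eq_iff)
  finally show ?thesis .
qed

lemma integrable_exp_neg_norm_square:
  fixes c :: real
  assumes "0 < c"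
  shows "integrable lborel (\<lambda>x::'a::euclidean_space. exp (- c * (norm x)\<^sup>2))"
proof (rule integrableI_nonneg)
  have "exp (- c * (norm x)\<^sup>2) = (\<Prod>b\<in>Basis. exp (- c * (x \<bullet> b)\<^sup>2))" for x :: 'a
    by (simp add: exp_sum [symmetric] sum_distrib_left [symmetric] sum_negf power2_norm_eq_inner
        euclidean_inner[of x x] flip: power2_eq_square)
  then have "(\<integral>\<^sup>+x. ennreal (exp (- c * (norm (x::'a))\<^sup>2)) \<partial>lborel)
      = (\<integral>\<^sup>+x. (\<Prod>b\<in>Basis. ennreal (exp (- c * (x \<bullet> b)\<^sup>2))) \<partial>(lborel::'a measure))"
    by (simp add: prod_ennreal)
  also have "\<dots> = (\<Prod>b\<in>(Basis::'a set). (\<integral>\<^sup>+x. ennreal (exp (- c * x\<^sup>2)) \<partial>lborel))"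
    by (intro nn_integral_lborel_prod) auto
  also have "\<dots> < \<infinity>"
    using integrable_exp_neg_square[OF assms]
    by (simp add: integrable_iff_bounded power_less_top_ennreal)
  finally show "(\<integral>\<^sup>+x. ennreal (exp (- c * (norm (x::'a))\<^sup>2)) \<partial>lborel) < \<infinity>" .
qed (auto)

text \<open>The quotient form lets limit theorems and sequences in \<open>S - {t}\<close> act on
  derivatives, also at an end point of an interval.\<close>

lemma has_vector_derivative_iff_tendsto:
  "(f has_vector_derivative D) (at t within S) \<longleftrightarrow>
    ((\<lambda>s. (f s - f t) /\<^sub>R (s - t)) \<longlongrightarrow> D) (at t within S)"
proof -
  have "norm ((1 / norm (s - t)) *\<^sub>R (f s - (f t + (s - t) *\<^sub>R D)))
      = norm ((f s - f t) /\<^sub>R (s - t) - D)" if "s \<noteq> t" for s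
  proof -
    have "(f s - f t) /\<^sub>R (s - t) - D = (f s - (f t + (s - t) *\<^sub>R D)) /\<^sub>R (s - t)"
      using that by (simp add: scaleR_diff_right scaleR_add_right)
    then show ?thesis
      by (simp add: divide_inverse)
  qed
  then have "((\<lambda>s. norm ((1 / norm (s - t)) *\<^sub>R (f s - (f t + (s - t) *\<^sub>R D)))) \<longlongrightarrow> 0) (at t within S)
    \<longleftrightarrow> ((\<lambda>s. norm ((f s - f t) /\<^sub>R (s - t) - D)) \<longlongrightarrow> 0) (at t within S)"
    by (intro filterlim_cong refl) (auto simp: eventually_at_filter)
  then have "((\<lambda>s. (1 / norm (s - t)) *\<^sub>R (f s - (f t + (s - t) *\<^sub>R D))) \<longlongrightarrow> 0) (at t within S)
    \<longleftrightarrow> ((\<lambda>s. (f s - f t) /\<^sub>R (s - t) - D) \<longlongrightarrow> 0) (at t within S)"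
    by (simp only: tendsto_norm_zero_iff)
  then show ?thesis
    by (simp add: has_vector_derivative_def has_derivative_within bounded_linear_scaleR_left
        Lim_null[of _ D])
qed

text \<open>An explicit majorant rather than mere integrability: the same bound also dominates
  difference quotients, because it survives bounded shifts.\<close>

definition gaussian_decay :: "('a::real_normed_vector \<Rightarrow> 'b::real_normed_vector) \<Rightarrow> bool" where
  "gaussian_decay f \<longleftrightarrow> (\<exists>K c. 0 < c \<and> (\<forall>x. norm (f x) \<le> K * exp (- c * (norm x)\<^sup>2)))"

lemma gaussian_decay_integrable:
  fixes f :: "'a::euclidean_space \<Rightarrow> 'b::{banach, second_countable_topology}"
  assumes "gaussian_decay f" and "continuous_on UNIV f"
  shows "integrable lborel f"
proof -
  obtain K c where "0 < c" and le: "\<And>x. norm (f x) \<le> K * exp (- c * (norm x)\<^sup>2)"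
    using assms(1) unfolding gaussian_decay_def by blast
  show ?thesis
  proof (rule Bochner_Integration.integrable_bound)
    show "integrable lborel (\<lambda>x::'a. K * exp (- c * (norm x)\<^sup>2))"
      using integrable_exp_neg_norm_square[OF \<open>0 < c\<close>] by (rule integrable_mult_right)
    show "f \<in> borel_measurable lborel"
      using borel_measurable_continuous_onI[OF assms(2)] by simp
    show "AE x in lborel. norm (f x) \<le> norm (K * exp (- c * (norm x)\<^sup>2))"
      using le by (intro AE_I2) (smt (verit) real_norm_def)
  qed
qed

text \<open>Nonempty open sets are not negligible, so for a continuous function vanishing almost
  everywhere means vanishing everywhere. This makes the projection unique as a function.\<close>

lemma continuous_nonneg_integral_zero:
  fixes f :: "'a::euclidean_space \<Rightarrow> real"
  assumes "integrable lborel f" "continuous_on UNIV f" "\<And>x. 0 \<le> f x" "integral\<^sup>L lborel f = 0"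
  shows "f x = 0"
proof (rule ccontr)
  assume "f x \<noteq> 0"
  have "AE x in lborel. f x = 0"
    using integral_nonneg_eq_0_iff_AE[OF assms(1)] assms(3,4) by simp
  then have "AE x in lebesgue. f x = 0"
    by (rule AE_completion)
  then have "negligible {x. f x \<noteq> 0}"
    by (simp add: negligible_iff_null_sets AE_iff_null_sets completion.complete_measure_axioms
      eventually_ae_filter null_sets_completion_subset)
      (metis (mono_tags, lifting) negligible_iff_null_sets negligible_subset)
  moreover have "open {x. f x \<noteq> 0}"
    using assms(2) by (intro open_Collect_neq) (auto intro: continuous_intros)
  ultimately show False
    using \<open>f x \<noteq> 0\<close> open_not_negligible by blast
qed

lemma integral_translate:
  fixes f :: "'a::euclidean_space \<Rightarrow> 'b::{banach, second_countable_topology}"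
  assumes "continuous_on UNIV f"
  shows "integral\<^sup>L lborel (\<lambda>x. f (x + a)) = integral\<^sup>L lborel f"
proof -
  have "integral\<^sup>L (distr lborel borel ((+) a)) f = integral\<^sup>L lborel (\<lambda>x. f (a + x))"
    by (rule integral_distr) (auto intro: borel_measurable_continuous_onI assms)
  then show ?thesis
    by (simp add: lborel_distr_plus add.commute)
qed

text \<open>The two sides differ by half the square of the norm of \<open>x + 2 *\<^sub>R y\<close>.
  Hence a shift of a Gaussian costs half of its rate and a constant factor.\<close>

lemma norm_square_translate_ge:
  fixes x y :: "'a::real_inner"
  shows "(norm x)\<^sup>2 / 2 - (norm y)\<^sup>2 \<le> (norm (x + y))\<^sup>2"
proof -
  have "(norm (x + y))\<^sup>2 - ((norm x)\<^sup>2 / 2 - (norm y)\<^sup>2) = (norm (x + 2 *\<^sub>R y))\<^sup>2 / 2"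
    by (simp add: power2_norm_eq_inner inner_simps inner_commute field_simps)
  then show ?thesis
    by (smt (verit) zero_le_power2 divide_nonneg_pos)
qed

text \<open>
  By translation invariance the integral of a difference quotient vanishes; the Gaussian
  bound on the derivative dominates the difference quotients.
\<close>
lemma integral_directional_derivative_zero:
  fixes F D :: "'a::euclidean_space \<Rightarrow> 'b::{banach, second_countable_topology}" and e :: 'a
  assumes der: "\<And>x. (F has_derivative F' x) (at x)"
    and D: "\<And>x. D x = F' x e"
    and decF: "gaussian_decay F" and decD: "gaussian_decay D"
  shows "integral\<^sup>L lborel D = 0"
proof -
  obtain K c where c: "0 < c" and le: "\<And>x. norm (D x) \<le> K * exp (- c * (norm x)\<^sup>2)"
    using decD unfolding gaussian_decay_def by blast
  have K: "0 \<le> K"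
    using order_trans[OF norm_ge_zero le[of 0]] by simp
  have contF: "continuous_on UNIV F"
    using der by (meson continuous_at_imp_continuous_on has_derivative_continuous)
  have intF: "integrable lborel F"
    using decF contF by (rule gaussian_decay_integrable)
  have mF: "F \<in> borel_measurable borel"
    using contF by (rule borel_measurable_continuous_onI)
  define h where "h n = inverse (real (Suc n))" for n
  have h: "0 < h n" "h n \<le> 1" for n
    by (auto simp: h_def divide_simps)
  define Q where "Q n x = (F (x + h n *\<^sub>R e) - F x) /\<^sub>R h n" for n x
  have line: "((\<lambda>s. F (x + s *\<^sub>R e)) has_vector_derivative D (x + s *\<^sub>R e)) (at s within S)"
    for x s S
  proof -
    have "((\<lambda>s. x + s *\<^sub>R e) has_derivative (\<lambda>r. r *\<^sub>R e)) (at s within S)"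
      by (auto intro!: derivative_eq_intros)
    from has_derivative_compose[OF this der]
    have "((\<lambda>s. F (x + s *\<^sub>R e)) has_derivative (\<lambda>r. F' (x + s *\<^sub>R e) (r *\<^sub>R e))) (at s within S)" .
    moreover have "F' (x + s *\<^sub>R e) (r *\<^sub>R e) = r *\<^sub>R D (x + s *\<^sub>R e)" for r
      using der[of "x + s *\<^sub>R e"] by (simp add: D has_derivative_bounded_linear bounded_linear.linear linear_cmul)
    ultimately show ?thesis
      by (simp add: has_vector_derivative_def)
  qed
  \<comment> \<open>Since \<open>h n\<close> is at most 1, all points between x and the shifted
    point are x plus a vector of norm at most \<open>norm e\<close>. Bounding the derivative there
    halves the rate and costs the factor \<open>exp (c * (norm e)\<^sup>2)\<close>.\<close>
  define W where "W x = K * exp (c * (norm e)\<^sup>2) * exp (- (c/2) * (norm x)\<^sup>2)" for x :: 'a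
  have bound: "norm (Q n x) \<le> W x" for n x
  proof -
    have "norm (F (x + h n *\<^sub>R e) - F (x + 0 *\<^sub>R e)) \<le> W x * norm (h n - 0)"
    proof (rule differentiable_bound[where f = "\<lambda>s. F (x + s *\<^sub>R e)" and S = "{0..1}"
          and f' = "\<lambda>s r. r *\<^sub>R D (x + s *\<^sub>R e)"])
      show "((\<lambda>s. F (x + s *\<^sub>R e)) has_derivative (\<lambda>r. r *\<^sub>R D (x + s *\<^sub>R e))) (at s within {0..1})" for s
        using line by (simp add: has_vector_derivative_def)
      fix s :: real assume s: "s \<in> {0..1}"
      have "(norm (s *\<^sub>R e))\<^sup>2 \<le> (norm e)\<^sup>2"
        using s by (intro power_mono) (auto simp: mult_left_le_one_le)
      then have "(norm x)\<^sup>2 / 2 - (norm e)\<^sup>2 \<le> (norm (x + s *\<^sub>R e))\<^sup>2"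
        using norm_square_translate_ge[of x "s *\<^sub>R e"] by linarith
      then have "- c * (norm (x + s *\<^sub>R e))\<^sup>2 \<le> c * (norm e)\<^sup>2 + - (c/2) * (norm x)\<^sup>2"
        using mult_left_mono[of _ _ c] c by (fastforce simp: algebra_simps)
      then have "K * exp (- c * (norm (x + s *\<^sub>R e))\<^sup>2) \<le> K * exp (c * (norm e)\<^sup>2 + - (c/2) * (norm x)\<^sup>2)"
        using K by (intro mult_left_mono) auto
      also have "\<dots> = W x"
        by (simp only: W_def exp_add mult.assoc)
      finally have "norm (D (x + s *\<^sub>R e)) \<le> W x"
        using le[of "x + s *\<^sub>R e"] by linarith
      then show "onorm (\<lambda>r. r *\<^sub>R D (x + s *\<^sub>R e)) \<le> W x"
        by (intro onorm_le) (auto simp: mult.commute[of "W x"] intro: mult_left_mono)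
    qed (use h[of n] in auto)
    then have "norm (F (x + h n *\<^sub>R e) - F x) \<le> W x * h n"
      using h[of n] by simp
    then show ?thesis
      using h[of n] by (simp add: Q_def divide_simps mult.commute)
  qed
  have lim: "(\<lambda>n. Q n x) \<longlonglongrightarrow> D x" for x
  proof -
    have "((\<lambda>s. (F (x + s *\<^sub>R e) - F x) /\<^sub>R s) \<longlongrightarrow> D x) (at 0)"
      using line[of x 0 UNIV] by (simp add: has_vector_derivative_iff_tendsto)
    moreover have "filterlim h (at 0) sequentially"
      unfolding filterlim_at h_def using LIMSEQ_inverse_real_of_nat by auto
    ultimately show ?thesis
      unfolding Q_def by (rule filterlim_compose)
  qed
  have mD: "D \<in> borel_measurable borel"
    by (rule borel_measurable_LIMSEQ_metric[OF _ lim]) (use mF in \<open>measurable; simp add: Q_def\<close>)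
  have mQ: "Q n \<in> borel_measurable borel" for n
    unfolding Q_def using mF by measurable
  have "(\<lambda>n. integral\<^sup>L lborel (Q n)) \<longlonglongrightarrow> integral\<^sup>L lborel D"
  proof (rule integral_dominated_convergence[where w = W])
    show "integrable lborel W"
      unfolding W_def using c by (intro integrable_mult_right integrable_exp_neg_norm_square) auto
  qed (use mD mQ bound lim in auto)
  moreover have "integral\<^sup>L lborel (Q n) = 0" for n
  proof -
    have "integrable (distr lborel borel ((+) (h n *\<^sub>R e))) F"
      using intF by (simp add: lborel_distr_plus)
    then have "integrable lborel (\<lambda>x. F (x + h n *\<^sub>R e))"
      by (simp add: integrable_distr_eq mF add.commute)
    then show ?thesis
      using intF unfolding Q_def by (simp add: integral_translate[OF contF])
  qed
  ultimately show ?thesis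
    by (simp add: LIMSEQ_const_iff)
qed

section \<open>Partial derivatives and polynomial growth\<close>

lemma pd_eqI: "(f has_derivative f') (at x) \<Longrightarrow> pd j f x = f' (axis j 1)"
  unfolding pd_def by (metis frechet_derivative_at)

lemma has_derivative_pd:
  assumes "f differentiable (at x)"
  shows "(f has_derivative (\<lambda>h. \<Sum>j\<in>UNIV. h $ j *\<^sub>R pd j f x)) (at x)"
proof -
  have der: "(f has_derivative frechet_derivative f (at x)) (at x)"
    using assms frechet_derivative_works by blast
  then have lin: "linear (frechet_derivative f (at x))"
    by (rule has_derivative_linear)
  have "frechet_derivative f (at x) h = (\<Sum>j\<in>UNIV. h $ j *\<^sub>R pd j f x)" for h
  proof -
    have "frechet_derivative f (at x) h = frechet_derivative f (at x) (\<Sum>j\<in>UNIV. h $ j *\<^sub>R axis j 1)"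
      by (simp add: basis_expansion flip: scalar_mult_eq_scaleR)
    also have "\<dots> = (\<Sum>j\<in>UNIV. h $ j *\<^sub>R pd j f x)"
      by (simp add: linear_sum[OF lin] linear_cmul[OF lin] pd_def)
    finally show ?thesis .
  qed
  then have "frechet_derivative f (at x) = (\<lambda>h. \<Sum>j\<in>UNIV. h $ j *\<^sub>R pd j f x)"
    by (rule ext)
  with der show ?thesis
    by simp
qed

lemma pd_const [simp]: "pd j (\<lambda>x. c) = (\<lambda>x. 0)"
  by (intro ext, subst pd_eqI[OF has_derivative_const]) simp

lemma pd_coord: "pd j (\<lambda>x. x $ k) = (\<lambda>x. if k = j then 1 else 0)"
  by (intro ext, subst pd_eqI[OF bounded_linear_imp_has_derivative[OF bounded_linear_vec_nth]])
    (simp add: axis_def)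

lemma pd_add:
  assumes "f differentiable (at x)" "g differentiable (at x)"
  shows "pd j (\<lambda>x. f x + g x) x = pd j f x + pd j g x"
  by (subst pd_eqI[OF has_derivative_add[OF has_derivative_pd has_derivative_pd]])
    (use assms in \<open>auto simp: axis_def if_distrib[where f = "\<lambda>c. c *\<^sub>R _"] cong: if_cong\<close>)

lemma pd_diff:
  assumes "f differentiable (at x)" "g differentiable (at x)"
  shows "pd j (\<lambda>x. f x - g x) x = pd j f x - pd j g x"
  by (subst pd_eqI[OF has_derivative_diff[OF has_derivative_pd has_derivative_pd]])
    (use assms in \<open>auto simp: axis_def if_distrib[where f = "\<lambda>c. c *\<^sub>R _"] cong: if_cong\<close>)

lemma pd_bounded_linear:
  assumes "bounded_linear T" "f differentiable (at x)"
  shows "pd j (\<lambda>x. T (f x)) x = T (pd j f x)"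
  by (subst pd_eqI[OF bounded_linear.has_derivative[OF assms(1) has_derivative_pd[OF assms(2)]]])
    (auto simp: axis_def if_distrib[where f = "\<lambda>c. c *\<^sub>R _"] cong: if_cong)

lemma pd_bilinear:
  assumes "bounded_bilinear B" "f differentiable (at x)" "g differentiable (at x)"
  shows "pd j (\<lambda>x. B (f x) (g x)) x = B (f x) (pd j g x) + B (pd j f x) (g x)"
  by (subst pd_eqI[OF bounded_bilinear.FDERIV[OF assms(1) has_derivative_pd has_derivative_pd]])
    (use assms in \<open>auto simp: axis_def if_distrib[where f = "\<lambda>c. c *\<^sub>R _"] cong: if_cong\<close>)

text \<open>Continuity is part of the notion, so that the product with a continuous Gaussian weight
  is integrable without a separate measurability argument.\<close>

definition poly_bounded :: "('a::real_normed_vector \<Rightarrow> 'b::real_normed_vector) \<Rightarrow> bool" where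
  "poly_bounded f \<longleftrightarrow> continuous_on UNIV f \<and> (\<exists>K k. \<forall>x. norm (f x) \<le> K * (1 + norm x) ^ k)"

lemma poly_boundedI:
  assumes "continuous_on UNIV f" "\<And>x. norm (f x) \<le> K * (1 + norm x) ^ k"
  shows "poly_bounded f"
  using assms unfolding poly_bounded_def by blast

lemma poly_boundedE:
  assumes "poly_bounded f"
  obtains K k where "continuous_on UNIV f" "0 \<le> K" "\<And>x. norm (f x) \<le> K * (1 + norm x) ^ k"
proof -
  obtain K k where *: "\<And>x. norm (f x) \<le> K * (1 + norm x) ^ k"
    using assms unfolding poly_bounded_def by blast
  have "0 \<le> K"
    using order_trans[OF norm_ge_zero *[of 0]] by simp
  then show ?thesis
    using assms * that unfolding poly_bounded_def by blast
qed

lemma poly_bounded_const: "poly_bounded (\<lambda>x. c)"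
  by (rule poly_boundedI[where K = "norm c" and k = 0]) auto

lemma poly_bounded_add:
  assumes "poly_bounded f" "poly_bounded g"
  shows "poly_bounded (\<lambda>x. f x + g x)"
proof -
  obtain K k where f: "continuous_on UNIV f" "0 \<le> K" "\<And>x. norm (f x) \<le> K * (1 + norm x) ^ k"
    using poly_boundedE[OF assms(1)] by blast
  obtain L l where g: "continuous_on UNIV g" "0 \<le> L" "\<And>x. norm (g x) \<le> L * (1 + norm x) ^ l"
    using poly_boundedE[OF assms(2)] by blast
  show ?thesis
  proof (rule poly_boundedI)
    fix x
    have "norm (f x + g x) \<le> K * (1 + norm x) ^ k + L * (1 + norm x) ^ l"
      using f(3)[of x] g(3)[of x] norm_triangle_ineq[of "f x" "g x"] by linarith
    also have "\<dots> \<le> K * (1 + norm x) ^ max k l + L * (1 + norm x) ^ max k l"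
      using f(2) g(2) by (intro add_mono mult_left_mono power_increasing) auto
    finally show "norm (f x + g x) \<le> (K + L) * (1 + norm x) ^ max k l"
      by (simp add: algebra_simps)
  qed (intro continuous_intros f g)
qed

lemma poly_bounded_bilinear:
  assumes B: "bounded_bilinear B" and "poly_bounded f" "poly_bounded g"
  shows "poly_bounded (\<lambda>x. B (f x) (g x))"
proof -
  obtain K k where f: "continuous_on UNIV f" "0 \<le> K" "\<And>x. norm (f x) \<le> K * (1 + norm x) ^ k"
    using poly_boundedE[OF assms(2)] by blast
  obtain L l where g: "continuous_on UNIV g" "0 \<le> L" "\<And>x. norm (g x) \<le> L * (1 + norm x) ^ l"
    using poly_boundedE[OF assms(3)] by blast
  obtain M where M: "0 \<le> M" "\<And>a b. norm (B a b) \<le> norm a * norm b * M"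
    using bounded_bilinear.nonneg_bounded[OF B] by blast
  show ?thesis
  proof (rule poly_boundedI)
    fix x
    have "norm (B (f x) (g x)) \<le> norm (f x) * norm (g x) * M"
      by (rule M)
    also have "\<dots> \<le> (K * (1 + norm x) ^ k) * (L * (1 + norm x) ^ l) * M"
      using f g M by (intro mult_mono) auto
    finally show "norm (B (f x) (g x)) \<le> (K * L * M) * (1 + norm x) ^ (k + l)"
      by (simp add: power_add algebra_simps)
  qed (intro bounded_bilinear.continuous_on[OF B] f g)
qed

lemma poly_bounded_linear:
  assumes T: "bounded_linear T" and "poly_bounded f"
  shows "poly_bounded (\<lambda>x. T (f x))"
proof -
  obtain K k where f: "continuous_on UNIV f" "0 \<le> K" "\<And>x. norm (f x) \<le> K * (1 + norm x) ^ k"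
    using poly_boundedE[OF assms(2)] by blast
  obtain M where M: "0 \<le> M" "\<And>a. norm (T a) \<le> norm a * M"
    using bounded_linear.nonneg_bounded[OF T] by blast
  show ?thesis
  proof (rule poly_boundedI)
    fix x
    have "norm (T (f x)) \<le> (K * (1 + norm x) ^ k) * M"
      using f(3)[of x] M by (meson mult_right_mono order_trans)
    then show "norm (T (f x)) \<le> (K * M) * (1 + norm x) ^ k"
      by (simp add: algebra_simps)
  qed (intro bounded_linear.continuous_on[OF T] f)
qed

lemma poly_bounded_coord: "poly_bounded (\<lambda>x::real^'n::finite. x $ k)"
proof (rule poly_boundedI)
  show "norm (x $ k) \<le> 1 * (1 + norm x) ^ 1" for x :: "real^'n"
    using component_le_norm_cart[of x k] by simp
qed (intro continuous_intros)

lemma poly_bounded_bounded: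
  assumes "continuous_on UNIV f" "bounded (range f)"
  shows "poly_bounded f"
proof -
  obtain K where "\<And>x. norm (f x) \<le> K"
    using assms(2) by (auto simp: bounded_iff)
  then show ?thesis
    by (intro poly_boundedI[where K = K and k = 0] assms) auto
qed

text \<open>The mean value inequality on the ball of radius \<open>norm x\<close> raises the degree
  by one. It is needed because the standing assumptions bound derivatives only, not the potentials
  themselves.\<close>

lemma poly_bounded_from_pd:
  fixes f :: "real^'n::finite \<Rightarrow> 'b::real_normed_vector"
  assumes diff: "\<And>x. f differentiable (at x)" and pd: "\<And>j. poly_bounded (pd j f)"
  shows "poly_bounded f"
proof -
  have "\<exists>K k. 0 \<le> K \<and> (\<forall>x. norm (pd j f x) \<le> K * (1 + norm x) ^ k)" for j
    using pd by (metis poly_boundedE)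
  then obtain K k where K: "\<And>j. 0 \<le> K j" "\<And>j x. norm (pd j f x) \<le> K j * (1 + norm x) ^ k j"
    by metis
  define L where "L = (\<Sum>j\<in>UNIV. K j)"
  define l where "l = (\<Sum>j\<in>UNIV. k j)"
  have L: "0 \<le> L"
    unfolding L_def by (intro sum_nonneg K)
  have der: "norm (\<Sum>j\<in>UNIV. h $ j *\<^sub>R pd j f y) \<le> L * (1 + norm x) ^ l * norm h"
    if "norm y \<le> norm x" for h x y
  proof -
    have "norm (\<Sum>j\<in>UNIV. h $ j *\<^sub>R pd j f y) \<le> (\<Sum>j\<in>UNIV. norm (h $ j *\<^sub>R pd j f y))"
      by (rule norm_sum)
    also have "\<dots> \<le> (\<Sum>j\<in>UNIV. norm h * (K j * (1 + norm x) ^ l))"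
    proof (rule sum_mono)
      fix j
      have "K j * (1 + norm y) ^ k j \<le> K j * (1 + norm x) ^ k j"
        using K that by (intro mult_left_mono power_mono) auto
      also have "\<dots> \<le> K j * (1 + norm x) ^ l"
        using K by (intro mult_left_mono power_increasing) (auto simp: l_def member_le_sum)
      finally have "norm (pd j f y) \<le> K j * (1 + norm x) ^ l"
        using K(2)[of j y] by linarith
      then show "norm (h $ j *\<^sub>R pd j f y) \<le> norm h * (K j * (1 + norm x) ^ l)"
        using component_le_norm_cart[of h j] by (auto intro!: mult_mono)
    qed
    also have "\<dots> = L * (1 + norm x) ^ l * norm h"
      by (simp add: L_def sum_distrib_left sum_distrib_right mult_ac)
    finally show ?thesis .
  qed
  show ?thesis
  proof (rule poly_boundedI)
    show "continuous_on UNIV f"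
      using diff by (simp add: continuous_on_eq_continuous_at differentiable_imp_continuous_within)
    fix x
    have "norm (f x - f 0) \<le> (L * (1 + norm x) ^ l) * norm (x - 0)"
    proof (rule differentiable_bound[where S = "cball 0 (norm x)"
          and f' = "\<lambda>y h. \<Sum>j\<in>UNIV. h $ j *\<^sub>R pd j f y"])
      show "(f has_derivative (\<lambda>h. \<Sum>j\<in>UNIV. h $ j *\<^sub>R pd j f y)) (at y within cball 0 (norm x))" for y
        using has_derivative_pd[OF diff] by (rule has_derivative_at_withinI)
      show "onorm (\<lambda>h. \<Sum>j\<in>UNIV. h $ j *\<^sub>R pd j f y) \<le> L * (1 + norm x) ^ l"
        if "y \<in> cball 0 (norm x)" for y
        using der[of y x] that by (intro onorm_le) auto
    qed auto
    then have "norm (f x) \<le> norm (f 0) + L * (1 + norm x) ^ l * norm x"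
      using norm_triangle_sub[of "f x" "f 0"] by simp
    also have "\<dots> \<le> norm (f 0) * (1 + norm x) ^ Suc l + L * (1 + norm x) ^ Suc l"
    proof (rule add_mono)
      show "norm (f 0) \<le> norm (f 0) * (1 + norm x) ^ Suc l"
        using mult_left_mono[OF one_le_power[of "1 + norm x" "Suc l"], of "norm (f 0)"] by simp
      have "(1 + norm x) ^ l * norm x \<le> (1 + norm x) ^ l * (1 + norm x)"
        by (intro mult_left_mono) auto
      from mult_left_mono[OF this L]
      show "L * (1 + norm x) ^ l * norm x \<le> L * (1 + norm x) ^ Suc l"
        by (simp add: mult_ac)
    qed
    finally show "norm (f x) \<le> (norm (f 0) + L) * (1 + norm x) ^ Suc l"
      by (simp add: algebra_simps)
  qed
qed

text \<open>The index counts the integrations by parts that a function admits. Total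
  differentiability at each stage keeps the product rule for \<open>pd\<close> available.\<close>

primrec tame :: "nat \<Rightarrow> (real^'n::finite \<Rightarrow> 'b::real_normed_vector) \<Rightarrow> bool" where
  "tame 0 f \<longleftrightarrow> poly_bounded f"
| "tame (Suc n) f \<longleftrightarrow> poly_bounded f \<and> (\<forall>x. f differentiable (at x)) \<and> (\<forall>j. tame n (pd j f))"

lemma tame_poly_bounded: "tame n f \<Longrightarrow> poly_bounded f"
  by (cases n) auto

lemma tame_SucD: "tame (Suc n) f \<Longrightarrow> tame n f"
  by (induction n arbitrary: f) auto

lemma tame_le: "tame n f \<Longrightarrow> m \<le> n \<Longrightarrow> tame m f"
proof (induction n)
  case (Suc n)
  then show ?case
    using tame_SucD[of n f] by (cases "m = Suc n") auto
qed auto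

lemma tame_differentiable: "tame (Suc n) f \<Longrightarrow> f differentiable (at x)"
  by simp

lemma tame_pd: "tame (Suc n) f \<Longrightarrow> tame n (pd j f)"
  by simp

lemma tame_const: "tame n (\<lambda>x. c)"
  by (induction n arbitrary: c) (auto simp: poly_bounded_const)

lemma tame_coord: "tame n (\<lambda>x. x $ k)"
  by (cases n) (auto simp: poly_bounded_coord pd_coord tame_const
      intro!: linear_imp_differentiable bounded_linear.linear[OF bounded_linear_vec_nth])

lemma tame_add: "tame n f \<Longrightarrow> tame n g \<Longrightarrow> tame n (\<lambda>x. f x + g x)"
proof (induction n arbitrary: f g)
  case (Suc n)
  then have "pd j (\<lambda>x. f x + g x) = (\<lambda>x. pd j f x + pd j g x)" for j
    by (auto simp: pd_add)
  with Suc show ?case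
    by (auto intro: poly_bounded_add)
qed (auto intro: poly_bounded_add)

lemma tame_linear:
  assumes T: "bounded_linear T"
  shows "tame n f \<Longrightarrow> tame n (\<lambda>x. T (f x))"
proof (induction n arbitrary: f)
  case (Suc n)
  have "tame n (\<lambda>x. T (pd j f x))" for j
    using Suc by simp
  moreover have "pd j (\<lambda>x. T (f x)) = (\<lambda>x. T (pd j f x))" for j
    using Suc.prems by (intro ext pd_bounded_linear[OF T]) simp
  moreover have "f differentiable (at x)" for x
    using Suc.prems by simp
  then have "(\<lambda>x. T (f x)) differentiable (at x)" for x
    by (intro differentiableI[OF bounded_linear.has_derivative[OF T has_derivative_pd]])
  ultimately show ?case
    using poly_bounded_linear[OF T, of f] Suc.prems by simp
qed (auto intro: poly_bounded_linear[OF T])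

lemma tame_bilinear:
  assumes B: "bounded_bilinear B"
  shows "tame n f \<Longrightarrow> tame n g \<Longrightarrow> tame n (\<lambda>x. B (f x) (g x))"
proof (induction n arbitrary: f g)
  case (Suc n)
  have fg: "tame n f" "tame n g"
    using Suc.prems by (auto intro: tame_SucD)
  have "tame n (\<lambda>x. B (f x) (pd j g x) + B (pd j f x) (g x))" for j
    using Suc.prems by (intro tame_add Suc.IH fg) auto
  moreover have "pd j (\<lambda>x. B (f x) (g x)) = (\<lambda>x. B (f x) (pd j g x) + B (pd j f x) (g x))" for j
    using Suc.prems by (intro ext pd_bilinear[OF B]) auto
  moreover have "f differentiable (at x)" "g differentiable (at x)" for x
    using Suc.prems by auto
  then have "(\<lambda>x. B (f x) (g x)) differentiable (at x)" for x
    by (intro differentiableI[OF bounded_bilinear.FDERIV[OF B has_derivative_pd has_derivative_pd]])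
  ultimately show ?case
    using poly_bounded_bilinear[OF B, of f g] Suc.prems by simp
qed (auto intro: poly_bounded_bilinear[OF B])

lemma tame_sum: "(\<And>i. i \<in> S \<Longrightarrow> tame n (f i)) \<Longrightarrow> tame n (\<lambda>x. \<Sum>i\<in>S. f i x)"
  by (induction S rule: infinite_finite_induct) (auto intro: tame_add tame_const)

lemma tame_minus: "tame n f \<Longrightarrow> tame n (\<lambda>x. - f x)"
  by (rule tame_linear[OF bounded_linear_minus[OF bounded_linear_ident]])

lemma tame_diff: "tame n f \<Longrightarrow> tame n g \<Longrightarrow> tame n (\<lambda>x. f x - g x)"
  using tame_add[OF _ tame_minus, of n f g] by simp

lemmas tame_mult = tame_bilinear[OF bounded_bilinear_mult]
lemmas tame_scaleR = tame_bilinear[OF bounded_bilinear_scaleR]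
lemmas tame_of_real = tame_linear[OF bounded_linear_of_real]
lemmas tame_nth = tame_linear[OF bounded_linear_vec_nth]
lemmas tame_intros = tame_const tame_coord tame_add tame_diff tame_minus tame_mult tame_scaleR
  tame_of_real tame_nth tame_sum

lemma pd_coord_scaleR:
  assumes "f differentiable (at x)"
  shows "pd m (\<lambda>x. x $ k *\<^sub>R f x) x = x $ k *\<^sub>R pd m f x + (if k = m then f x else 0)"
  using pd_bilinear[OF bounded_bilinear_scaleR _ assms, of "\<lambda>x. x $ k" m]
    linear_imp_differentiable[OF bounded_linear.linear[OF bounded_linear_vec_nth], of k "at x"]
  by (simp add: pd_coord)

text \<open>Evaluating the average of a vector or a matrix entry by entry requires integrability of
  the whole function; this supplies it from the entries.\<close>

lemma poly_bounded_vec: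
  fixes f :: "'a::real_normed_vector \<Rightarrow> 'b::real_normed_vector^'m::finite"
  assumes "\<And>i. poly_bounded (\<lambda>x. f x $ i)"
  shows "poly_bounded f"
proof -
  have "\<exists>K k. 0 \<le> K \<and> (\<forall>x. norm (f x $ i) \<le> K * (1 + norm x) ^ k)" for i
    using poly_boundedE[OF assms[of i]] by metis
  then obtain K k where K: "\<And>i. 0 \<le> K i" "\<And>i x. norm (f x $ i) \<le> K i * (1 + norm x) ^ k i"
    by metis
  show ?thesis
  proof (rule poly_boundedI)
    have "continuous_on UNIV (\<lambda>x. \<chi> i. f x $ i)"
      using assms by (intro continuous_on_vec_lambda) (auto simp: poly_bounded_def)
    then show "continuous_on UNIV f"
      by simp
    fix x
    have "norm (f x) \<le> (\<Sum>i\<in>UNIV. norm (f x $ i))"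
      unfolding norm_vec_def by (rule L2_set_le_sum) auto
    also have "\<dots> \<le> (\<Sum>i\<in>UNIV. K i * (1 + norm x) ^ (\<Sum>i\<in>UNIV. k i))"
    proof (rule sum_mono)
      fix i
      have "K i * (1 + norm x) ^ k i \<le> K i * (1 + norm x) ^ (\<Sum>i\<in>UNIV. k i)"
        using K by (intro mult_left_mono power_increasing member_le_sum) auto
      then show "norm (f x $ i) \<le> K i * (1 + norm x) ^ (\<Sum>i\<in>UNIV. k i)"
        using K(2)[of x i] by linarith
    qed
    finally show "norm (f x) \<le> (\<Sum>i\<in>UNIV. K i) * (1 + norm x) ^ (\<Sum>i\<in>UNIV. k i)"
      by (simp add: sum_distrib_right)
  qed
qed

lemma pd_of_real:
  fixes f :: "real^'n::finite \<Rightarrow> real"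
  assumes "\<And>x. f differentiable (at x)"
  shows "pd k (\<lambda>x. complex_of_real (f x)) = (\<lambda>x. of_real (pd k f x))"
  using pd_bounded_linear[OF bounded_linear_of_real assms] by auto

lemma sum_axis_complex: "(\<Sum>j\<in>UNIV. f j * complex_of_real (axis k 1 $ j)) = f k"
proof -
  have "f j * complex_of_real (axis k 1 $ j) = (if j = k then f j else 0)" for j
    by (auto simp: axis_def)
  then show ?thesis
    by simp
qed

lemmas has_derivative_coord = bounded_linear_imp_has_derivative[OF bounded_linear_vec_nth]

text \<open>The polynomials of \<open>tangent_space\<close>, expanded about the origin. Averages are
  computed with \<open>quad\<close> instead, which is centred at q.\<close>

definition quadratic :: "complex \<Rightarrow> complex^'n \<Rightarrow> complex^'n^'n \<Rightarrow> real^'n::finite \<Rightarrow> complex" where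
  "quadratic a b M x = a + (\<Sum>j\<in>UNIV. b $ j * of_real (x $ j))
     + (\<Sum>j\<in>UNIV. \<Sum>k\<in>UNIV. M $ j $ k * of_real (x $ j) * of_real (x $ k))"

lemma quadratic_tame: "tame n (quadratic a b M)"
  unfolding quadratic_def by (intro tame_intros)

lemma tangent_space_eq: "tangent_space u = {\<lambda>x. quadratic a b M x * u x | a b M. True}"
  unfolding tangent_space_def quadratic_def ..

text \<open>The common interface of three functionals: the average, the average of a first partial
  derivative and that of a second one. The potential part of the Hamiltonian is then split into
  summands once for all three.\<close>

definition tame2_linear :: "((real^'n::finite \<Rightarrow> complex) \<Rightarrow> complex) \<Rightarrow> bool" where
  "tame2_linear L \<longleftrightarrow>
    (\<forall>f g. tame 2 f \<longrightarrow> tame 2 g \<longrightarrow> L (\<lambda>x. f x + g x) = L f + L g) \<and>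
    (\<forall>c f. tame 2 f \<longrightarrow> L (\<lambda>x. c * f x) = c * L f)"

lemma tame2_linearD:
  assumes "tame2_linear L"
  shows "tame 2 f \<Longrightarrow> tame 2 g \<Longrightarrow> L (\<lambda>x. f x + g x) = L f + L g"
    and "tame 2 f \<Longrightarrow> L (\<lambda>x. c * f x) = c * L f"
    and "tame 2 f \<Longrightarrow> tame 2 g \<Longrightarrow> L (\<lambda>x. f x - g x) = L f - L g"
    and "(\<And>i. i \<in> S \<Longrightarrow> tame 2 (F i)) \<Longrightarrow> L (\<lambda>x. \<Sum>i\<in>S. F i x) = (\<Sum>i\<in>S. L (F i))"
proof -
  show add: "tame 2 f \<Longrightarrow> tame 2 g \<Longrightarrow> L (\<lambda>x. f x + g x) = L f + L g"
    and scale: "tame 2 f \<Longrightarrow> L (\<lambda>x. c * f x) = c * L f" for f g c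
    using assms unfolding tame2_linear_def by blast+
  show "tame 2 f \<Longrightarrow> tame 2 g \<Longrightarrow> L (\<lambda>x. f x - g x) = L f - L g"
    using add[of f "\<lambda>x. (-1) * g x"] scale[of g "-1"] tame_mult[OF tame_const, of 2 g "-1"] by simp
  have zero: "L (\<lambda>x. 0) = 0"
    using scale[OF tame_const, of 0 0] by simp
  show "(\<And>i. i \<in> S \<Longrightarrow> tame 2 (F i)) \<Longrightarrow> L (\<lambda>x. \<Sum>i\<in>S. F i x) = (\<Sum>i\<in>S. L (F i))"
    by (induction S rule: infinite_finite_induct) (auto simp: zero add tame_sum)
qed

lemma jac_nth: "jac A x $ j $ m = pd m A x $ j"
  by (simp add: jac_def jacobian_def matrix_def pd_def)

lemma pd_nth:
  assumes "A differentiable (at x)"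
  shows "pd m (\<lambda>y. A y $ j) x = pd m A x $ j"
  by (rule pd_bounded_linear[OF bounded_linear_vec_nth assms])

lemma trace_transpose_eq: "trace (transpose X) = trace X"
  by (simp add: trace_def transpose_def)

lemma matrix_vector_nth: "(M *v v) $ j = (\<Sum>k\<in>UNIV. M $ j $ k * v $ k)"
  by (simp add: matrix_vector_mult_def)

section \<open>Averages over a wave packet\<close>

text \<open>The exponent \<open>(real k)\<^sup>2 / (4 * c)\<close> is the maximum of k r - c r^2
  over r; the inequality behind it is (2 c r - k)^2 \<ge> 0.\<close>

lemma power_le_exp_square:
  fixes c r :: real
  assumes "0 < c" "0 \<le> r"
  shows "(1 + r) ^ k \<le> exp ((real k)\<^sup>2 / (4 * c)) * exp (c * r\<^sup>2)"
proof -
  have "(1 + r) ^ k \<le> exp r ^ k"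
    using assms by (intro power_mono exp_ge_add_one_self) auto
  also have "\<dots> = exp (real k * r)"
    by (simp add: exp_of_nat_mult)
  also have "real k * r \<le> (real k)\<^sup>2 / (4 * c) + c * r\<^sup>2"
    using zero_le_power2[of "2 * c * r - real k"] assms(1)
    by (simp add: field_simps power2_eq_square)
  then have "exp (real k * r) \<le> exp ((real k)\<^sup>2 / (4 * c)) * exp (c * r\<^sup>2)"
    by (simp flip: exp_add)
  finally show ?thesis .
qed

lemma positive_definite_invertible:
  fixes G :: "real^'n::finite^'n"
  assumes pos: "\<And>v. v \<noteq> 0 \<Longrightarrow> 0 < v \<bullet> (G *v v)"
  shows "invertible G"
proof -
  have "v = 0" if "G *v v = 0" for v
  proof (rule ccontr)
    assume "v \<noteq> 0"
    from pos[OF this] that show False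
      by simp
  qed
  then have "\<exists>B. B ** G = mat 1"
    by (simp only: matrix_left_invertible_ker) simp
  then show ?thesis
    by (simp only: invertible_left_inverse)
qed

text \<open>The minimum over the compact unit sphere is positive, and homogeneity of degree two
  carries it to all vectors.\<close>

lemma coercive_matrix:
  fixes G :: "real^'n::finite^'n"
  assumes "\<And>v. v \<noteq> 0 \<Longrightarrow> 0 < v \<bullet> (G *v v)"
  obtains c where "0 < c" "\<And>v. c * (norm v)\<^sup>2 \<le> v \<bullet> (G *v v)"
proof -
  let ?f = "\<lambda>v::real^'n. v \<bullet> (G *v v)"
  have "continuous_on (sphere 0 1) ?f"
    by (intro continuous_intros matrix_vector_mult_linear_continuous_on)
  moreover have "sphere (0::real^'n) 1 \<noteq> {}"
    by simp
  ultimately obtain w where w: "w \<in> sphere 0 1" "\<And>v. v \<in> sphere 0 1 \<Longrightarrow> ?f w \<le> ?f v"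
    using continuous_attains_inf[of "sphere (0::real^'n) 1" ?f] by auto
  have "?f w * (norm v)\<^sup>2 \<le> ?f v" for v
  proof (cases "v = 0")
    case False
    then have "?f w \<le> ?f (v /\<^sub>R norm v)"
      by (intro w(2)) simp
    also have "?f (v /\<^sub>R norm v) = ?f v / (norm v)\<^sup>2"
      by (simp add: matrix_vector_mult_scaleR power2_eq_square divide_inverse)
    finally show ?thesis
      using False by (simp add: field_simps)
  qed auto
  moreover have "0 < ?f w"
    using w(1) by (intro assms) auto
  ultimately show ?thesis
    using that by blast
qed

text \<open>One half of the rate absorbs the polynomial factor through
  \<open>power_le_exp_square\<close>; the other half remains as decay.\<close>

lemma exp_quadratic_gaussian_decay:
  fixes Q :: "'a::real_inner \<Rightarrow> real" and f :: "'a \<Rightarrow> 'b::real_normed_vector"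
  assumes c: "0 < c" and Q: "\<And>x. c * (norm x)\<^sup>2 - K \<le> Q x" and f: "poly_bounded f"
  shows "gaussian_decay (\<lambda>x. exp (- Q x) *\<^sub>R f x)"
proof -
  obtain L k where L: "0 \<le> L" "\<And>x. norm (f x) \<le> L * (1 + norm x) ^ k"
    using poly_boundedE[OF f] by blast
  define M where "M = exp ((real k)\<^sup>2 / (4 * (c/2)))"
  have "norm (exp (- Q x) *\<^sub>R f x) \<le> (exp K * L * M) * exp (- (c/2) * (norm x)\<^sup>2)" for x
  proof -
    have "norm (exp (- Q x) *\<^sub>R f x) = exp (- Q x) * norm (f x)"
      by simp
    also have "\<dots> \<le> exp (K - c * (norm x)\<^sup>2) * (L * (M * exp (c/2 * (norm x)\<^sup>2)))"
    proof (intro mult_mono)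
      have "(1 + norm x) ^ k \<le> M * exp (c/2 * (norm x)\<^sup>2)"
        unfolding M_def using c by (intro power_le_exp_square) auto
      then show "norm (f x) \<le> L * (M * exp (c/2 * (norm x)\<^sup>2))"
        using L by (meson mult_left_mono order_trans)
    qed (use Q[of x] in auto)
    also have "\<dots> = (exp K * L * M) * (exp (- c * (norm x)\<^sup>2) * exp (c/2 * (norm x)\<^sup>2))"
      by (simp add: exp_diff exp_minus field_simps)
    also have "exp (- c * (norm x)\<^sup>2) * exp (c/2 * (norm x)\<^sup>2) = exp (- (c/2) * (norm x)\<^sup>2)"
      by (simp flip: exp_add add: field_simps)
    finally show ?thesis .
  qed
  then show ?thesis
    unfolding gaussian_decay_def using c by (intro exI[of _ "exp K * L * M"] exI[of _ "c/2"]) auto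
qed

lemma sum_axis:
  fixes g :: "'n::finite \<Rightarrow> 'b::real_vector"
  shows "(\<Sum>j\<in>UNIV. axis k 1 $ j *\<^sub>R g j) = g k" "(\<Sum>j\<in>UNIV. axis k 1 $ j * f j) = (f k :: real)"
proof -
  have "axis k 1 $ j *\<^sub>R g j = (if j = k then g j else 0)"
    "axis k 1 $ j * f j = (if j = k then f j else 0)" for j
    by (auto simp: axis_def)
  then show "(\<Sum>j\<in>UNIV. axis k 1 $ j *\<^sub>R g j) = g k" "(\<Sum>j\<in>UNIV. axis k 1 $ j * f j) = f k"
    by simp_all
qed

lemma width_matrix_sym: "width_matrix C \<Longrightarrow> C $ j $ k = C $ k $ j"
  unfolding width_matrix_def transpose_def by (metis vec_lambda_beta)

section \<open>The Gaussian weight of a wave packet\<close>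

locale wave_packet =
  fixes \<epsilon> :: real and q p :: "real^'n::finite" and C :: "complex^'n^'n" and \<zeta> :: complex
  assumes eps: "0 < \<epsilon>" and width: "width_matrix C"
begin

abbreviation u :: "real^'n \<Rightarrow> complex" where "u \<equiv> gwp \<epsilon> q p C \<zeta>"
abbreviation G :: "real^'n^'n" where "G \<equiv> map_matrix Im C"
abbreviation Gi :: "real^'n^'n" where "Gi \<equiv> matrix_inv G"
abbreviation E :: "(real^'n \<Rightarrow> 'b::{banach, second_countable_topology}) \<Rightarrow> 'b" where "E \<equiv> avg u"

text \<open>Up to the factor -2 / \<epsilon> this is the logarithmic derivative of the weight, so
  integration by parts takes its simplest form for these combinations of coordinates.\<close>

definition slope :: "'n \<Rightarrow> real^'n \<Rightarrow> real" where
  "slope k x = (\<Sum>m\<in>UNIV. G $ k $ m * (x $ m - q $ m))"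

lemma C_sym: "C $ j $ k = C $ k $ j"
  by (rule width_matrix_sym[OF width])

lemma G_pos: "v \<noteq> 0 \<Longrightarrow> 0 < v \<bullet> (G *v v)"
  using width unfolding width_matrix_def by blast

lemma invertible_G: "invertible G"
  by (rule positive_definite_invertible[OF G_pos])

lemma matrix_inv_inverse: "G ** Gi = mat 1" "Gi ** G = mat 1"
  using someI_ex[OF invertible_G[unfolded invertible_def]] by (auto simp: matrix_inv_def)

lemma G_Gi: "(\<Sum>m\<in>UNIV. G $ k $ m * Gi $ m $ l) = (if k = l then 1 else 0)"
proof -
  have "(G ** Gi) $ k $ l = (mat 1 :: real^'n^'n) $ k $ l"
    by (simp only: matrix_inv_inverse)
  then show ?thesis
    by (simp add: matrix_matrix_mult_def mat_def)
qed

lemma Gi_G: "(\<Sum>m\<in>UNIV. Gi $ k $ m * G $ m $ l) = (if k = l then 1 else 0)"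
proof -
  have "(Gi ** G) $ k $ l = (mat 1 :: real^'n^'n) $ k $ l"
    by (simp only: matrix_inv_inverse)
  then show ?thesis
    by (simp add: matrix_matrix_mult_def mat_def)
qed

lemma weight_eq:
  "(cmod (u x))\<^sup>2 = exp (- (((x - q) \<bullet> (G *v (x - q))) / \<epsilon> + 2 * Im \<zeta> / \<epsilon>))"
proof -
  have *: "Re (\<i> / of_real \<epsilon> * z) = - (Im z / \<epsilon>)" for z
    by (simp add: Re_divide_of_real flip: times_divide_eq_left)
      (simp add: field_simps Re_divide_of_real)
  define S where "S = (\<Sum>j\<in>UNIV. \<Sum>k\<in>UNIV. of_real ((x - q) $ j) * C $ j $ k * of_real ((x - q) $ k))"
  have S: "Im S = (x - q) \<bullet> (G *v (x - q))"
    by (simp add: S_def inner_vec_def matrix_vector_mult_def sum_distrib_left mult.assoc)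
  have "u x = exp (\<i> / of_real \<epsilon> * (1/2 * S + of_real ((x - q) \<bullet> p) + \<zeta>))"
    by (simp add: gwp_def S_def)
  then have "cmod (u x) = exp (- (((x - q) \<bullet> (G *v (x - q)) / 2 + Im \<zeta>) / \<epsilon>))"
    by (simp only: norm_exp_eq_Re *) (simp add: S)
  then have "(cmod (u x))\<^sup>2 = exp (2 * - (((x - q) \<bullet> (G *v (x - q)) / 2 + Im \<zeta>) / \<epsilon>))"
    by (simp only: exp_double)
  then show ?thesis
    by (simp add: add_divide_distrib)
qed

lemma weight_exponent_ge:
  obtains c K where "0 < c"
    "\<And>x. c * (norm x)\<^sup>2 - K \<le> ((x - q) \<bullet> (G *v (x - q))) / \<epsilon> + 2 * Im \<zeta> / \<epsilon>"
proof -
  obtain c where c: "0 < c" "\<And>v. c * (norm v)\<^sup>2 \<le> v \<bullet> (G *v v)"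
    using coercive_matrix[OF G_pos] by blast
  \<comment> \<open>The subtracted constant collects the cost of moving the centre from q to the
    origin and the normalising factor given by \<open>Im \<zeta>\<close>.\<close>
  have "c / (2 * \<epsilon>) * (norm x)\<^sup>2 - (c / \<epsilon> * (norm q)\<^sup>2 - 2 * Im \<zeta> / \<epsilon>)
      \<le> ((x - q) \<bullet> (G *v (x - q))) / \<epsilon> + 2 * Im \<zeta> / \<epsilon>" for x
  proof -
    have "(norm x)\<^sup>2 / 2 - (norm q)\<^sup>2 \<le> (norm (x - q))\<^sup>2"
      using norm_square_translate_ge[of x "- q"] by simp
    then have "c * ((norm x)\<^sup>2 / 2 - (norm q)\<^sup>2) \<le> (x - q) \<bullet> (G *v (x - q))"
      using c(2)[of "x - q"] mult_left_mono[of _ _ c] c(1) by (meson less_imp_le order_trans)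
    then have "c * ((norm x)\<^sup>2 / 2 - (norm q)\<^sup>2) / \<epsilon> \<le> ((x - q) \<bullet> (G *v (x - q))) / \<epsilon>"
      using eps by (intro divide_right_mono) auto
    then show ?thesis
      using eps by (simp add: field_simps)
  qed
  moreover have "0 < c / (2 * \<epsilon>)"
    using c eps by simp
  ultimately show ?thesis
    using that by blast
qed

lemma weight_decay:
  assumes "poly_bounded f"
  shows "gaussian_decay (\<lambda>x. (cmod (u x))\<^sup>2 *\<^sub>R f x)"
proof -
  obtain c K where "0 < c"
    "\<And>x. c * (norm x)\<^sup>2 - K \<le> ((x - q) \<bullet> (G *v (x - q))) / \<epsilon> + 2 * Im \<zeta> / \<epsilon>"
    using weight_exponent_ge by blast
  then show ?thesis
    unfolding weight_eq by (rule exp_quadratic_gaussian_decay[OF _ _ assms])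
qed

lemma weight_has_derivative:
  "((\<lambda>x. (cmod (u x))\<^sup>2) has_derivative
     (\<lambda>h. \<Sum>k\<in>UNIV. h $ k * (- (2 / \<epsilon>) * slope k x * (cmod (u x))\<^sup>2))) (at x)"
proof -
  have G_sym: "w \<bullet> (G *v h) = h \<bullet> (G *v w)" for w h
  proof -
    have "transpose G = G"
      using C_sym by (simp add: transpose_def vec_eq_iff)
    then show ?thesis
      by (metis dot_lmul_matrix inner_commute vector_transpose_matrix)
  qed
  have "h \<bullet> (G *v (x - q)) = (\<Sum>k\<in>UNIV. h $ k * slope k x)" for h
    by (simp add: inner_vec_def matrix_vector_mult_def slope_def)
  note eq = this
  have "((\<lambda>x. x - q) has_derivative (\<lambda>h. h)) (at x)"
    by (auto intro!: derivative_eq_intros)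
  then have mul: "((\<lambda>x. G *v (x - q)) has_derivative (\<lambda>h. G *v h)) (at x)"
    by (rule bounded_linear.has_derivative[OF matrix_vector_mul_bounded_linear])
  have "((\<lambda>x. (x - q) \<bullet> (G *v (x - q))) has_derivative
      (\<lambda>h. (x - q) \<bullet> (G *v h) + h \<bullet> (G *v (x - q)))) (at x)"
    by (rule has_derivative_inner) (auto intro!: derivative_eq_intros mul)
  then have Q: "((\<lambda>x. (x - q) \<bullet> (G *v (x - q))) has_derivative
      (\<lambda>h. 2 * (\<Sum>k\<in>UNIV. h $ k * slope k x))) (at x)"
    by (simp only: G_sym[of "x - q"] eq mult_2)
  define Qf where "Qf x = (x - q) \<bullet> (G *v (x - q))" for x
  have "((\<lambda>x. exp (- (Qf x / \<epsilon> + 2 * Im \<zeta> / \<epsilon>))) has_derivative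
      (\<lambda>h. exp (- (Qf x / \<epsilon> + 2 * Im \<zeta> / \<epsilon>)) * - (2 * (\<Sum>k\<in>UNIV. h $ k * slope k x) / \<epsilon>))) (at x)"
    using Q[folded Qf_def] eps by (auto intro!: derivative_eq_intros)
  then show ?thesis
    unfolding weight_eq Qf_def
    by (rule has_derivative_eq_rhs)
      (simp add: fun_eq_iff sum_distrib_left sum_distrib_right sum_negf[symmetric] sum_divide_distrib mult_ac)
qed

lemma weight_continuous: "continuous_on S (\<lambda>x. (cmod (u x))\<^sup>2)"
  using weight_has_derivative
  by (meson continuous_at_imp_continuous_on has_derivative_continuous)

lemma weight_integrable:
  fixes f :: "real^'n \<Rightarrow> 'b::{banach, second_countable_topology}"
  assumes "poly_bounded f"
  shows "integrable lborel (\<lambda>x. (cmod (u x))\<^sup>2 *\<^sub>R f x)"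
  using assms weight_decay[OF assms]
  by (intro gaussian_decay_integrable continuous_intros weight_continuous) (auto simp: poly_bounded_def)

lemma E_add: "poly_bounded f \<Longrightarrow> poly_bounded g \<Longrightarrow> E (\<lambda>x. f x + g x) = E f + E g"
  by (simp add: avg_def scaleR_add_right weight_integrable)

lemma E_linear:
  assumes "bounded_linear T" "poly_bounded f"
  shows "E (\<lambda>x. T (f x)) = T (E f)"
proof -
  have "E (\<lambda>x. T (f x)) = (LINT x|lborel. T ((cmod (u x))\<^sup>2 *\<^sub>R f x))"
    using linear_scale[OF bounded_linear.linear[OF assms(1)]] by (simp add: avg_def)
  also have "\<dots> = T (E f)"
    unfolding avg_def by (rule integral_bounded_linear[OF assms(1) weight_integrable[OF assms(2)]])
  finally show ?thesis .
qed

lemma E_sum: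
  assumes "\<And>i. i \<in> S \<Longrightarrow> poly_bounded (f i)"
  shows "E (\<lambda>x. \<Sum>i\<in>S. f i x) = (\<Sum>i\<in>S. E (f i))"
  unfolding avg_def scaleR_sum_right
  by (rule Bochner_Integration.integral_sum) (auto intro: weight_integrable assms)

lemma E_diff: "poly_bounded f \<Longrightarrow> poly_bounded g \<Longrightarrow> E (\<lambda>x. f x - g x) = E f - E g"
  by (simp add: avg_def scaleR_diff_right weight_integrable)

lemma E_scaleR: "poly_bounded f \<Longrightarrow> E (\<lambda>x. c *\<^sub>R f x) = c *\<^sub>R E f"
  by (rule E_linear[OF bounded_linear_scaleR_right])

lemma E_cmult: "poly_bounded f \<Longrightarrow> E (\<lambda>x. c * f x) = c * E f"
  for f :: "real^'n \<Rightarrow> complex"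
  by (rule E_linear[OF bounded_linear_mult_right])

lemma E_of_real: "poly_bounded f \<Longrightarrow> E (\<lambda>x. complex_of_real (f x)) = of_real (E f)"
  by (rule E_linear[OF bounded_linear_of_real])

lemma E_nth: "poly_bounded f \<Longrightarrow> E (\<lambda>x. f x $ k) = E f $ k"
  for f :: "real^'n \<Rightarrow> ('b::euclidean_space)^'m"
  by (rule E_linear[OF bounded_linear_vec_nth])

section \<open>Stein's identity and Gaussian moments\<close>

lemma slope_tame: "tame n (slope k)"
  unfolding slope_def by (intro tame_intros)

lemma pd_slope: "pd m (slope k) x = G $ k $ m"
proof -
  have "slope k = (\<lambda>x. G $ k \<bullet> (x - q))"
    by (auto simp: slope_def inner_vec_def)
  moreover have "((\<lambda>x. G $ k \<bullet> (x - q)) has_derivative (\<lambda>h. G $ k \<bullet> h)) (at x)"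
    by (auto intro!: derivative_eq_intros)
  ultimately show ?thesis
    by (simp add: pd_eqI inner_axis)
qed

text \<open>The derivative of weight times f along a coordinate axis integrates to zero, and the
  product rule splits it into the two averages that are compared. \<open>?D\<close> is that
  derivative.\<close>

lemma stein:
  fixes f :: "real^'n \<Rightarrow> 'b::{banach, second_countable_topology}"
  assumes "tame 1 f"
  shows "E (\<lambda>x. slope k x *\<^sub>R f x) = (\<epsilon> / 2) *\<^sub>R E (pd k f)"
proof -
  let ?D = "\<lambda>x. (cmod (u x))\<^sup>2 *\<^sub>R (pd k f x - (2 / \<epsilon>) *\<^sub>R slope k x *\<^sub>R f x)"
  have f: "poly_bounded f" "poly_bounded (pd k f)" "\<And>x. f differentiable (at x)"
    using assms by auto
  have sf: "poly_bounded (\<lambda>x. slope k x *\<^sub>R f x)"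
    using tame_scaleR[OF slope_tame, of 0 f k] f by simp
  have pb: "poly_bounded (\<lambda>x. pd k f x - (2 / \<epsilon>) *\<^sub>R slope k x *\<^sub>R f x)"
    using tame_diff[of 0 "pd k f" "\<lambda>x. (2 / \<epsilon>) *\<^sub>R slope k x *\<^sub>R f x"] f(2)
      poly_bounded_linear[OF bounded_linear_scaleR_right sf]
    by (simp only: tame.simps)
  have "integral\<^sup>L lborel ?D = 0"
  proof (rule integral_directional_derivative_zero)
    show "((\<lambda>x. (cmod (u x))\<^sup>2 *\<^sub>R f x) has_derivative
        (\<lambda>h. (cmod (u x))\<^sup>2 *\<^sub>R (\<Sum>j\<in>UNIV. h $ j *\<^sub>R pd j f x)
           + (\<Sum>k\<in>UNIV. h $ k * (- (2 / \<epsilon>) * slope k x * (cmod (u x))\<^sup>2)) *\<^sub>R f x)) (at x)" for x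
      by (rule has_derivative_scaleR[OF weight_has_derivative has_derivative_pd[OF f(3)]])
    show "?D x = (cmod (u x))\<^sup>2 *\<^sub>R (\<Sum>j\<in>UNIV. axis k 1 $ j *\<^sub>R pd j f x)
           + (\<Sum>j\<in>UNIV. axis k 1 $ j * (- (2 / \<epsilon>) * slope j x * (cmod (u x))\<^sup>2)) *\<^sub>R f x" for x
      by (simp only: sum_axis) (simp add: algebra_simps)
    show "gaussian_decay (\<lambda>x. (cmod (u x))\<^sup>2 *\<^sub>R f x)" "gaussian_decay ?D"
      using f pb by (auto intro: weight_decay)
  qed
  then have "E (\<lambda>x. pd k f x - (2 / \<epsilon>) *\<^sub>R slope k x *\<^sub>R f x) = 0"
    by (simp add: avg_def)
  then have "E (pd k f) = (2 / \<epsilon>) *\<^sub>R E (\<lambda>x. slope k x *\<^sub>R f x)"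
    using E_diff[OF f(2) poly_bounded_linear[OF bounded_linear_scaleR_right sf]] E_scaleR[OF sf]
    by (metis eq_iff_diff_eq_0)
  then show ?thesis
    using eps by simp
qed

lemma G_sym: "G $ j $ k = G $ k $ j"
  using C_sym by simp

lemma pd_slope_scaleR:
  assumes "f differentiable (at x)"
  shows "pd m (\<lambda>x. slope k x *\<^sub>R f x) x = slope k x *\<^sub>R pd m f x + G $ k $ m *\<^sub>R f x"
  using pd_bilinear[OF bounded_bilinear_scaleR tame_differentiable[OF slope_tame] assms]
  by (simp add: pd_slope)

lemma tame_slope_scaleR: "tame n f \<Longrightarrow> tame n (\<lambda>x. slope k x *\<^sub>R f x)"
  by (intro tame_scaleR slope_tame)

lemma E_tame_add: "tame n f \<Longrightarrow> tame n g \<Longrightarrow> E (\<lambda>x. f x + g x) = E f + E g"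
  by (intro E_add tame_poly_bounded)

lemma E_tame_scaleR: "tame n f \<Longrightarrow> E (\<lambda>x. c *\<^sub>R f x) = c *\<^sub>R E f"
  by (intro E_scaleR tame_poly_bounded)

lemma stein_pd:
  fixes f :: "real^'n \<Rightarrow> 'b::{banach, second_countable_topology}"
  assumes "tame 1 f"
  shows "E (pd k f) = (2 / \<epsilon>) *\<^sub>R E (\<lambda>x. slope k x *\<^sub>R f x)"
  using stein[OF assms] eps by simp

text \<open>The second integration by parts also hits the remaining slope, whose gradient is a
  constant row of G; this is the origin of the zeroth-order term.\<close>

lemma stein2:
  fixes f :: "real^'n \<Rightarrow> 'b::{banach, second_countable_topology}"
  assumes "tame 2 f"
  shows "E (\<lambda>x. slope k x *\<^sub>R slope l x *\<^sub>R f x)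
    = (\<epsilon> / 2)\<^sup>2 *\<^sub>R E (pd l (pd k f)) + (\<epsilon> / 2 * G $ k $ l) *\<^sub>R E f"
proof -
  have f: "tame 1 f" "tame 0 f" "tame 1 (pd k f)" "tame 0 (pd k f)"
    using assms by (auto simp: numeral_2_eq_2)
  have "E (\<lambda>x. slope k x *\<^sub>R slope l x *\<^sub>R f x) = (\<epsilon> / 2) *\<^sub>R E (pd k (\<lambda>x. slope l x *\<^sub>R f x))"
    by (intro stein tame_slope_scaleR f)
  also have "pd k (\<lambda>x. slope l x *\<^sub>R f x) = (\<lambda>x. slope l x *\<^sub>R pd k f x + G $ l $ k *\<^sub>R f x)"
    using f by (intro ext pd_slope_scaleR) auto
  also have "E \<dots> = E (\<lambda>x. slope l x *\<^sub>R pd k f x) + E (\<lambda>x. G $ l $ k *\<^sub>R f x)"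
    by (intro E_tame_add[of 0] tame_slope_scaleR f tame_scaleR tame_const)
  also have "\<dots> = (\<epsilon> / 2) *\<^sub>R E (pd l (pd k f)) + G $ k $ l *\<^sub>R E f"
    using stein[OF f(3), of l] E_tame_scaleR[OF f(2), of "G $ l $ k"] G_sym[of k l] by simp
  finally show ?thesis
    by (simp add: scaleR_add_right power2_eq_square)
qed

lemma stein2_pd:
  fixes f :: "real^'n \<Rightarrow> 'b::{banach, second_countable_topology}"
  assumes "tame 2 f"
  shows "E (pd l (pd k f))
    = (2 / \<epsilon>)\<^sup>2 *\<^sub>R E (\<lambda>x. slope k x *\<^sub>R slope l x *\<^sub>R f x) - (2 / \<epsilon> * G $ k $ l) *\<^sub>R E f"
  unfolding stein2[OF assms] using eps by (simp add: scaleR_add_right power2_eq_square)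

text \<open>In \<open>stein2_pd\<close> the right-hand side is symmetric in k and l, because
  products of slopes commute and G is symmetric. This takes the place of Schwarz's theorem.\<close>

lemma E_hess_commute:
  fixes f :: "real^'n \<Rightarrow> 'b::{banach, second_countable_topology}"
  assumes "tame 2 f"
  shows "E (pd l (pd k f)) = E (pd k (pd l f))"
  unfolding stein2_pd[OF assms] by (simp add: C_sym[of l k] mult.commute)

lemma coord_eq: "x $ k - q $ k = (\<Sum>m\<in>UNIV. Gi $ k $ m * slope m x)"
proof -
  have "(\<Sum>m\<in>UNIV. Gi $ k $ m * slope m x)
      = (\<Sum>n\<in>UNIV. (\<Sum>m\<in>UNIV. Gi $ k $ m * G $ m $ n) * (x $ n - q $ n))"
    unfolding slope_def sum_distrib_left sum_distrib_right by (subst sum.swap) (simp add: mult.assoc)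
  also have "\<dots> = x $ k - q $ k"
    unfolding Gi_G by (simp add: if_distrib[where f = "\<lambda>c. c * _"] cong: if_cong)
  finally show ?thesis ..
qed

text \<open>Inverting G expresses the centred coordinates by slopes, to which Stein's identity
  applies. In particular \<epsilon>/2 times \<open>Gi\<close> is the covariance matrix of the
  normalised weight.\<close>

lemma E_coord_centered:
  fixes f :: "real^'n \<Rightarrow> 'b::{banach, second_countable_topology}"
  assumes "tame 1 f"
  shows "E (\<lambda>x. (x $ k - q $ k) *\<^sub>R f x) = (\<epsilon> / 2) *\<^sub>R (\<Sum>m\<in>UNIV. Gi $ k $ m *\<^sub>R E (pd m f))"
proof -
  have sf: "poly_bounded (\<lambda>x. slope m x *\<^sub>R f x)" for m
    using tame_slope_scaleR[OF assms] by (rule tame_poly_bounded)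
  have "E (\<lambda>x. (x $ k - q $ k) *\<^sub>R f x) = E (\<lambda>x. \<Sum>m\<in>UNIV. Gi $ k $ m *\<^sub>R (slope m x *\<^sub>R f x))"
    unfolding coord_eq by (simp add: scaleR_sum_left)
  also have "\<dots> = (\<Sum>m\<in>UNIV. Gi $ k $ m *\<^sub>R E (\<lambda>x. slope m x *\<^sub>R f x))"
    by (subst E_sum) (simp_all only: E_scaleR[OF sf] poly_bounded_linear[OF bounded_linear_scaleR_right sf])
  finally show ?thesis
    by (simp add: stein[OF assms] scaleR_sum_right mult.commute)
qed

lemma E_coord:
  fixes f :: "real^'n \<Rightarrow> 'b::{banach, second_countable_topology}"
  assumes "tame 1 f"
  shows "E (\<lambda>x. x $ k *\<^sub>R f x) = (\<epsilon> / 2) *\<^sub>R (\<Sum>m\<in>UNIV. Gi $ k $ m *\<^sub>R E (pd m f)) + q $ k *\<^sub>R E f"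
proof -
  have "E (\<lambda>x. x $ k *\<^sub>R f x) = E (\<lambda>x. (x $ k - q $ k) *\<^sub>R f x + q $ k *\<^sub>R f x)"
    by (simp flip: scaleR_add_left)
  also have "\<dots> = E (\<lambda>x. (x $ k - q $ k) *\<^sub>R f x) + q $ k *\<^sub>R E f"
    using assms by (subst E_tame_add[of 1]) (auto intro!: tame_intros E_tame_scaleR simp del: tame.simps One_nat_def)
  finally show ?thesis
    by (simp add: E_coord_centered[OF assms])
qed

text \<open>\<open>E_coord\<close> removes one coordinate factor, leaving multiples of the average
  of the function and of the averages of its first partial derivatives. Removing two factors
  therefore leaves only averages of R and of its derivatives up to order two.\<close>

lemma orthogonal_quadratics:
  fixes R :: "real^'n \<Rightarrow> complex"
  assumes R: "tame 2 R" and E0: "E R = 0" and E1: "\<And>k. E (pd k R) = 0"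
    and E2: "\<And>k l. E (pd l (pd k R)) = 0"
  shows "E (\<lambda>x. quadratic a b M x * R x) = 0"
proof -
  have R': "tame 1 R" "tame 1 (pd k R)" "tame 0 (pd k R)" "tame 0 R" "R differentiable (at x)" for k x
    using R by (auto simp: numeral_2_eq_2)
  have L: "E (\<lambda>x. x $ k *\<^sub>R R x) = 0" for k
    by (simp add: E_coord[OF R'(1)] E0 E1)
  have Lpd: "E (\<lambda>x. x $ k *\<^sub>R pd m R x) = 0" for k m
    by (simp add: E_coord[OF R'(2)] E1 E2)
  have t1: "tame 1 (\<lambda>x. x $ k *\<^sub>R R x)" for k
    by (intro tame_intros R')
  have pdt: "E (pd m (\<lambda>x. x $ k *\<^sub>R R x)) = 0" for m k
  proof -
    have "E (pd m (\<lambda>x. x $ k *\<^sub>R R x)) = E (\<lambda>x. x $ k *\<^sub>R pd m R x + (if k = m then 1 else 0) *\<^sub>R R x)"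
      using pd_coord_scaleR[OF R'(5)] by (intro arg_cong[where f = E]) auto
    also have "\<dots> = E (\<lambda>x. x $ k *\<^sub>R pd m R x) + (if k = m then 1 else 0) *\<^sub>R E R"
      by (subst E_tame_add[of 0]) (intro tame_intros R' E_tame_scaleR[OF R'(4)] arg_cong2[where f="(+)"] refl)+
    finally show ?thesis
      by (simp add: Lpd E0)
  qed
  have Q: "E (\<lambda>x. x $ j *\<^sub>R x $ k *\<^sub>R R x) = 0" for j k
    by (simp only: E_coord[OF t1] L pdt) simp
  have "quadratic a b M x * R x
      = a * R x + (\<Sum>j\<in>UNIV. b $ j * (x $ j *\<^sub>R R x))
             + (\<Sum>j\<in>UNIV. \<Sum>k\<in>UNIV. M $ j $ k * (x $ j *\<^sub>R x $ k *\<^sub>R R x))" for x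
    by (simp add: quadratic_def scaleR_conv_of_real distrib_right sum_distrib_right mult.assoc)
  moreover have "E (\<lambda>x. a * R x + (\<Sum>j\<in>UNIV. b $ j * (x $ j *\<^sub>R R x))
             + (\<Sum>j\<in>UNIV. \<Sum>k\<in>UNIV. M $ j $ k * (x $ j *\<^sub>R x $ k *\<^sub>R R x)))
    = E (\<lambda>x. a * R x) + E (\<lambda>x. \<Sum>j\<in>UNIV. b $ j * (x $ j *\<^sub>R R x))
             + E (\<lambda>x. \<Sum>j\<in>UNIV. \<Sum>k\<in>UNIV. M $ j $ k * (x $ j *\<^sub>R x $ k *\<^sub>R R x))"
    by (subst E_tame_add[of 0], (intro tame_intros R'(4))+)+ simp
  moreover have "E (\<lambda>x. a * R x) = 0"
    by (subst E_cmult[OF tame_poly_bounded[OF R]]) (simp add: E0)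
  moreover have "E (\<lambda>x. \<Sum>j\<in>UNIV. b $ j * (x $ j *\<^sub>R R x)) = 0"
    by (subst E_sum, (intro tame_poly_bounded[of 0] tame_intros R'(4)))
      (subst E_cmult, (intro tame_poly_bounded[of 0] tame_intros R'(4)), simp add: L)
  moreover have "E (\<lambda>x. \<Sum>j\<in>UNIV. \<Sum>k\<in>UNIV. M $ j $ k * (x $ j *\<^sub>R x $ k *\<^sub>R R x)) = 0"
    by (subst E_sum, (intro tame_poly_bounded[of 0] tame_intros R'(4)),
        subst E_sum, (intro tame_poly_bounded[of 0] tame_intros R'(4)))
      (subst E_cmult, (intro tame_poly_bounded[of 0] tame_intros R'(4)), simp only: Q, simp)
  ultimately show ?thesis
    by simp
qed

section \<open>Averages containing the phase gradient C (x - q)\<close>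

definition Cy :: "'n \<Rightarrow> real^'n \<Rightarrow> complex" where
  "Cy j x = (\<Sum>k\<in>UNIV. C $ j $ k * of_real (x $ k - q $ k))"

text \<open>The matrix C (Im C)^-1. A factor \<open>Cy\<close> under an average turns into a
  contraction of first derivatives with this matrix, times \<epsilon>/2.\<close>

definition K :: "'n \<Rightarrow> 'n \<Rightarrow> complex" where
  "K j m = (\<Sum>k\<in>UNIV. C $ j $ k * of_real (Gi $ k $ m))"

lemma Cy_tame: "tame n (Cy j)"
  unfolding Cy_def by (intro tame_intros)

lemma K_G: "(\<Sum>m\<in>UNIV. K j m * of_real (G $ k $ m)) = C $ j $ k"
proof -
  have "(\<Sum>m\<in>UNIV. K j m * of_real (G $ k $ m))
      = (\<Sum>n\<in>UNIV. C $ j $ n * of_real (\<Sum>m\<in>UNIV. Gi $ n $ m * G $ m $ k))"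
    unfolding K_def sum_distrib_right sum_distrib_left of_real_sum G_sym[of k]
    by (subst sum.swap) (simp add: mult.assoc)
  also have "\<dots> = C $ j $ k"
    unfolding Gi_G by (simp add: if_distrib[where f = "\<lambda>c. _ * c"] if_distrib[where f = of_real] cong: if_cong)
  finally show ?thesis .
qed

lemma E_Cy:
  fixes g :: "'n \<Rightarrow> real^'n \<Rightarrow> complex"
  assumes g: "\<And>j. tame 1 (g j)"
  shows "E (\<lambda>x. \<Sum>j\<in>UNIV. g j x * Cy j x)
    = (\<epsilon> / 2) *\<^sub>R (\<Sum>j\<in>UNIV. \<Sum>m\<in>UNIV. K j m * E (pd m (g j)))"
proof -
  have pb: "poly_bounded (\<lambda>x. (x $ k - q $ k) *\<^sub>R g j x)" for j k
    by (intro tame_poly_bounded[of 1] tame_intros g)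
  have "(\<Sum>j\<in>UNIV. g j x * Cy j x) = (\<Sum>j\<in>UNIV. \<Sum>k\<in>UNIV. C $ j $ k * ((x $ k - q $ k) *\<^sub>R g j x))" for x
    by (simp add: Cy_def sum_distrib_left scaleR_conv_of_real mult_ac)
  then have "E (\<lambda>x. \<Sum>j\<in>UNIV. g j x * Cy j x)
      = E (\<lambda>x. \<Sum>j\<in>UNIV. \<Sum>k\<in>UNIV. C $ j $ k * ((x $ k - q $ k) *\<^sub>R g j x))"
    by simp
  also have "\<dots> = (\<Sum>j\<in>UNIV. E (\<lambda>x. \<Sum>k\<in>UNIV. C $ j $ k * ((x $ k - q $ k) *\<^sub>R g j x)))"
    by (intro E_sum tame_poly_bounded[of 1] tame_intros g)
  also have "\<dots> = (\<Sum>j\<in>UNIV. \<Sum>k\<in>UNIV. E (\<lambda>x. C $ j $ k * ((x $ k - q $ k) *\<^sub>R g j x)))"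
    by (intro E_sum sum.cong refl tame_poly_bounded[of 1] tame_intros g)
  also have "\<dots> = (\<Sum>j\<in>UNIV. \<Sum>k\<in>UNIV. C $ j $ k *
      ((\<epsilon> / 2) *\<^sub>R (\<Sum>m\<in>UNIV. Gi $ k $ m *\<^sub>R E (pd m (g j)))))"
    by (simp only: E_cmult[OF pb] E_coord_centered[OF g])
  also have "\<dots> = (\<Sum>j\<in>UNIV. \<Sum>k\<in>UNIV. \<Sum>m\<in>UNIV.
      (\<epsilon> / 2) *\<^sub>R (C $ j $ k * of_real (Gi $ k $ m) * E (pd m (g j))))"
    by (simp add: scaleR_conv_of_real sum_distrib_left sum_divide_distrib mult_ac)
  also have "\<dots> = (\<Sum>j\<in>UNIV. \<Sum>m\<in>UNIV. \<Sum>k\<in>UNIV.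
      (\<epsilon> / 2) *\<^sub>R (C $ j $ k * of_real (Gi $ k $ m) * E (pd m (g j))))"
    by (intro sum.cong refl sum.swap)
  finally show ?thesis
    by (simp add: K_def scaleR_sum_right sum_distrib_right)
qed

section \<open>Averages of derivatives as linear functionals\<close>

lemma tame2_linear_E: "tame2_linear E"
  unfolding tame2_linear_def
  by (intro conjI allI impI E_tame_add[of 2] E_cmult[OF tame_poly_bounded[of 2]])

lemma pd_cmult:
  fixes f :: "real^'n \<Rightarrow> complex"
  assumes "tame (Suc n) f"
  shows "pd k (\<lambda>x. c * f x) = (\<lambda>x. c * pd k f x)"
  by (intro ext pd_bounded_linear[OF bounded_linear_mult_right] tame_differentiable[OF assms])

lemma pd_tame_add:
  assumes "tame (Suc n) f" "tame (Suc n) g"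
  shows "pd k (\<lambda>x. f x + g x) = (\<lambda>x. pd k f x + pd k g x)"
  by (intro ext pd_add tame_differentiable[OF assms(1)] tame_differentiable[OF assms(2)])

lemma tame2_linear_E_pd: "tame2_linear (\<lambda>f. E (pd k f))"
proof -
  have "E (pd k (\<lambda>x. c * f x)) = c * E (pd k f)" if "tame (Suc 1) f" for f :: "real^'n \<Rightarrow> complex" and c
    unfolding pd_cmult[OF that] by (rule E_cmult[OF tame_poly_bounded[OF tame_pd[OF that]]])
  moreover have "E (pd k (\<lambda>x. f x + g x)) = E (pd k f) + E (pd k g)"
    if "tame (Suc 1) f" "tame (Suc 1) g" for f g :: "real^'n \<Rightarrow> complex"
    unfolding pd_tame_add[OF that] by (rule E_tame_add[OF tame_pd[OF that(1)] tame_pd[OF that(2)]])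
  ultimately show ?thesis
    unfolding tame2_linear_def by (simp only: Suc_1) blast
qed

lemma tame2_linear_E_pd_pd: "tame2_linear (\<lambda>f. E (pd l (pd k f)))"
proof -
  have "E (pd l (pd k (\<lambda>x. c * f x))) = c * E (pd l (pd k f))"
    if "tame (Suc (Suc 0)) f" for f :: "real^'n \<Rightarrow> complex" and c
    unfolding pd_cmult[OF that] pd_cmult[OF tame_pd[OF that]]
    by (rule E_cmult[OF tame_poly_bounded[OF tame_pd[OF tame_pd[OF that]]]])
  moreover have "E (pd l (pd k (\<lambda>x. f x + g x))) = E (pd l (pd k f)) + E (pd l (pd k g))"
    if "tame (Suc (Suc 0)) f" "tame (Suc (Suc 0)) g" for f g :: "real^'n \<Rightarrow> complex"
    unfolding pd_tame_add[OF that] pd_tame_add[OF tame_pd[OF that(1)] tame_pd[OF that(2)]]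
    by (rule E_tame_add[OF tame_pd[OF tame_pd[OF that(1)]] tame_pd[OF tame_pd[OF that(2)]]])
  ultimately show ?thesis
    unfolding tame2_linear_def numeral_2_eq_2 by blast
qed

lemma E_of_real_pd:
  assumes "tame 2 f"
  shows "E (\<lambda>x. complex_of_real (f x)) = of_real (E f)"
    and "E (pd k (\<lambda>x. complex_of_real (f x))) = of_real (E (pd k f))"
    and "E (pd l (pd k (\<lambda>x. complex_of_real (f x)))) = of_real (E (pd l (pd k f)))"
proof -
  have f: "tame (Suc (Suc 0)) f"
    using assms by (simp only: numeral_2_eq_2)
  have d: "pd k (\<lambda>x. complex_of_real (f x)) = (\<lambda>x. of_real (pd k f x))"
    by (rule pd_of_real[OF tame_differentiable[OF f]])
  show "E (\<lambda>x. complex_of_real (f x)) = of_real (E f)"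
    by (rule E_of_real[OF tame_poly_bounded[OF f]])
  show "E (pd k (\<lambda>x. complex_of_real (f x))) = of_real (E (pd k f))"
    unfolding d by (rule E_of_real[OF tame_poly_bounded[OF tame_pd[OF f]]])
  show "E (pd l (pd k (\<lambda>x. complex_of_real (f x)))) = of_real (E (pd l (pd k f)))"
    unfolding d pd_of_real[OF tame_differentiable[OF tame_pd[OF f]]]
    by (rule E_of_real[OF tame_poly_bounded[OF tame_pd[OF tame_pd[OF f]]]])
qed

text \<open>The mass of the packet. It stays a free positive number here, because its constancy is
  deduced later from formulas that already contain it.\<close>

abbreviation N :: real where "N \<equiv> E (\<lambda>x. 1)"

text \<open>With the factor 1/2 and a symmetric M, the coefficients are the value and the gradient
  at q and the Hessian, which is the form in which \<open>tangent_proj_eq\<close> fixes the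
  projection.\<close>

definition quad :: "complex \<Rightarrow> complex^'n \<Rightarrow> complex^'n^'n \<Rightarrow> real^'n \<Rightarrow> complex" where
  "quad a b M x = a + (\<Sum>j\<in>UNIV. b $ j * of_real (x $ j - q $ j))
     + 1/2 * (\<Sum>j\<in>UNIV. \<Sum>k\<in>UNIV. M $ j $ k * of_real (x $ j - q $ j) * of_real (x $ k - q $ k))"

lemma quad_tame: "tame n (quad a b M)"
  unfolding quad_def by (intro tame_intros)

lemma quad_add: "quad a b M x + quad a' b' M' x = quad (a + a') (b + b') (M + M') x"
  by (simp only: quad_def vector_add_component distrib_right distrib_left sum.distrib add_ac)

lemma pd_quad:
  assumes "\<And>j k. M $ j $ k = M $ k $ j"
  shows "pd k (quad a b M) x = b $ k + (\<Sum>j\<in>UNIV. M $ k $ j * of_real (x $ j - q $ j))"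
proof -
  have "(quad a b M has_derivative
     (\<lambda>h. (\<Sum>j\<in>UNIV. b $ j * of_real (h $ j)) + 1/2 * (\<Sum>i\<in>UNIV. \<Sum>j\<in>UNIV.
        M $ i $ j * of_real (x $ i - q $ i) * of_real (h $ j) + M $ i $ j * of_real (h $ i) * of_real (x $ j - q $ j)))) (at x)"
    unfolding quad_def by (auto intro!: derivative_eq_intros has_derivative_coord simp: fun_eq_iff)
  from pd_eqI[OF this, of k]
  have eq: "pd k (quad a b M) x = (\<Sum>j\<in>UNIV. b $ j * of_real (axis k 1 $ j))
      + 1/2 * ((\<Sum>i\<in>UNIV. \<Sum>j\<in>UNIV. M $ i $ j * of_real (x $ i - q $ i) * of_real (axis k 1 $ j))
      + (\<Sum>i\<in>UNIV. \<Sum>j\<in>UNIV. M $ i $ j * of_real (axis k 1 $ i) * of_real (x $ j - q $ j)))"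
    by (simp only: sum.distrib)
  have "(\<Sum>i\<in>UNIV. \<Sum>j\<in>UNIV. M $ i $ j * of_real (axis k 1 $ i) * of_real (x $ j - q $ j))
      = (\<Sum>j\<in>UNIV. (\<Sum>i\<in>UNIV. M $ i $ j * of_real (axis k 1 $ i)) * of_real (x $ j - q $ j))"
    by (subst sum.swap) (simp only: sum_distrib_right)
  then have "pd k (quad a b M) x = b $ k + 1/2 * ((\<Sum>i\<in>UNIV. M $ i $ k * of_real (x $ i - q $ i))
      + (\<Sum>j\<in>UNIV. M $ k $ j * of_real (x $ j - q $ j)))"
    by (simp only: eq sum_axis_complex)
  then show ?thesis
    by (simp only: assms[of _ k]) simp
qed

lemma pd_pd_quad:
  assumes "\<And>j k. M $ j $ k = M $ k $ j"
  shows "pd l (pd k (quad a b M)) x = M $ k $ l"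
proof -
  have "(pd k (quad a b M) has_derivative (\<lambda>h. \<Sum>j\<in>UNIV. M $ k $ j * of_real (h $ j))) (at x)"
    unfolding pd_quad[OF assms, abs_def] by (auto intro!: derivative_eq_intros has_derivative_coord)
  from pd_eqI[OF this, of l] show ?thesis
    by (simp only: sum_axis_complex)
qed

lemma E_const: "E (\<lambda>x. c) = c * of_real N"
  for c :: complex
  using E_cmult[OF poly_bounded_const, of c 1] E_of_real[OF poly_bounded_const, of 1] by simp

lemma pd_coord_complex: "pd m (\<lambda>x. complex_of_real (x $ k - q $ k)) x = (if k = m then 1 else 0)"
  by (subst pd_eqI[where f' = "\<lambda>h. complex_of_real (h $ k)"])
    (auto intro!: derivative_eq_intros has_derivative_coord simp: axis_def)

lemma E_coord1: "E (\<lambda>x. complex_of_real (x $ k - q $ k)) = 0"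
  using E_coord_centered[OF tame_const, of k "1::complex"] by (simp add: scaleR_conv_of_real avg_def)

lemma E_coord2: "E (\<lambda>x. complex_of_real (x $ j - q $ j) * of_real (x $ k - q $ k)) = of_real (\<epsilon> / 2 * Gi $ j $ k * N)"
proof -
  have "E (pd m (\<lambda>x. complex_of_real (x $ k - q $ k))) = (if k = m then of_real N else 0)" for m
    unfolding pd_coord_complex[abs_def] using E_const[of 1] E_const[of 0] by simp
  moreover have "tame 1 (\<lambda>x. complex_of_real (x $ k - q $ k))"
    by (intro tame_intros)
  ultimately have "E (\<lambda>x. (x $ j - q $ j) *\<^sub>R complex_of_real (x $ k - q $ k))
    = (\<epsilon> / 2) *\<^sub>R (\<Sum>m\<in>UNIV. Gi $ j $ m *\<^sub>R (if k = m then of_real N else 0))"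
    by (simp only: E_coord_centered)
  then show ?thesis
    by (simp add: scaleR_conv_of_real if_distrib[where f = "\<lambda>c. _ * c"] cong: if_cong)
qed

text \<open>The factor \<epsilon>/4 is the 1/2 of the Taylor term times the \<epsilon>/2 of the
  covariance; it reappears in the equation for \<zeta>.\<close>

lemma E_quad: "E (quad a b M) = (a + of_real (\<epsilon> / 4) * (\<Sum>j\<in>UNIV. \<Sum>k\<in>UNIV. M $ j $ k * of_real (Gi $ j $ k))) * of_real N"
proof -
  note lin = tame2_linearD[OF tame2_linear_E]
  have "E (quad a b M) = E (\<lambda>x. a) + (\<Sum>j\<in>UNIV. b $ j * E (\<lambda>x. of_real (x $ j - q $ j)))
     + 1/2 * (\<Sum>j\<in>UNIV. \<Sum>k\<in>UNIV. M $ j $ k * E (\<lambda>x. of_real (x $ j - q $ j) * of_real (x $ k - q $ k)))"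
    unfolding quad_def mult.assoc
    by (subst lin(1), (intro tame_intros)+, subst lin(1), (intro tame_intros)+,
        subst lin(2), (intro tame_intros)+, subst lin(4), (intro tame_intros)+,
        subst lin(4), (intro tame_intros)+, subst lin(4), (intro tame_intros)+,
        subst lin(2), (intro tame_intros)+, subst lin(2), (intro tame_intros)+, rule refl)
  also have "\<dots> = a * of_real N
     + 1/2 * (\<Sum>j\<in>UNIV. \<Sum>k\<in>UNIV. M $ j $ k * of_real (\<epsilon> / 2 * Gi $ j $ k * N))"
    by (simp only: E_const E_coord1 E_coord2) simp
  also have "\<dots> = (a + of_real (\<epsilon> / 4) * (\<Sum>j\<in>UNIV. \<Sum>k\<in>UNIV. M $ j $ k * of_real (Gi $ j $ k))) * of_real N"
    by (simp add: algebra_simps sum_distrib_left sum_distrib_right)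
  finally show ?thesis .
qed

lemma E_pd_quad:
  assumes "\<And>j k. M $ j $ k = M $ k $ j"
  shows "E (pd k (quad a b M)) = b $ k * of_real N"
proof -
  note lin = tame2_linearD[OF tame2_linear_E]
  have "E (pd k (quad a b M)) = E (\<lambda>x. b $ k) + (\<Sum>j\<in>UNIV. M $ k $ j * E (\<lambda>x. of_real (x $ j - q $ j)))"
    unfolding pd_quad[OF assms, abs_def]
    by (subst lin(1), (intro tame_intros)+, subst lin(4), (intro tame_intros)+,
        subst lin(2), (intro tame_intros)+, rule refl)
  then show ?thesis
    by (simp only: E_const E_coord1) simp
qed

lemma E_pd_pd_quad:
  assumes "\<And>j k. M $ j $ k = M $ k $ j"
  shows "E (pd l (pd k (quad a b M))) = M $ k $ l * of_real N"
  unfolding pd_pd_quad[OF assms, abs_def] by (rule E_const)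

lemma N_pos: "0 < N"
proof -
  have int: "integrable lborel (\<lambda>x. (cmod (u x))\<^sup>2)"
    using weight_integrable[OF poly_bounded_const, of "1::real"] by simp
  have "0 \<le> N"
    by (simp add: avg_def)
  moreover have "N \<noteq> 0"
  proof
    assume "N = 0"
    then have "AE x in lborel. (cmod (u x))\<^sup>2 = 0"
      using integral_nonneg_eq_0_iff_AE[OF int] by (simp add: avg_def)
    then have "AE x in (lborel :: (real^'n) measure). False"
      by (simp add: gwp_def)
    then show False
      by (simp add: AE_iff_measurable[OF _ refl] emeasure_lborel_UNIV)
  qed
  ultimately show ?thesis
    by simp
qed

lemma quad_eq_uncentered:
  obtains a' b' M' where "\<And>x. quad a b M x = quadratic a' b' M' x"
proof -
  define Y where "Y j = complex_of_real (q $ j)" for j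
  \<comment> \<open>M need not be symmetric, so the two mixed terms of the expansion contract its
    rows and its columns separately.\<close>
  define b1 where "b1 j = (\<Sum>k\<in>UNIV. M $ j $ k * Y k)" for j
  define b2 where "b2 k = (\<Sum>j\<in>UNIV. M $ j $ k * Y j)" for k
  define a' where "a' = a - (\<Sum>j\<in>UNIV. b $ j * Y j) + 1/2 * (\<Sum>j\<in>UNIV. b1 j * Y j)"
  define b' where "b' = (\<chi> j. b $ j - 1/2 * (b1 j + b2 j))"
  define M' where "M' = (\<chi> j k. 1/2 * M $ j $ k)"
  have "quad a b M x = quadratic a' b' M' x" for x
  proof -
    define X where "X j = complex_of_real (x $ j)" for j
    have "(\<Sum>j\<in>UNIV. \<Sum>k\<in>UNIV. M $ j $ k * Y j * X k) = (\<Sum>k\<in>UNIV. b2 k * X k)"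
      by (subst sum.swap) (simp add: b2_def sum_distrib_left mult_ac)
    moreover have "(\<Sum>j\<in>UNIV. \<Sum>k\<in>UNIV. M $ j $ k * X j * Y k) = (\<Sum>j\<in>UNIV. b1 j * X j)"
      by (simp add: b1_def sum_distrib_left mult_ac)
    moreover have "(\<Sum>j\<in>UNIV. \<Sum>k\<in>UNIV. M $ j $ k * Y j * Y k) = (\<Sum>j\<in>UNIV. b1 j * Y j)"
      by (simp add: b1_def sum_distrib_left mult_ac)
    moreover have "(\<Sum>j\<in>UNIV. \<Sum>k\<in>UNIV. M $ j $ k * (X j - Y j) * (X k - Y k))
      = (\<Sum>j\<in>UNIV. \<Sum>k\<in>UNIV. M $ j $ k * X j * X k)
      - (\<Sum>j\<in>UNIV. \<Sum>k\<in>UNIV. M $ j $ k * X j * Y k)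
      - (\<Sum>j\<in>UNIV. \<Sum>k\<in>UNIV. M $ j $ k * Y j * X k)
      + (\<Sum>j\<in>UNIV. \<Sum>k\<in>UNIV. M $ j $ k * Y j * Y k)"
      by (simp add: sum.distrib[symmetric] sum_subtractf[symmetric] algebra_simps)
    moreover have "(\<Sum>j\<in>UNIV. b $ j * (X j - Y j)) = (\<Sum>j\<in>UNIV. b $ j * X j) - (\<Sum>j\<in>UNIV. b $ j * Y j)"
      by (simp add: sum_subtractf[symmetric] algebra_simps)
    moreover have "(\<Sum>j\<in>UNIV. b' $ j * X j) = (\<Sum>j\<in>UNIV. b $ j * X j)
        - 1/2 * ((\<Sum>j\<in>UNIV. b1 j * X j) + (\<Sum>j\<in>UNIV. b2 j * X j))"
      by (simp add: b'_def sum.distrib[symmetric] sum_subtractf[symmetric] sum_divide_distrib algebra_simps add_divide_distrib)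
    moreover have "(\<Sum>j\<in>UNIV. \<Sum>k\<in>UNIV. M' $ j $ k * X j * X k)
        = 1/2 * (\<Sum>j\<in>UNIV. \<Sum>k\<in>UNIV. M $ j $ k * X j * X k)"
      by (simp add: M'_def sum_distrib_left)
    ultimately show ?thesis
      unfolding quad_def quadratic_def a'_def of_real_diff X_def[symmetric] Y_def[symmetric]
      by (simp only:) (simp add: algebra_simps add_divide_distrib diff_divide_distrib)
  qed
  then show ?thesis
    using that by blast
qed

lemma quad_in_tangent_space: "(\<lambda>x. quad a b M x * u x) \<in> tangent_space u"
proof -
  obtain a' b' M' where "\<And>x. quad a b M x = quadratic a' b' M' x"
    using quad_eq_uncentered by blast
  then show ?thesis
    unfolding tangent_space_eq by auto
qed

section \<open>Orthogonal projection onto the tangent space\<close>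

lemma L2_inner_weighted:
  "L2_inner (\<lambda>x. f x * u x) (\<lambda>x. g x * u x - h x * u x) = E (\<lambda>x. cnj (f x) * (g x - h x))"
proof -
  have "cnj (f x * u x) * (g x * u x - h x * u x) = (cmod (u x))\<^sup>2 *\<^sub>R (cnj (f x) * (g x - h x))" for x
    by (simp only: scaleR_conv_of_real complex_norm_square) (simp add: algebra_simps)
  then show ?thesis
    unfolding L2_inner_def avg_def by simp
qed

lemma gwp_nonzero: "u x \<noteq> 0"
  by (simp add: gwp_def)

text \<open>Matching averages up to second order make the residual \<open>h - w\<close> orthogonal
  to all quadratics, by \<open>orthogonal_quadratics\<close>. As the projection is a definite
  description, uniqueness has to be shown too: the difference of two candidates is itself a
  quadratic and can serve as test function.\<close>

lemma tangent_proj_eq: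
  assumes h: "tame 2 h" and w: "w = quad a b M"
    and E0: "E (\<lambda>x. h x - w x) = 0"
    and E1: "\<And>k. E (pd k (\<lambda>x. h x - w x)) = 0"
    and E2: "\<And>k l. E (pd l (pd k (\<lambda>x. h x - w x))) = 0"
  shows "tangent_proj u (\<lambda>x. h x * u x) = (\<lambda>x. w x * u x)"
proof -
  have wt: "tame n w" for n
    unfolding w by (rule quad_tame)
  have R: "tame 2 (\<lambda>x. h x - w x)"
    by (intro tame_intros h wt)
  \<comment> \<open>The variable x is real, so the conjugate of a quadratic polynomial is the
    quadratic with conjugate coefficients.\<close>
  have orth: "E (\<lambda>x. cnj (quadratic a b M x) * (h x - w x)) = 0" for a b M
    using orthogonal_quadratics[OF R E0 E1 E2, of "cnj a" "\<chi> j. cnj (b $ j)" "\<chi> j k. cnj (M $ j $ k)"]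
    by (simp add: quadratic_def)
  show ?thesis
    unfolding tangent_proj_def
  proof (rule the_equality, intro conjI ballI)
    show "(\<lambda>x. w x * u x) \<in> tangent_space u"
      unfolding w by (rule quad_in_tangent_space)
    show "L2_inner v (\<lambda>x. h x * u x - w x * u x) = 0" if "v \<in> tangent_space u" for v
      using that orth unfolding tangent_space_eq by (auto simp: L2_inner_weighted)
  next
    fix v assume v: "v \<in> tangent_space u \<and> (\<forall>v'\<in>tangent_space u. L2_inner v' (\<lambda>x. h x * u x - v x) = 0)"
    then obtain a1 b1 M1 where v_eq: "v = (\<lambda>x. quadratic a1 b1 M1 x * u x)"
      unfolding tangent_space_eq by blast
    obtain a2 b2 M2 where w_eq: "\<And>x. w x = quadratic a2 b2 M2 x"
      unfolding w using quad_eq_uncentered by blast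
    define f where "f x = quadratic a1 b1 M1 x" for x :: "real^'n"
    define d where "d x = f x - w x" for x
    have v_f: "v = (\<lambda>x. f x * u x)"
      by (simp add: v_eq f_def)
    have ft: "tame n f" for n
      unfolding f_def by (rule quadratic_tame)
    have dt: "tame n d" "tame n (\<lambda>x. cnj (d x))" for n
      unfolding d_def by (intro tame_linear[OF bounded_linear_cnj] tame_intros ft wt)+
    have d_eq: "d x = quadratic (a1 - a2) (b1 - b2) (M1 - M2) x" for x
      by (simp add: d_def f_def w_eq quadratic_def left_diff_distrib sum_subtractf)
    have "(\<lambda>x. d x * u x) \<in> tangent_space u"
      unfolding tangent_space_eq d_eq by blast
    then have "L2_inner (\<lambda>x. d x * u x) (\<lambda>x. h x * u x - v x) = 0"
      using v by blast
    then have 1: "E (\<lambda>x. cnj (d x) * (h x - f x)) = 0"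
      by (simp only: v_f L2_inner_weighted)
    have 2: "E (\<lambda>x. cnj (d x) * (h x - w x)) = 0"
      unfolding d_eq by (rule orth)
    \<comment> \<open>Both residuals are orthogonal to d and their difference is d itself, so the
      average of |d|^2 vanishes.\<close>
    have "E (\<lambda>x. cnj (d x) * (h x - w x) - cnj (d x) * (h x - f x)) = 0"
      by (subst E_diff) (intro tame_poly_bounded[of 2] tame_intros dt h wt ft | simp add: 1 2)+
    moreover have "cnj (d x) * (h x - w x) - cnj (d x) * (h x - f x) = of_real ((cmod (d x))\<^sup>2)" for x
      by (simp only: complex_norm_square) (simp add: d_def algebra_simps)
    moreover have pb: "poly_bounded (\<lambda>x. (cmod (d x))\<^sup>2)"
    proof -
      have "poly_bounded (\<lambda>x. Re (cnj (d x) * d x))"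
        by (intro poly_bounded_linear[OF bounded_linear_Re] tame_poly_bounded[of 0] tame_intros dt)
      then show ?thesis
        by (simp add: cmod_power2 flip: power2_eq_square)
    qed
    ultimately have "complex_of_real (E (\<lambda>x. (cmod (d x))\<^sup>2)) = 0"
      by (simp only: E_of_real)
    then have E: "E (\<lambda>x. (cmod (d x))\<^sup>2) = 0"
      by (simp only: of_real_eq_0_iff)
    have "(cmod (u x))\<^sup>2 *\<^sub>R (cmod (d x))\<^sup>2 = 0" for x
      using E unfolding avg_def
      by (rule continuous_nonneg_integral_zero[OF weight_integrable[OF pb], rotated 2])
        (use pb in \<open>auto simp: poly_bounded_def intro!: continuous_intros weight_continuous simp del: real_scaleR_def intro: scaleR_nonneg_nonneg\<close>)
    then have "d x = 0" for x
      using gwp_nonzero by auto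
    then show "v = (\<lambda>x. w x * u x)"
      by (simp add: v_f d_def)
  qed
qed

section \<open>Derivatives of the wave packet and the kinetic term\<close>

lemma gwp_eq_quad: "u x = exp (\<i> / of_real \<epsilon> * quad \<zeta> (\<chi> j. of_real (p $ j)) C x)"
proof -
  have "of_real ((x - q) \<bullet> p) = (\<Sum>j\<in>UNIV. complex_of_real (p $ j) * of_real (x $ j - q $ j))"
    by (simp add: inner_vec_def mult.commute)
  then show ?thesis
    unfolding gwp_def quad_def by (simp add: mult_ac add_ac)
qed

lemma pd_gwp: "pd k u x = \<i> / of_real \<epsilon> * (of_real (p $ k) + Cy k x) * u x"
proof -
  define Q where "Q = quad \<zeta> (\<chi> j. of_real (p $ j)) C"
  have u: "u = (\<lambda>x. exp (\<i> / of_real \<epsilon> * Q x))"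
    using gwp_eq_quad by (auto simp: Q_def)
  have pdQ: "pd k Q x = of_real (p $ k) + Cy k x"
    unfolding Q_def by (subst pd_quad) (auto simp: C_sym Cy_def)
  have "(Q has_derivative (\<lambda>h. \<Sum>j\<in>UNIV. h $ j *\<^sub>R pd j Q x)) (at x)"
    unfolding Q_def by (intro has_derivative_pd tame_differentiable[OF quad_tame])
  from has_derivative_compose[OF has_derivative_mult_right[OF this, of "\<i> / of_real \<epsilon>"] DERIV_exp[unfolded has_field_derivative_def]]
  have "(u has_derivative (\<lambda>h. exp (\<i> / of_real \<epsilon> * Q x) * (\<i> / of_real \<epsilon> * (\<Sum>j\<in>UNIV. h $ j *\<^sub>R pd j Q x)))) (at x)"
    unfolding u by (simp add: mult_ac)
  from pd_eqI[OF this, of k] show ?thesis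
    by (simp only: sum_axis pdQ) (simp add: u mult_ac)
qed

lemma gwp_differentiable: "u differentiable (at x)"
proof -
  have "(\<lambda>x. \<i> / of_real \<epsilon> * quad \<zeta> (\<chi> j. of_real (p $ j)) C x) differentiable (at x)"
    by (rule tame_differentiable[of 0]) (intro tame_intros quad_tame)
  then show ?thesis
    unfolding gwp_eq_quad[abs_def] differentiable_def
    using has_derivative_compose[OF _ DERIV_exp[unfolded has_field_derivative_def]] by blast
qed

text \<open>The right-hand side is the factor by which -\<epsilon>^2/2 times the Laplacian
  multiplies u. It is already a quadratic polynomial, with gradient C p at q and Hessian C C, so the
  projection leaves it unchanged.\<close>

lemma quad_kinetic:
  "quad (1/2 * (\<Sum>j\<in>UNIV. (of_real (p $ j))\<^sup>2) - \<i> * of_real \<epsilon> / 2 * trace C)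
     (\<chi> k. \<Sum>j\<in>UNIV. C $ k $ j * of_real (p $ j)) (C ** C) x
   = 1/2 * (\<Sum>j\<in>UNIV. (of_real (p $ j) + Cy j x)\<^sup>2) - \<i> * of_real \<epsilon> / 2 * trace C"
proof -
  have "(\<Sum>j\<in>UNIV. of_real (p $ j) * Cy j x) = (\<Sum>k\<in>UNIV. (\<Sum>j\<in>UNIV. C $ k $ j * of_real (p $ j)) * of_real (x $ k - q $ k))"
    unfolding Cy_def sum_distrib_left sum_distrib_right
    by (subst sum.swap) (simp add: C_sym mult_ac)
  moreover have "(\<Sum>j\<in>UNIV. (Cy j x)\<^sup>2) = (\<Sum>k\<in>UNIV. \<Sum>l\<in>UNIV. (C ** C) $ k $ l * of_real (x $ k - q $ k) * of_real (x $ l - q $ l))"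
  proof -
    have "(\<Sum>j\<in>UNIV. (Cy j x)\<^sup>2) = (\<Sum>j\<in>UNIV. \<Sum>k\<in>UNIV. \<Sum>l\<in>UNIV. C $ k $ j * C $ j $ l * of_real (x $ k - q $ k) * of_real (x $ l - q $ l))"
      by (simp only: Cy_def power2_eq_square sum_product C_sym[of _ _]) (simp add: C_sym mult_ac)
    also have "\<dots> = (\<Sum>k\<in>UNIV. \<Sum>j\<in>UNIV. \<Sum>l\<in>UNIV. C $ k $ j * C $ j $ l * of_real (x $ k - q $ k) * of_real (x $ l - q $ l))"
      by (rule sum.swap)
    also have "\<dots> = (\<Sum>k\<in>UNIV. \<Sum>l\<in>UNIV. \<Sum>j\<in>UNIV. C $ k $ j * C $ j $ l * of_real (x $ k - q $ k) * of_real (x $ l - q $ l))"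
      by (intro sum.cong refl sum.swap)
    finally show ?thesis
      by (simp add: matrix_matrix_mult_def sum_distrib_right)
  qed
  moreover have "(\<Sum>j\<in>UNIV. (of_real (p $ j) + Cy j x)\<^sup>2) = (\<Sum>j\<in>UNIV. (of_real (p $ j))\<^sup>2)
     + 2 * (\<Sum>j\<in>UNIV. of_real (p $ j) * Cy j x) + (\<Sum>j\<in>UNIV. (Cy j x)\<^sup>2)"
    by (simp add: power2_sum sum.distrib sum_distrib_left mult_ac)
  ultimately show ?thesis
    by (simp add: quad_def algebra_simps)
qed

end

section \<open>The projected Hamiltonian\<close>

text \<open>Three derivatives of A are required because the trace term contains one and its Hessian
  is averaged.\<close>

locale wave_packet_potential = wave_packet \<epsilon> q p C \<zeta>
  for \<epsilon> :: real and q p :: "real^'n::finite" and C :: "complex^'n^'n" and \<zeta> :: complex +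
  fixes A :: "real^'n \<Rightarrow> real^'n" and Vt :: "real^'n \<Rightarrow> real"
  assumes A_tame: "tame 3 A" and Vt_tame: "tame 2 Vt"
    and div: "(\<Sum>j\<in>UNIV. pd j (\<lambda>y. A y $ j) x) = 0"
begin

abbreviation T :: "real^'n \<Rightarrow> real" where "T \<equiv> tr_term A C"
abbreviation J :: "real^'n^'n" where "J \<equiv> E (jac A)"

definition cA :: "'n \<Rightarrow> real^'n \<Rightarrow> complex" where "cA j x = of_real (A x $ j)"

lemma A_tame': "tame (Suc (Suc (Suc 0))) A"
  using A_tame by (simp only: numeral_3_eq_3)

lemma A_nth_tame: "m \<le> 3 \<Longrightarrow> tame m (\<lambda>x. A x $ j)"
  by (intro tame_nth tame_le[OF A_tame])

lemma cA_tame: "m \<le> 3 \<Longrightarrow> tame m (cA j)"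
  unfolding cA_def by (intro tame_of_real A_nth_tame)

lemma A_differentiable: "A differentiable (at x)"
  by (rule tame_differentiable[OF A_tame'])

lemma pd_A_tame: "tame 2 (pd m A)"
  using tame_pd[OF A_tame'] by (simp only: numeral_2_eq_2)

lemma pd_cA: "pd m (cA j) x = of_real (pd m A x $ j)"
proof -
  have "pd m (cA j) x = of_real (pd m (\<lambda>y. A y $ j) x)"
    unfolding cA_def[abs_def]
    by (subst pd_of_real) (auto intro!: tame_differentiable[of 0] A_nth_tame simp del: tame.simps)
  then show ?thesis
    by (simp add: pd_nth[OF A_differentiable])
qed

lemma div_pd: "(\<Sum>j\<in>UNIV. pd j A x $ j) = 0"
  using div[of x] by (simp add: pd_nth[OF A_differentiable])

lemma tr_term_eq: "T x = (\<Sum>j\<in>UNIV. \<Sum>m\<in>UNIV. (map_matrix Re C ** Gi) $ j $ m * pd m A x $ j)"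
proof -
  have "T x = trace (transpose (jac A x) ** (map_matrix Re C ** Gi))"
    by (simp add: tr_term_def matrix_mul_assoc)
  also have "\<dots> = (\<Sum>m\<in>UNIV. \<Sum>j\<in>UNIV. jac A x $ j $ m * (map_matrix Re C ** Gi) $ j $ m)"
    unfolding trace_def by (subst (1) matrix_matrix_mult_def) (simp add: transpose_def)
  also have "\<dots> = (\<Sum>j\<in>UNIV. \<Sum>m\<in>UNIV. jac A x $ j $ m * (map_matrix Re C ** Gi) $ j $ m)"
    by (rule sum.swap)
  finally show ?thesis
    by (simp add: jac_nth mult.commute)
qed

lemma T_tame: "tame 2 T"
  unfolding tr_term_eq[abs_def] by (intro tame_intros pd_A_tame)

lemma K_eq: "K j m = of_real ((map_matrix Re C ** Gi) $ j $ m) + \<i> * (if j = m then 1 else 0)"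
proof -
  have "K j m = (\<Sum>k\<in>UNIV. (of_real (Re (C $ j $ k)) + \<i> * of_real (G $ j $ k)) * of_real (Gi $ k $ m))"
    by (simp add: K_def complex_eq[symmetric])
  also have "\<dots> = of_real (\<Sum>k\<in>UNIV. Re (C $ j $ k) * Gi $ k $ m) + \<i> * of_real (\<Sum>k\<in>UNIV. G $ j $ k * Gi $ k $ m)"
    by (simp only: of_real_sum sum_distrib_left distrib_right sum.distrib of_real_mult mult.assoc)
  also have "\<dots> = of_real ((map_matrix Re C ** Gi) $ j $ m) + \<i> * (if j = m then 1 else 0)"
    unfolding G_Gi by (simp add: matrix_matrix_mult_def)
  finally show ?thesis .
qed

text \<open>The identity part of \<open>K\<close> contributes i times the divergence of A, which
  vanishes. Thus the full complex C may be used although \<open>tr_term\<close> contains only its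
  real part.\<close>

lemma of_real_T: "complex_of_real (T x) = (\<Sum>j\<in>UNIV. \<Sum>m\<in>UNIV. K j m * pd m (cA j) x)"
proof -
  have "(\<Sum>j\<in>UNIV. \<Sum>m\<in>UNIV. K j m * pd m (cA j) x)
    = (\<Sum>j\<in>UNIV. \<Sum>m\<in>UNIV. of_real ((map_matrix Re C ** Gi) $ j $ m * pd m A x $ j)
       + \<i> * (if j = m then of_real (pd m A x $ j) else 0))"
    unfolding K_eq pd_cA by (intro sum.cong refl) (simp add: distrib_right)
  also have "\<dots> = of_real (T x) + \<i> * of_real (\<Sum>j\<in>UNIV. pd j A x $ j)"
    by (simp only: tr_term_eq sum.distrib of_real_sum sum_distrib_left[symmetric]) simp
  finally show ?thesis
    by (simp add: div_pd)
qed

definition cT :: "real^'n \<Rightarrow> complex" where "cT x = of_real (T x)"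

lemma cT_tame: "tame 2 cT"
  unfolding cT_def by (intro tame_of_real T_tame)

lemma E_K_sum:
  assumes "\<And>j m. tame 0 (F j m)"
  shows "(\<Sum>j\<in>UNIV. \<Sum>m\<in>UNIV. K j m * E (F j m)) = E (\<lambda>x. \<Sum>j\<in>UNIV. \<Sum>m\<in>UNIV. K j m * F j m x)"
proof -
  have "E (\<lambda>x. \<Sum>j\<in>UNIV. \<Sum>m\<in>UNIV. K j m * F j m x) = (\<Sum>j\<in>UNIV. E (\<lambda>x. \<Sum>m\<in>UNIV. K j m * F j m x))"
    by (intro E_sum tame_poly_bounded[of 0] tame_intros assms)
  also have "\<dots> = (\<Sum>j\<in>UNIV. \<Sum>m\<in>UNIV. E (\<lambda>x. K j m * F j m x))"
    by (intro sum.cong refl E_sum tame_poly_bounded[of 0] tame_intros assms)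
  also have "\<dots> = (\<Sum>j\<in>UNIV. \<Sum>m\<in>UNIV. K j m * E (F j m))"
    by (intro sum.cong refl E_cmult tame_poly_bounded[of 0] assms)
  finally show ?thesis ..
qed

text \<open>The magnetic term A . C (x - q), the part of the Hamiltonian in which the complex matrix
  C and the factor x - q multiply the potential.\<close>

definition adv :: "real^'n \<Rightarrow> complex" where "adv x = (\<Sum>j\<in>UNIV. cA j x * Cy j x)"

lemma adv_tame: "tame 2 adv"
  unfolding adv_def by (intro tame_intros cA_tame Cy_tame) auto

text \<open>One integration by parts removes C (x - q): derivatives falling on A sum up to the trace
  term, those falling on the factor s remain. The choices s = 1, a slope, and a product of two
  slopes give all moments of \<open>adv\<close> that are needed.\<close>

lemma E_weighted_adv:
  fixes s :: "real^'n \<Rightarrow> real"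
  assumes s: "tame 2 s"
  shows "E (\<lambda>x. s x *\<^sub>R adv x) = (\<epsilon> / 2) *\<^sub>R
    (E (\<lambda>x. s x *\<^sub>R cT x) + (\<Sum>j\<in>UNIV. \<Sum>m\<in>UNIV. K j m * E (\<lambda>x. pd m s x *\<^sub>R cA j x)))"
proof -
  have s1: "tame (Suc 0) s" and A1: "tame (Suc 0) (cA j)" for j
    by (rule tame_le[OF s], simp) (rule cA_tame, simp)
  have t0: "tame 0 s" "tame 0 (pd m s)" "tame 0 (cA j)" "tame 0 (pd m (cA j))" for j m
    by (rule tame_SucD[OF s1] tame_pd[OF s1] tame_SucD[OF A1] tame_pd[OF A1])+
  have pd: "pd m (\<lambda>x. s x *\<^sub>R cA j x) = (\<lambda>x. s x *\<^sub>R pd m (cA j) x + pd m s x *\<^sub>R cA j x)" for j m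
    by (intro ext pd_bilinear[OF bounded_bilinear_scaleR] tame_differentiable[OF s1] tame_differentiable[OF A1])
  have "E (\<lambda>x. s x *\<^sub>R adv x) = E (\<lambda>x. \<Sum>j\<in>UNIV. (s x *\<^sub>R cA j x) * Cy j x)"
    by (simp add: adv_def scaleR_sum_right)
  also have "\<dots> = (\<epsilon> / 2) *\<^sub>R (\<Sum>j\<in>UNIV. \<Sum>m\<in>UNIV. K j m * E (pd m (\<lambda>x. s x *\<^sub>R cA j x)))"
    by (rule E_Cy) (unfold One_nat_def, rule tame_scaleR[OF s1 A1])
  also have "(\<Sum>j\<in>UNIV. \<Sum>m\<in>UNIV. K j m * E (pd m (\<lambda>x. s x *\<^sub>R cA j x)))
      = (\<Sum>j\<in>UNIV. \<Sum>m\<in>UNIV. K j m * E (\<lambda>x. s x *\<^sub>R pd m (cA j) x))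
      + (\<Sum>j\<in>UNIV. \<Sum>m\<in>UNIV. K j m * E (\<lambda>x. pd m s x *\<^sub>R cA j x))"
    unfolding pd
    by (simp only: E_tame_add[OF tame_scaleR[OF t0(1,4)] tame_scaleR[OF t0(2,3)]] distrib_left sum.distrib)
  also have "(\<Sum>j\<in>UNIV. \<Sum>m\<in>UNIV. K j m * E (\<lambda>x. s x *\<^sub>R pd m (cA j) x)) = E (\<lambda>x. s x *\<^sub>R cT x)"
    unfolding E_K_sum[OF tame_scaleR[OF t0(1,4)]]
    by (simp only: cT_def of_real_T scaleR_sum_right mult_scaleR_right)
  finally show ?thesis .
qed

lemma sum_K_G:
  "(\<Sum>j\<in>UNIV. \<Sum>m\<in>UNIV. K j m * (G $ k $ m *\<^sub>R F j)) = (\<Sum>j\<in>UNIV. C $ j $ k * F j)"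
  by (simp only: scaleR_conv_of_real mult.assoc[symmetric] sum_distrib_right[symmetric] K_G)

lemma E_adv: "E adv = (\<epsilon> / 2) *\<^sub>R E cT"
  using E_weighted_adv[OF tame_const, of 1] by (simp add: avg_def)

lemma E_slope_adv:
  "E (\<lambda>x. slope k x *\<^sub>R adv x) = (\<epsilon> / 2) *\<^sub>R (E (\<lambda>x. slope k x *\<^sub>R cT x) + (\<Sum>j\<in>UNIV. C $ j $ k * E (cA j)))"
proof -
  have tc: "tame 0 (cA j)" for j
    by (rule cA_tame) simp
  show ?thesis
    unfolding E_weighted_adv[OF slope_tame] pd_slope E_tame_scaleR[OF tc] sum_K_G ..
qed

lemma E_slope_slope_adv:
  "E (\<lambda>x. slope k x *\<^sub>R slope l x *\<^sub>R adv x) = (\<epsilon> / 2) *\<^sub>R (E (\<lambda>x. slope k x *\<^sub>R slope l x *\<^sub>R cT x)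
     + (\<Sum>j\<in>UNIV. C $ j $ l * E (\<lambda>x. slope k x *\<^sub>R cA j x)) + (\<Sum>j\<in>UNIV. C $ j $ k * E (\<lambda>x. slope l x *\<^sub>R cA j x)))"
proof -
  have ts: "tame 0 (\<lambda>x. slope k x *\<^sub>R cA j x)" for j k
    by (intro tame_slope_scaleR cA_tame) simp
  have "pd m (\<lambda>x. slope k x * slope l x) x = G $ l $ m * slope k x + G $ k $ m * slope l x" for m x
    using pd_bilinear[OF bounded_bilinear_mult tame_differentiable[OF slope_tame] tame_differentiable[OF slope_tame]]
    by (simp add: pd_slope mult.commute)
  then have "E (\<lambda>x. pd m (\<lambda>x. slope k x * slope l x) x *\<^sub>R cA j x)
      = G $ l $ m *\<^sub>R E (\<lambda>x. slope k x *\<^sub>R cA j x) + G $ k $ m *\<^sub>R E (\<lambda>x. slope l x *\<^sub>R cA j x)" for j m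
    unfolding E_tame_scaleR[OF ts, symmetric]
    by (subst E_tame_add[of 0, symmetric]) (intro tame_scaleR tame_const ts | simp add: scaleR_add_left del: tame.simps)+
  then show ?thesis
    using E_weighted_adv[OF tame_mult[OF slope_tame slope_tame], of k l]
    by (simp only: distrib_left sum.distrib sum_K_G scaleR_scaleR add.assoc)
qed

text \<open>A detour through slope moments: Stein's identity trades the derivative for a slope,
  \<open>E_slope_adv\<close> removes C (x - q), and the slope left in front of the trace term is
  traded back for a derivative. The second-order version below works in the same way.\<close>

lemma E_pd_adv: "E (pd k adv) = (\<epsilon> / 2) *\<^sub>R E (pd k cT) + (\<Sum>j\<in>UNIV. C $ j $ k * E (cA j))"
proof -
  have "E (pd k adv) = (2 / \<epsilon>) *\<^sub>R E (\<lambda>x. slope k x *\<^sub>R adv x)"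
    by (intro stein_pd tame_le[OF adv_tame]) simp
  also have "\<dots> = E (\<lambda>x. slope k x *\<^sub>R cT x) + (\<Sum>j\<in>UNIV. C $ j $ k * E (cA j))"
    using eps by (simp add: E_slope_adv)
  also have "E (\<lambda>x. slope k x *\<^sub>R cT x) = (\<epsilon> / 2) *\<^sub>R E (pd k cT)"
    by (intro stein tame_le[OF cT_tame]) simp
  finally show ?thesis .
qed

lemma E_pd_pd_adv: "E (pd l (pd k adv)) = (\<epsilon> / 2) *\<^sub>R E (pd l (pd k cT))
    + (\<Sum>j\<in>UNIV. C $ j $ l * E (pd k (cA j))) + (\<Sum>j\<in>UNIV. C $ j $ k * E (pd l (cA j)))"
proof -
  have sA: "E (\<lambda>x. slope k x *\<^sub>R cA j x) = (\<epsilon> / 2) *\<^sub>R E (pd k (cA j))" for k j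
    by (intro stein cA_tame) simp
  have "(\<Sum>j\<in>UNIV. C $ j $ l * E (\<lambda>x. slope k x *\<^sub>R cA j x)) = (\<epsilon> / 2) *\<^sub>R (\<Sum>j\<in>UNIV. C $ j $ l * E (pd k (cA j)))" for k l
    by (simp only: sA) (simp add: scaleR_conv_of_real sum_distrib_left sum_divide_distrib mult_ac)
  note s = this
  show ?thesis
    unfolding stein2_pd[OF adv_tame] stein2_pd[OF cT_tame] E_slope_slope_adv E_adv s
    using eps by (simp add: scaleR_conv_of_real field_simps power2_eq_square)
qed

text \<open>What remains of H u / u after the kinetic quadratic is split off; |A|^2/2 is contained
  in \<open>Vt\<close>. Only this part has to be projected.\<close>

definition W :: "real^'n \<Rightarrow> complex" where
  "W x = of_real (Vt x) - (\<Sum>j\<in>UNIV. of_real (p $ j) * cA j x) - adv x"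

lemma W_tame: "tame 2 W"
  unfolding W_def by (intro tame_intros Vt_tame cA_tame adv_tame) simp

lemma linear_W:
  assumes "tame2_linear L"
  shows "L W = L (\<lambda>x. of_real (Vt x)) - (\<Sum>j\<in>UNIV. of_real (p $ j) * L (cA j)) - L adv"
proof -
  note lin = tame2_linearD[OF assms]
  have t: "tame 2 (\<lambda>x. complex_of_real (Vt x))" "tame 2 (cA j)" for j
    by (intro tame_of_real Vt_tame, intro cA_tame) simp
  have "L W = L (\<lambda>x. of_real (Vt x) - (\<Sum>j\<in>UNIV. of_real (p $ j) * cA j x)) - L adv"
    unfolding W_def[abs_def] by (intro lin(3) tame_intros t adv_tame)
  also have "L (\<lambda>x. of_real (Vt x) - (\<Sum>j\<in>UNIV. of_real (p $ j) * cA j x))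
     = L (\<lambda>x. of_real (Vt x)) - L (\<lambda>x. \<Sum>j\<in>UNIV. of_real (p $ j) * cA j x)"
    by (intro lin(3) tame_intros t)
  also have "L (\<lambda>x. \<Sum>j\<in>UNIV. of_real (p $ j) * cA j x) = (\<Sum>j\<in>UNIV. L (\<lambda>x. of_real (p $ j) * cA j x))"
    by (intro lin(4) tame_intros t)
  also have "\<dots> = (\<Sum>j\<in>UNIV. of_real (p $ j) * L (cA j))"
    by (intro sum.cong refl lin(2) t)
  finally show ?thesis .
qed

section \<open>Averages of the potentials in vector and matrix form\<close>

lemma E_cA: "E (cA j) = of_real (E A $ j)"
proof -
  have "E (cA j) = of_real (E (\<lambda>x. A x $ j))"
    unfolding cA_def[abs_def] by (intro E_of_real tame_poly_bounded[of 0] A_nth_tame) simp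
  then show ?thesis
    by (simp add: E_nth[OF tame_poly_bounded[OF A_tame]])
qed

lemma E_matrix_nth:
  fixes F :: "real^'n \<Rightarrow> real^'m::finite^'k::finite"
  assumes "\<And>i j. tame 0 (\<lambda>x. F x $ i $ j)"
  shows "E F $ i $ j = E (\<lambda>x. F x $ i $ j)"
proof -
  have F: "poly_bounded F" "\<And>i. poly_bounded (\<lambda>x. F x $ i)"
    by (intro poly_bounded_vec tame_poly_bounded[of 0] assms)+
  show ?thesis
    by (simp only: E_nth[OF F(1), symmetric]) (simp only: E_nth[OF F(2), symmetric])
qed

lemma E_jac: "J $ j $ m = E (\<lambda>x. pd m A x $ j)"
  by (subst E_matrix_nth) (simp_all only: jac_nth tame_nth[OF tame_le[OF pd_A_tame]] zero_le)

lemma E_pd_cA: "E (pd m (cA j)) = of_real (J $ j $ m)"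
  unfolding pd_cA[abs_def] E_jac
  by (intro E_of_real tame_poly_bounded[of 0] tame_nth tame_le[OF pd_A_tame]) simp

lemma E_grad:
  assumes "tame 2 f"
  shows "E (grad f) $ k = E (pd k f)"
proof -
  have "poly_bounded (pd k f)" for k
    using assms by (simp add: numeral_2_eq_2)
  then have "poly_bounded (grad f)"
    by (intro poly_bounded_vec) (simp add: grad_def)
  from E_nth[OF this, of k] show ?thesis
    by (simp add: grad_def)
qed

lemma E_hess:
  assumes "tame 2 f"
  shows "E (hess f) $ k $ l = E (pd l (pd k f))"
proof -
  have "tame 0 (\<lambda>x. hess f x $ k $ l)" for k l
    using assms by (simp add: hess_def numeral_2_eq_2)
  moreover have "(\<lambda>x. hess f x $ k $ l) = pd l (pd k f)"
    by (simp add: hess_def)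
  ultimately show ?thesis
    by (simp only: E_matrix_nth)
qed

lemma E_D2: "of_real (E (D2 A p) $ k $ l) = (\<Sum>j\<in>UNIV. of_real (p $ j) * E (pd l (pd k (cA j))))"
proof -
  have A2: "tame 2 (\<lambda>y. A y $ j)" for j
    by (rule A_nth_tame) simp
  then have t: "tame 0 (\<lambda>x. pd l (pd k (\<lambda>y. A y $ j)) x)" for j k l
    by (simp add: numeral_2_eq_2)
  have "E (D2 A p) $ k $ l = E (\<lambda>x. \<Sum>j\<in>UNIV. pd l (pd k (\<lambda>y. A y $ j)) x * p $ j)"
    by (subst E_matrix_nth) (auto simp: D2_def simp del: tame.simps intro!: tame_intros t)
  also have "\<dots> = (\<Sum>j\<in>UNIV. E (\<lambda>x. pd l (pd k (\<lambda>y. A y $ j)) x * p $ j))"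
    by (intro E_sum tame_poly_bounded[of 0] tame_intros t)
  also have "\<dots> = (\<Sum>j\<in>UNIV. p $ j * E (pd l (pd k (\<lambda>y. A y $ j))))"
    by (intro sum.cong refl, subst mult.commute)
      (rule E_linear[OF bounded_linear_mult_right tame_poly_bounded[OF t]])
  finally show ?thesis
    using E_of_real_pd(3)[OF A2, of l k] by (simp add: cA_def[abs_def])
qed

text \<open>Up to sign, the potential terms of the equation for C; \<open>E_pd_pd_W\<close>
  identifies them as the averaged Hessian of \<open>W\<close>.\<close>

definition HW :: "complex^'n^'n" where
  "HW = cmat (E (hess Vt)) - cmat (E (D2 A p)) - cmat ((\<epsilon>/2) *\<^sub>R E (hess T))
     - cmat (transpose J) ** C - C ** cmat J"

definition gW :: "complex^'n" where
  "gW = (\<chi> k. of_real ((E (grad Vt) - transpose J *v p - (\<epsilon>/2) *\<^sub>R E (grad T)) $ k)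
     - (\<Sum>j\<in>UNIV. C $ k $ j * of_real (E A $ j)))"

lemma E_W: "E W = of_real (E Vt - p \<bullet> E A - \<epsilon>/2 * E T)"
proof -
  have "E cT = of_real (E T)"
    unfolding cT_def[abs_def] by (rule E_of_real_pd(1)[OF T_tame])
  moreover have "E (\<lambda>x. complex_of_real (Vt x)) = of_real (E Vt)"
    by (rule E_of_real_pd(1)[OF Vt_tame])
  ultimately show ?thesis
    by (simp add: linear_W[OF tame2_linear_E] E_adv E_cA inner_vec_def scaleR_conv_of_real[where 'a = complex])
qed

lemma E_pd_W: "E (pd k W) = gW $ k"
proof -
  have "E (pd k cT) = of_real (E (grad T) $ k)"
    unfolding cT_def[abs_def] E_grad[OF T_tame] by (rule E_of_real_pd(2)[OF T_tame])
  moreover have "E (pd k (\<lambda>x. complex_of_real (Vt x))) = of_real (E (grad Vt) $ k)"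
    unfolding E_grad[OF Vt_tame] by (rule E_of_real_pd(2)[OF Vt_tame])
  moreover have "(transpose J *v p) $ k = (\<Sum>j\<in>UNIV. p $ j * J $ j $ k)"
    by (simp add: matrix_vector_mult_def transpose_def mult.commute)
  moreover have "(\<Sum>j\<in>UNIV. C $ j $ k * complex_of_real (E A $ j)) = (\<Sum>j\<in>UNIV. C $ k $ j * of_real (E A $ j))"
    by (simp only: C_sym[of _ k])
  ultimately show ?thesis
    by (simp add: linear_W[OF tame2_linear_E_pd] E_pd_adv E_cA E_pd_cA gW_def scaleR_conv_of_real[where 'a = complex])
qed

lemma E_pd_pd_W: "E (pd l (pd k W)) = HW $ k $ l"
proof -
  have "E (pd l (pd k cT)) = of_real (E (hess T) $ k $ l)"
    unfolding cT_def[abs_def] E_hess[OF T_tame] by (rule E_of_real_pd(3)[OF T_tame])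
  moreover have "E (pd l (pd k (\<lambda>x. complex_of_real (Vt x)))) = of_real (E (hess Vt) $ k $ l)"
    unfolding E_hess[OF Vt_tame] by (rule E_of_real_pd(3)[OF Vt_tame])
  moreover have "(cmat (transpose J) ** C) $ k $ l = (\<Sum>j\<in>UNIV. C $ j $ l * of_real (J $ j $ k))"
    by (simp add: matrix_matrix_mult_def transpose_def mult.commute)
  moreover have "(C ** cmat J) $ k $ l = (\<Sum>j\<in>UNIV. C $ j $ k * of_real (J $ j $ l))"
    by (simp add: matrix_matrix_mult_def C_sym[of k])
  ultimately show ?thesis
    by (simp add: linear_W[OF tame2_linear_E_pd_pd] E_pd_pd_adv E_pd_cA E_D2[symmetric] HW_def scaleR_conv_of_real[where 'a = complex])
qed

text \<open>Symmetry is inherited from the averaged Hessian of \<open>W\<close>, where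
  \<open>E_hess_commute\<close> applies, instead of being checked summand by summand.\<close>

lemma HW_sym: "HW $ k $ l = HW $ l $ k"
  unfolding E_pd_pd_W[symmetric] by (rule E_hess_commute[OF W_tame])

definition HG :: complex where
  "HG = (\<Sum>j\<in>UNIV. \<Sum>k\<in>UNIV. HW $ j $ k * of_real (Gi $ j $ k))"

text \<open>The coefficients of the projected polynomial: the kinetic quadratic plus the fit of
  \<open>W\<close>. Division by \<open>N\<close> undoes the mass in the averages of a quadratic, and
  the \<epsilon>/4 \<open>HG\<close> subtracted in \<open>wa\<close> compensates the average of the
  second-order term.\<close>

definition wM :: "complex^'n^'n" where "wM = C ** C + HW /\<^sub>R N"
definition wb :: "complex^'n" where "wb = (\<chi> k. \<Sum>j\<in>UNIV. C $ k $ j * of_real (p $ j)) + gW /\<^sub>R N"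
definition wa :: complex where
  "wa = (1/2 * (\<Sum>j\<in>UNIV. (of_real (p $ j))\<^sup>2) - \<i> * of_real \<epsilon> / 2 * trace C)
     + (E W - of_real (\<epsilon> / 4) * HG) / of_real N"

definition h :: "real^'n \<Rightarrow> complex" where
  "h x = quad (1/2 * (\<Sum>j\<in>UNIV. (of_real (p $ j))\<^sup>2) - \<i> * of_real \<epsilon> / 2 * trace C)
     (\<chi> k. \<Sum>j\<in>UNIV. C $ k $ j * of_real (p $ j)) (C ** C) x + W x"

lemma h_tame: "tame 2 h"
  unfolding h_def by (intro tame_add quad_tame W_tame)

text \<open>The kinetic part cancels in the residual, so it suffices that \<open>W\<close> and the
  quadratic P agree in the averages of value, gradient and Hessian.\<close>

lemma tangent_proj_h: "tangent_proj u (\<lambda>x. h x * u x) = (\<lambda>x. quad wa wb wM x * u x)"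
proof (rule tangent_proj_eq[OF h_tame refl])
  define a where "a = (E W - of_real (\<epsilon> / 4) * HG) / of_real N"
  define P where "P = quad a (gW /\<^sub>R N) (HW /\<^sub>R N)"
  have Pt: "tame 2 P"
    unfolding P_def by (rule quad_tame)
  have sym: "(HW /\<^sub>R N) $ j $ k = (HW /\<^sub>R N) $ k $ j" for j k
    by (simp add: HW_sym[of j k])
  have "quad wa wb wM x = quad (1/2 * (\<Sum>j\<in>UNIV. (of_real (p $ j))\<^sup>2) - \<i> * of_real \<epsilon> / 2 * trace C)
     (\<chi> k. \<Sum>j\<in>UNIV. C $ k $ j * of_real (p $ j)) (C ** C) x + P x" for x
    unfolding P_def quad_add wa_def wb_def wM_def a_def by simp
  then have R: "(\<lambda>x. h x - quad wa wb wM x) = (\<lambda>x. W x - P x)"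
    by (auto simp: h_def)
  have N: "N \<noteq> 0"
    using N_pos by simp
  have "E P = E W"
  proof -
    have "(\<Sum>j\<in>UNIV. \<Sum>k\<in>UNIV. (HW /\<^sub>R N) $ j $ k * of_real (Gi $ j $ k)) = HG / of_real N"
      by (simp add: HG_def scaleR_conv_of_real[where 'a = complex] sum_divide_distrib divide_inverse mult_ac sum_distrib_left)
    then show ?thesis
      unfolding P_def E_quad using N by (simp add: a_def field_simps)
  qed
  then show "E (\<lambda>x. h x - quad wa wb wM x) = 0"
    unfolding R by (subst tame2_linearD(3)[OF tame2_linear_E W_tame Pt]) simp
  have "E (pd k P) = E (pd k W)" for k
    unfolding P_def E_pd_quad[OF sym] E_pd_W using N by (simp add: scaleR_conv_of_real[where 'a = complex])
  then show "E (pd k (\<lambda>x. h x - quad wa wb wM x)) = 0" for k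
    unfolding R by (subst tame2_linearD(3)[OF tame2_linear_E_pd W_tame Pt]) simp
  have "E (pd l (pd k P)) = E (pd l (pd k W))" for k l
    unfolding P_def E_pd_pd_quad[OF sym] E_pd_pd_W using N by (simp add: scaleR_conv_of_real[where 'a = complex])
  then show "E (pd l (pd k (\<lambda>x. h x - quad wa wb wM x))) = 0" for k l
    unfolding R by (subst tame2_linearD(3)[OF tame2_linear_E_pd_pd W_tame Pt]) simp
qed

text \<open>Each component of i \<epsilon> \<nabla> + A acts on u as multiplication by a component
  \<open>m j\<close> of A - p - C (x - q). Applying it again squares this factor and adds i
  \<epsilon> times its derivative; after summation div A = 0 leaves only the trace of C.\<close>

lemma hamiltonian_gwp:
  assumes V: "\<And>x. Vt x = 1/2 * (norm (A x))\<^sup>2 + V x"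
  shows "hamiltonian \<epsilon> A V u = (\<lambda>x. h x * u x)"
proof
  fix x
  define m where "m j x = cA j x - (of_real (p $ j) + Cy j x)" for j x
  have mom: "momentum \<epsilon> A j u = (\<lambda>x. m j x * u x)" for j
    using eps by (auto simp: momentum_def pd_gwp m_def cA_def algebra_simps fun_eq_iff)
  have cAd: "cA j differentiable (at x)" and Cyd: "(\<lambda>x. of_real (p $ j) + Cy j x) differentiable (at x)" for j x
    by (rule tame_differentiable[OF cA_tame[of "Suc 0"]], simp)
      (rule tame_differentiable[of 0], intro tame_intros Cy_tame)
  have md: "m j differentiable (at x)" for j x
    unfolding m_def by (intro differentiable_diff cAd Cyd)
  have pdCy: "pd j (\<lambda>x. of_real (p $ j) + Cy j x) x = C $ j $ j" for j x
  proof -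
    have "(\<lambda>x. of_real (p $ j) + Cy j x) = pd j (quad 0 (\<chi> j. of_real (p $ j)) C)"
      using pd_quad[of C, OF C_sym] by (auto simp: Cy_def)
    then show ?thesis
      by (simp add: pd_pd_quad[OF C_sym])
  qed
  have pdm: "pd j (m j) x = of_real (pd j A x $ j) - C $ j $ j" for j
    unfolding m_def[abs_def] by (simp only: pd_diff[OF cAd Cyd] pd_cA pdCy)
  have "momentum \<epsilon> A j (momentum \<epsilon> A j u) x
      = (\<i> * of_real \<epsilon> * (of_real (pd j A x $ j) - C $ j $ j) + (m j x)\<^sup>2) * u x" for j
  proof -
    define z where "z = of_real (p $ j) + Cy j x"
    have "momentum \<epsilon> A j (momentum \<epsilon> A j u) x
        = \<i> * of_real \<epsilon> * (m j x * pd j u x + pd j (m j) x * u x) + cA j x * (m j x * u x)"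
      unfolding mom
      by (simp only: momentum_def pd_bilinear[OF bounded_bilinear_mult md gwp_differentiable] cA_def)
    also have "\<dots> = \<i> * of_real \<epsilon> * (m j x * (\<i> / of_real \<epsilon> * z * u x) + pd j (m j) x * u x) + (m j x + z) * (m j x * u x)"
      by (simp add: pd_gwp z_def m_def)
    also have "\<dots> = (\<i> * of_real \<epsilon> * pd j (m j) x + (m j x)\<^sup>2) * u x"
      using eps by (simp add: algebra_simps power2_eq_square)
    finally show ?thesis
      unfolding pdm .
  qed
  then have "(\<Sum>j\<in>UNIV. momentum \<epsilon> A j (momentum \<epsilon> A j u) x)
      = (\<Sum>j\<in>UNIV. (\<i> * of_real \<epsilon> * (of_real (pd j A x $ j) - C $ j $ j) + (m j x)\<^sup>2)) * u x"
    by (simp add: sum_distrib_right)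
  also have "(\<Sum>j\<in>UNIV. (\<i> * of_real \<epsilon> * (of_real (pd j A x $ j) - C $ j $ j) + (m j x)\<^sup>2))
      = \<i> * of_real \<epsilon> * (of_real (\<Sum>j\<in>UNIV. pd j A x $ j) - trace C) + (\<Sum>j\<in>UNIV. (m j x)\<^sup>2)"
    by (simp add: sum.distrib sum_subtractf sum_distrib_left trace_def right_diff_distrib)
  also have "(\<Sum>j\<in>UNIV. (m j x)\<^sup>2) = of_real ((norm (A x))\<^sup>2)
     - 2 * ((\<Sum>j\<in>UNIV. of_real (p $ j) * cA j x) + adv x) + (\<Sum>j\<in>UNIV. (of_real (p $ j) + Cy j x)\<^sup>2)"
  proof -
    have "(norm (A x))\<^sup>2 = (\<Sum>j\<in>UNIV. (A x $ j)\<^sup>2)"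
      unfolding power2_norm_eq_inner inner_vec_def by (simp add: power2_eq_square)
    then have "of_real ((norm (A x))\<^sup>2) = (\<Sum>j\<in>UNIV. (cA j x)\<^sup>2)"
      by (simp only: cA_def of_real_sum of_real_power)
    moreover have "(m j x)\<^sup>2 = (cA j x)\<^sup>2 - 2 * (of_real (p $ j) * cA j x + cA j x * Cy j x) + (of_real (p $ j) + Cy j x)\<^sup>2" for j
      by (simp add: m_def power2_eq_square algebra_simps)
    ultimately show ?thesis
      by (simp only: adv_def sum.distrib sum_subtractf sum_distrib_left[symmetric])
  qed
  finally have "(\<Sum>j\<in>UNIV. momentum \<epsilon> A j (momentum \<epsilon> A j u) x) = (\<i> * of_real \<epsilon> * (0 - trace C)
     + (of_real ((norm (A x))\<^sup>2) - 2 * ((\<Sum>j\<in>UNIV. of_real (p $ j) * cA j x) + adv x)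
     + (\<Sum>j\<in>UNIV. (of_real (p $ j) + Cy j x)\<^sup>2))) * u x"
    by (simp only: div_pd of_real_0)
  moreover have "complex_of_real (V x) = of_real (Vt x) - 1/2 * of_real ((norm (A x))\<^sup>2)"
    by (simp add: V)
  ultimately show "hamiltonian \<epsilon> A V u x = h x * u x"
    unfolding hamiltonian_def h_def quad_kinetic W_def by (simp only:) (simp add: algebra_simps)
qed

section \<open>Real and imaginary parts of the projected coefficients\<close>

lemma Gi_sym: "Gi $ j $ k = Gi $ k $ j"
proof -
  \<comment> \<open>Both sides are covariances of the same two coordinates, in either order.\<close>
  have "complex_of_real (\<epsilon> / 2 * Gi $ j $ k * N) = of_real (\<epsilon> / 2 * Gi $ k $ j * N)"
    unfolding E_coord2[symmetric] by (simp add: mult.commute)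
  then show ?thesis
    using eps N_pos by (simp only: of_real_eq_iff) simp
qed

text \<open>As \<open>Gi\<close> is symmetric, contracting with it is the trace of the product with
  the inverse of G, so a factor G on either side cancels. This evaluates the imaginary parts
  below.\<close>

lemma trace_G_Gi: "(\<Sum>j\<in>UNIV. \<Sum>k\<in>UNIV. (X ** G) $ j $ k * Gi $ j $ k) = trace X"
  "(\<Sum>j\<in>UNIV. \<Sum>k\<in>UNIV. (G ** X) $ j $ k * Gi $ j $ k) = trace X"
proof -
  have "(\<Sum>k\<in>UNIV. (X ** G) $ j $ k * Gi $ j $ k) = X $ j $ j" for j
  proof -
    have "(\<Sum>k\<in>UNIV. (X ** G) $ j $ k * Gi $ j $ k) = ((X ** G) ** Gi) $ j $ j"
      by (subst (2) matrix_matrix_mult_def) (simp add: Gi_sym[of j])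
    then show ?thesis
      by (simp add: matrix_inv_inverse flip: matrix_mul_assoc)
  qed
  then show "(\<Sum>j\<in>UNIV. \<Sum>k\<in>UNIV. (X ** G) $ j $ k * Gi $ j $ k) = trace X"
    by (simp add: trace_def)
  have "(\<Sum>j\<in>UNIV. (G ** X) $ j $ k * Gi $ j $ k) = X $ k $ k" for k
  proof -
    have "(\<Sum>j\<in>UNIV. (G ** X) $ j $ k * Gi $ j $ k) = (Gi ** (G ** X)) $ k $ k"
      by (subst (2) matrix_matrix_mult_def) (simp add: Gi_sym[of k] mult.commute)
    then show ?thesis
      by (simp add: matrix_inv_inverse matrix_mul_assoc)
  qed
  then show "(\<Sum>j\<in>UNIV. \<Sum>k\<in>UNIV. (G ** X) $ j $ k * Gi $ j $ k) = trace X"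
    by (subst sum.swap) (simp add: trace_def)
qed

lemma trace_J: "trace J = 0"
proof -
  have "(\<Sum>j\<in>UNIV. E (\<lambda>x. pd j A x $ j)) = E (\<lambda>x. \<Sum>j\<in>UNIV. pd j A x $ j)"
    by (subst E_sum) (auto intro!: tame_poly_bounded[of 0] tame_nth tame_le[OF pd_A_tame])
  also have "\<dots> = 0"
    by (simp add: div_pd avg_def)
  finally show ?thesis
    by (simp only: trace_def E_jac)
qed

text \<open>Splitting C into real and imaginary part, the imaginary part of \<open>HW\<close> is
  -(J^T G + G J). Its contraction with \<open>Gi\<close> is -2 tr J, and tr J is the averaged
  divergence of A, hence \<open>HG\<close> is real.\<close>

lemma HG_eq: "HG = of_real (trace (Gi ** E (hess Vt))
   - trace (Gi ** ((\<epsilon>/2) *\<^sub>R E (hess T) + transpose J ** map_matrix Re C + map_matrix Re C ** J + E (D2 A p))))"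
proof -
  define R where "R = (\<epsilon>/2) *\<^sub>R E (hess T) + transpose J ** map_matrix Re C + map_matrix Re C ** J + E (D2 A p)"
  define X where "X = E (hess Vt) - ((\<epsilon>/2) *\<^sub>R E (hess T) + transpose J ** map_matrix Re C + map_matrix Re C ** J + E (D2 A p))"
  define Y where "Y = transpose J ** G + G ** J"
  have "HW $ j $ k = of_real (X $ j $ k) - \<i> * of_real (Y $ j $ k)" for j k
    by (auto simp: complex_eq_iff HW_def X_def Y_def matrix_matrix_mult_def)
  then have "HG = of_real (\<Sum>j\<in>UNIV. \<Sum>k\<in>UNIV. X $ j $ k * Gi $ j $ k)
      - \<i> * of_real (\<Sum>j\<in>UNIV. \<Sum>k\<in>UNIV. Y $ j $ k * Gi $ j $ k)"
    by (simp add: HG_def left_diff_distrib sum_subtractf sum_distrib_left mult.assoc)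
  also have "(\<Sum>j\<in>UNIV. \<Sum>k\<in>UNIV. Y $ j $ k * Gi $ j $ k) = 0"
    by (simp add: Y_def distrib_right sum.distrib trace_G_Gi trace_transpose_eq trace_J)
  also have "(\<Sum>j\<in>UNIV. \<Sum>k\<in>UNIV. X $ j $ k * Gi $ j $ k) = trace (Gi ** X)"
    unfolding trace_def matrix_matrix_mult_def
    by (subst sum.swap) (simp add: Gi_sym mult.commute)
  also have "\<dots> = trace (Gi ** E (hess Vt)) - trace (Gi ** R)"
  proof -
    have "trace (Gi ** X) + trace (Gi ** R) = trace (Gi ** (X + R))"
      by (simp only: matrix_add_ldistrib trace_add)
    then show ?thesis
      by (simp add: X_def R_def)
  qed
  finally show ?thesis
    by (simp add: R_def)
qed

text \<open>The imaginary part of C C is Re C G + G Re C; contracted with \<open>Gi\<close> and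
  multiplied by \<epsilon>/4 it gives (\<epsilon>/2) tr (Re C), which cancels the imaginary part of
  the kinetic constant. The terms with \<open>HG\<close> cancel each other and \<open>E W\<close> is
  real. This holds for every mass.\<close>

lemma Im_E_w: "Im (E (quad wa wb wM)) = 0"
proof -
  define S where "S = (\<Sum>j\<in>UNIV. \<Sum>k\<in>UNIV. (C ** C) $ j $ k * of_real (Gi $ j $ k))"
  have "Im ((C ** C) $ j $ k) = (map_matrix Re C ** G + G ** map_matrix Re C) $ j $ k" for j k
    by (simp add: matrix_matrix_mult_def sum.distrib)
  then have "Im S = (\<Sum>j\<in>UNIV. \<Sum>k\<in>UNIV. (map_matrix Re C ** G + G ** map_matrix Re C) $ j $ k * Gi $ j $ k)"
    by (simp add: S_def)
  then have ImS: "Im S = 2 * Re (trace C)"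
    by (simp add: distrib_right sum.distrib trace_G_Gi) (simp add: trace_def)
  have "(\<Sum>j\<in>UNIV. \<Sum>k\<in>UNIV. wM $ j $ k * of_real (Gi $ j $ k)) = S + HG / of_real N"
  proof -
    have "wM $ j $ k * of_real (Gi $ j $ k) = (C ** C) $ j $ k * of_real (Gi $ j $ k)
        + HW $ j $ k * of_real (Gi $ j $ k) / of_real N" for j k
      by (simp add: wM_def scaleR_conv_of_real[where 'a = complex] field_simps)
    then show ?thesis
      by (simp only: S_def HG_def sum.distrib sum_divide_distrib)
  qed
  then have "E (quad wa wb wM) = (1/2 * (\<Sum>j\<in>UNIV. (of_real (p $ j))\<^sup>2) - \<i> * of_real \<epsilon> / 2 * trace C
      + of_real (\<epsilon> / 4) * S + E W / of_real N) * of_real N"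
    unfolding E_quad wa_def by (simp add: algebra_simps diff_divide_distrib)
  moreover have "Im (\<Sum>j\<in>UNIV. (complex_of_real (p $ j))\<^sup>2) = 0"
    by (simp add: Im_power2 flip: of_real_power)
  ultimately show ?thesis
    using ImS by (simp add: E_W)
qed

lemma wM_sym: "wM $ j $ k = wM $ k $ j"
proof -
  have "(C ** C) $ j $ k = (C ** C) $ k $ j"
    unfolding matrix_matrix_mult_def by (simp add: C_sym[of j] C_sym[of _ k] mult.commute)
  then show ?thesis
    by (simp add: wM_def HW_sym[of j k])
qed

text \<open>Apart from real force terms, \<open>wb\<close> is C applied to p - E A / N. Taking
  imaginary parts gives the linear system that determines the velocity of the centre.\<close>

lemma Im_wb: "(G *v (p - E A /\<^sub>R N)) $ j = Im (wb $ j)"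
  by (simp add: wb_def gW_def matrix_vector_nth right_diff_distrib sum_subtractf sum_distrib_left mult_ac)

text \<open>The part Re C (p - E A) of the gradient cancels against the term caused by the motion of
  the centre, so that only the forces survive.\<close>

lemma Re_wb:
  assumes "N = 1"
  shows "(\<chi> j. - Re (wb $ j)) + map_matrix Re C *v (p - E A)
    = (\<epsilon>/2) *\<^sub>R E (grad T) + transpose J *v p - E (grad Vt)"
  by (simp add: vec_eq_iff wb_def gW_def matrix_vector_nth[of "map_matrix Re C"] assms
      right_diff_distrib sum_subtractf)

lemma wM_eq:
  assumes "N = 1"
  shows "- wM = - (C ** C) + cmat (E (D2 A p)) + cmat (transpose J) ** C + C ** cmat J
     - cmat (E (hess Vt)) + cmat ((\<epsilon>/2) *\<^sub>R E (hess T))"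
  by (simp add: wM_def HW_def assms)

text \<open>The motion of the centre contributes (p - E A) . p. It turns -|p|^2/2 into +|p|^2/2 and
  cancels the term p . E A contained in \<open>E W\<close>.\<close>

lemma wa_eq:
  assumes "N = 1"
  shows "- wa + of_real ((p - E A) \<bullet> p) =
     of_real (1/2 * (norm p)\<^sup>2) + of_real (\<epsilon>/2 * E T)
     + \<i> * of_real \<epsilon> / 2 * trace C
     - of_real (\<epsilon>/4 * trace (Gi **
         ((\<epsilon>/2) *\<^sub>R E (hess T) + transpose J ** map_matrix Re C + map_matrix Re C ** J + E (D2 A p))))
     - of_real (E Vt)
     + of_real (\<epsilon>/4 * trace (Gi ** E (hess Vt)))"
proof -
  have "(norm p)\<^sup>2 = (\<Sum>j\<in>UNIV. (p $ j)\<^sup>2)"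
    unfolding power2_norm_eq_inner inner_vec_def by (simp add: power2_eq_square)
  then have "(\<Sum>j\<in>UNIV. (complex_of_real (p $ j))\<^sup>2) = of_real ((norm p)\<^sup>2)"
    by simp
  moreover have "(p - E A) \<bullet> p = (norm p)\<^sup>2 - p \<bullet> E A"
    by (simp add: inner_diff_left inner_diff_right power2_norm_eq_inner inner_commute)
  ultimately show ?thesis
    unfolding wa_def E_W HG_eq assms by (simp only:) (simp add: algebra_simps)
qed

end

section \<open>Convergence of the parameters\<close>

text \<open>An explicit antiderivative bounds the integral by 2 / |l|; the product form includes l =
  0.\<close>

lemma norm_integral_exp_i_le:
  "\<bar>l\<bar> * norm (integral {0..1} (\<lambda>x. exp (\<i> * of_real (l * x)))) \<le> 2"
proof (cases "l = 0")
  case False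
  let ?F = "\<lambda>x. exp (\<i> * of_real (l * x)) / (\<i> * of_real l)"
  have "(?F has_vector_derivative exp (\<i> * of_real (l * x))) (at x within {0..1})" for x
  proof -
    have "((\<lambda>z. exp (c * z) / c) has_field_derivative exp (c * z)) (at z)" if "c \<noteq> 0" for c z :: complex
      using that by (auto intro!: derivative_eq_intros)
    from has_vector_derivative_real_field[OF this[of "\<i> * of_real l" "of_real x"]] show ?thesis
      using False by (simp add: mult.assoc)
  qed
  then have "((\<lambda>x. exp (\<i> * of_real (l * x))) has_integral (?F 1 - ?F 0)) {0..1}"
    by (intro fundamental_theorem_of_calculus) auto
  then have "integral {0..1} (\<lambda>x. exp (\<i> * of_real (l * x))) = (exp (\<i> * of_real l) - 1) / (\<i> * of_real l)"
    by (simp add: integral_unique diff_divide_distrib)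
  then have "\<bar>l\<bar> * norm (integral {0..1} (\<lambda>x. exp (\<i> * of_real (l * x)))) = norm (exp (\<i> * of_real l) - 1)"
    using False by (simp add: norm_divide norm_mult)
  also have "\<dots> \<le> norm (exp (\<i> * of_real l)) + norm (1::complex)"
    by (rule norm_triangle_ineq4)
  finally show ?thesis
    by simp
qed simp

text \<open>
  Dominated convergence makes the frequencies bounded, because the integral of a rapidly
  oscillating exponential is small; then the logarithm can be used for one small argument.
\<close>
lemma frequencies_tendsto_zero:
  fixes l :: "nat \<Rightarrow> real"
  assumes lim: "\<And>x. (\<lambda>n. exp (\<i> * of_real (l n * x))) \<longlonglongrightarrow> 1"
  shows "l \<longlonglongrightarrow> 0"
proof -
  define I where "I n = integral {0..1} (\<lambda>x. exp (\<i> * of_real (l n * x)))" for n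
  have "I \<longlonglongrightarrow> integral {0..1::real} (\<lambda>x. 1)"
    unfolding I_def
  proof (rule dominated_convergence(2)[where h = "\<lambda>x. 1"])
    show "(\<lambda>x. exp (\<i> * of_real (l n * x))) integrable_on {0..1}" for n
      by (intro integrable_continuous_interval continuous_intros)
  qed (use lim in auto)
  then have "(\<lambda>n. norm (I n)) \<longlonglongrightarrow> 1"
    using tendsto_norm[of I 1] by simp
  \<comment> \<open>Together with the bound 2 on |l| |I| this threshold yields |l| \<le> 3. At x =
    1/2 the exponent then has imaginary part at most 3/2 < pi in modulus, where \<open>Ln\<close>
    inverts \<open>exp\<close>.\<close>
  then have "eventually (\<lambda>n. 2/3 < norm (I n)) sequentially"
    by (rule order_tendstoD) simp
  then have ev: "eventually (\<lambda>n. \<bar>l n\<bar> \<le> 3) sequentially"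
  proof eventually_elim
    case (elim n)
    have "\<bar>l n\<bar> * (2/3) \<le> \<bar>l n\<bar> * norm (I n)"
      using elim by (intro mult_left_mono) auto
    also have "\<dots> \<le> 2"
      unfolding I_def by (rule norm_integral_exp_i_le)
    finally show ?case
      by simp
  qed
  have "(\<lambda>n. Im (Ln (exp (\<i> * of_real (l n * (1/2)))))) \<longlonglongrightarrow> Im (Ln 1)"
    by (intro tendsto_intros lim tendsto_Ln) auto
  moreover have "eventually (\<lambda>n. Im (Ln (exp (\<i> * of_real (l n * (1/2))))) = l n / 2) sequentially"
    using ev
  proof eventually_elim
    case (elim n)
    then have "Ln (exp (\<i> * of_real (l n * (1/2)))) = \<i> * of_real (l n * (1/2))"
      using pi_gt3 by (intro Ln_exp) auto
    then show ?case
      by (simp only:) simp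
  qed
  ultimately have "(\<lambda>n. l n / 2) \<longlonglongrightarrow> Im (Ln 1)"
    by (rule Lim_transform_eventually)
  from tendsto_mult[OF this tendsto_const[of 2]] show ?thesis
    by simp
qed

text \<open>A single s would leave the real part undetermined up to multiples of 2 pi / s. Dividing
  out the limit and the known moduli leaves pure oscillations whose frequency is the error of the
  real part, and all real s together force it to zero.\<close>

lemma tendsto_exponent:
  fixes z :: "nat \<Rightarrow> complex"
  assumes Im: "(\<lambda>n. Im (z n)) \<longlonglongrightarrow> Im w"
    and exp: "\<And>s. (\<lambda>n. exp (\<i> * of_real s * z n)) \<longlonglongrightarrow> exp (\<i> * of_real s * w)"
  shows "z \<longlonglongrightarrow> w"
proof -
  have "(\<lambda>n. exp (\<i> * of_real ((Re (z n) - Re w) * s))) \<longlonglongrightarrow> 1" for s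
  proof -
    have "(\<lambda>n. exp (\<i> * of_real s * z n) * exp (- (\<i> * of_real s * w)) * of_real (exp (s * (Im (z n) - Im w))))
        \<longlonglongrightarrow> exp (\<i> * of_real s * w) * exp (- (\<i> * of_real s * w)) * of_real (exp (s * (Im w - Im w)))"
      by (intro tendsto_intros exp Im)
    moreover have "exp (\<i> * of_real s * z n) * exp (- (\<i> * of_real s * w)) * of_real (exp (s * (Im (z n) - Im w)))
        = exp (\<i> * of_real ((Re (z n) - Re w) * s))" for n
      by (simp only: exp_of_real[symmetric] exp_add[symmetric], intro arg_cong[where f = exp])
        (auto simp: complex_eq_iff algebra_simps)
    ultimately show ?thesis
      by (simp add: exp_minus)
  qed
  then have "(\<lambda>n. Re (z n) - Re w) \<longlonglongrightarrow> 0"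
    by (rule frequencies_tendsto_zero)
  then have "(\<lambda>n. Re (z n)) \<longlonglongrightarrow> Re w"
    by (simp add: LIM_zero_iff)
  with Im show ?thesis
    by (simp add: tendsto_complex_iff)
qed

lemma tendsto_det:
  fixes M :: "'a \<Rightarrow> real^'n::finite^'n"
  assumes "\<And>i j. ((\<lambda>s. M s $ i $ j) \<longlongrightarrow> L $ i $ j) F"
  shows "((\<lambda>s. det (M s)) \<longlongrightarrow> det L) F"
  unfolding det_def by (intro tendsto_intros assms)

text \<open>Cramer's rule writes the solution as a quotient of determinants, which are polynomials
  in the converging data.\<close>

lemma tendsto_linear_solution:
  fixes G :: "'a \<Rightarrow> real^'n::finite^'n" and v :: "'a \<Rightarrow> real^'n"
  assumes G: "\<And>i j. ((\<lambda>s. G s $ i $ j) \<longlongrightarrow> G0 $ i $ j) F"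
    and r: "\<And>i. ((\<lambda>s. (G s *v v s) $ i) \<longlongrightarrow> (G0 *v v0) $ i) F"
    and det: "\<And>s. det (G s) \<noteq> 0" "det G0 \<noteq> 0"
  shows "(v \<longlongrightarrow> v0) F"
proof (rule vec_tendstoI)
  fix k
  have sol: "v s $ k = det (\<chi> i j. if j = k then (G s *v v s) $ i else G s $ i $ j) / det (G s)" for s
    using cramer_lemma[of k "G s" "v s"] det(1)[of s] by simp
  have sol0: "v0 $ k = det (\<chi> i j. if j = k then (G0 *v v0) $ i else G0 $ i $ j) / det G0"
    using cramer_lemma[of k G0 v0] det(2) by simp
  show "((\<lambda>s. v s $ k) \<longlongrightarrow> v0 $ k) F"
    unfolding sol sol0
    by (intro tendsto_divide tendsto_det det) (auto intro: r G)
qed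

text \<open>Continuity keeps \<open>f s - f t\<close> in the principal strip for s near t, and there
  f is \<open>f t\<close> plus \<open>Ln\<close> of a quotient of exponentials. Without continuity f
  could jump by multiples of 2 pi i.\<close>

lemma has_vector_derivative_log:
  fixes f :: "real \<Rightarrow> complex"
  assumes cont: "continuous (at t within S) f"
    and der: "((\<lambda>s. exp (f s)) has_vector_derivative d) (at t within S)" and t: "t \<in> S"
  shows "(f has_vector_derivative d / exp (f t)) (at t within S)"
proof -
  define r where "r s = exp (f s) / exp (f t)" for s
  have r: "(r has_vector_derivative d / exp (f t)) (at t within S)"
    unfolding r_def by (rule has_vector_derivative_divide[OF der])
  have "(Ln has_field_derivative inverse 1) (at (r t))"
    using has_field_derivative_Ln[of 1] by (simp add: r_def)
  from field_vector_diff_chain_within[OF r has_field_derivative_at_within[OF this]]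
  have "(Ln \<circ> r has_vector_derivative d / exp (f t)) (at t within S)"
    by simp
  then have "((\<lambda>s. Ln (r s) + f t) has_vector_derivative d / exp (f t)) (at t within S)"
    by (auto intro!: derivative_eq_intros simp: o_def)
  moreover have "eventually (\<lambda>s. Ln (r s) + f t = f s) (at t within S)"
  proof -
    have "eventually (\<lambda>s. dist (f s) (f t) < 1) (at t within S)"
      using cont unfolding continuous_within by (rule tendstoD) simp
    then show ?thesis
    proof eventually_elim
      case (elim s)
      then have "\<bar>Im (f s - f t)\<bar> < 1"
        using abs_Im_le_cmod[of "f s - f t"] by (simp add: dist_norm)
      then have "Ln (exp (f s - f t)) = f s - f t"
        using pi_gt3 by (intro Ln_exp) auto
      then show ?case
        by (simp add: r_def exp_diff)
    qed
  qed
  ultimately show ?thesis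
    using t unfolding has_vector_derivative_def
    by (elim has_derivative_transform_eventually) (auto simp: r_def)
qed

lemma exp_i_mult_tendsto_Im:
  assumes "(\<lambda>n. exp (\<i> / of_real \<epsilon> * z n)) \<longlonglongrightarrow> exp (\<i> / of_real \<epsilon> * w)" and "0 < \<epsilon>"
  shows "(\<lambda>n. Im (z n)) \<longlonglongrightarrow> Im w"
proof -
  have ln: "- \<epsilon> * ln (norm (exp (\<i> / of_real \<epsilon> * z))) = Im z" for z
    using assms(2) by (simp add: norm_exp_eq_Re Re_divide_of_real)
  have "(\<lambda>n. - \<epsilon> * ln (norm (exp (\<i> / of_real \<epsilon> * z n)))) \<longlonglongrightarrow> - \<epsilon> * ln (norm (exp (\<i> / of_real \<epsilon> * w)))"
    by (intro tendsto_intros assms) simp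
  then show ?thesis
    by (simp only: ln)
qed

section \<open>The phase and its exact finite differences\<close>

definition phase :: "real^'n \<Rightarrow> real^'n \<Rightarrow> complex^'n^'n \<Rightarrow> complex \<Rightarrow> real^'n::finite \<Rightarrow> complex" where
  "phase q p C \<zeta> x = 1/2 * (\<Sum>j\<in>UNIV. \<Sum>k\<in>UNIV. of_real ((x - q) $ j) * C $ j $ k * of_real ((x - q) $ k))
        + of_real ((x - q) \<bullet> p) + \<zeta>"

lemma gwp_phase: "gwp \<epsilon> q p C \<zeta> x = exp (\<i> / of_real \<epsilon> * phase q p C \<zeta> x)"
  by (simp add: gwp_def phase_def)

text \<open>The gradient of the phase at the point r. The point is kept apart from q, since it stays
  fixed while q varies.\<close>

definition phase_slope :: "real^'n \<Rightarrow> real^'n \<Rightarrow> complex^'n^'n \<Rightarrow> real^'n::finite \<Rightarrow> 'n \<Rightarrow> complex" where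
  "phase_slope q p C r j = of_real (p $ j) + (\<Sum>k\<in>UNIV. C $ j $ k * of_real (r $ k - q $ k))"

lemma phase_translate:
  assumes sym: "\<And>j k. C $ j $ k = C $ k $ j"
  shows "phase q p C \<zeta> (r + v) = phase q p C \<zeta> r + (\<Sum>j\<in>UNIV. of_real (v $ j) * phase_slope q p C r j)
      + 1/2 * (\<Sum>j\<in>UNIV. \<Sum>k\<in>UNIV. C $ j $ k * of_real (v $ j) * of_real (v $ k))"
proof -
  define y where "y j = complex_of_real (r $ j - q $ j)" for j
  define w where "w j = complex_of_real (v $ j)" for j
  have "(\<Sum>j\<in>UNIV. \<Sum>k\<in>UNIV. (y j + w j) * C $ j $ k * (y k + w k))
     = (\<Sum>j\<in>UNIV. \<Sum>k\<in>UNIV. y j * C $ j $ k * y k) + (\<Sum>j\<in>UNIV. \<Sum>k\<in>UNIV. y j * C $ j $ k * w k)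
     + (\<Sum>j\<in>UNIV. \<Sum>k\<in>UNIV. w j * C $ j $ k * y k) + (\<Sum>j\<in>UNIV. \<Sum>k\<in>UNIV. C $ j $ k * w j * w k)"
    by (simp add: algebra_simps sum.distrib)
  also have "(\<Sum>j\<in>UNIV. \<Sum>k\<in>UNIV. y j * C $ j $ k * w k) = (\<Sum>j\<in>UNIV. \<Sum>k\<in>UNIV. w j * C $ j $ k * y k)"
    by (subst sum.swap) (simp add: sym mult_ac)
  finally have quad: "(\<Sum>j\<in>UNIV. \<Sum>k\<in>UNIV. (y j + w j) * C $ j $ k * (y k + w k))
     = (\<Sum>j\<in>UNIV. \<Sum>k\<in>UNIV. y j * C $ j $ k * y k) + 2 * (\<Sum>j\<in>UNIV. \<Sum>k\<in>UNIV. w j * C $ j $ k * y k)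
     + (\<Sum>j\<in>UNIV. \<Sum>k\<in>UNIV. C $ j $ k * w j * w k)"
    by simp
  have e: "complex_of_real ((r + v - q) $ j) = y j + w j" "complex_of_real ((r - q) $ j) = y j" for j
    by (simp_all add: y_def w_def)
  have lin: "complex_of_real ((r + v - q) \<bullet> p) = of_real ((r - q) \<bullet> p) + (\<Sum>j\<in>UNIV. w j * of_real (p $ j))"
    by (simp add: inner_vec_def w_def algebra_simps sum.distrib sum_subtractf)
  have sl: "(\<Sum>j\<in>UNIV. w j * phase_slope q p C r j) = (\<Sum>j\<in>UNIV. w j * of_real (p $ j)) + (\<Sum>j\<in>UNIV. \<Sum>k\<in>UNIV. w j * C $ j $ k * y k)"
    by (simp add: phase_slope_def y_def distrib_left sum.distrib sum_distrib_left mult.assoc)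
  show ?thesis
    unfolding phase_def e lin quad w_def[symmetric] sl by (simp add: algebra_simps)
qed

text \<open>Finite differences of a quadratic are exact. The step s is free because
  \<open>tendsto_exponent\<close> needs exponentials with every real factor; s = 1 is enough for
  derivatives.\<close>

lemma phase_translate_axis:
  assumes sym: "\<And>j k. C $ j $ k = C $ k $ j"
  shows "phase q p C \<zeta> (r + s *\<^sub>R axis j 1) - phase q p C \<zeta> r
      = of_real s * phase_slope q p C r j + of_real (s\<^sup>2) / 2 * C $ j $ j"
    and "phase q p C \<zeta> (r + axis j 1 + s *\<^sub>R axis k 1) - phase q p C \<zeta> (r + axis j 1)
      - phase q p C \<zeta> (r + s *\<^sub>R axis k 1) + phase q p C \<zeta> r = of_real s * C $ j $ k"
proof -
  have ax: "complex_of_real ((s *\<^sub>R axis k 1) $ j) = (if j = k then of_real s else 0)" for s and j k :: 'a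
    by (simp add: axis_def)
  show 1: "phase q p C \<zeta> (r + s *\<^sub>R axis j 1) - phase q p C \<zeta> r
      = of_real s * phase_slope q p C r j + of_real (s\<^sup>2) / 2 * C $ j $ j" for r j
    unfolding phase_translate[OF sym] ax
    by (simp add: if_distrib[where f = "\<lambda>c. _ * c"] if_distrib[where f = "\<lambda>c. c * _"] power2_eq_square cong: if_cong)
  have "phase_slope q p C (r + axis j 1) k = phase_slope q p C r k + C $ k $ j"
  proof -
    have "C $ k $ i * of_real ((r + axis j 1) $ i - q $ i) = C $ k $ i * of_real (r $ i - q $ i) + (if i = j then C $ k $ i else 0)" for i
      by (simp add: axis_def algebra_simps)
    then show ?thesis
      by (simp add: phase_slope_def sum.distrib)
  qed
  then show "phase q p C \<zeta> (r + axis j 1 + s *\<^sub>R axis k 1) - phase q p C \<zeta> (r + axis j 1)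
      - phase q p C \<zeta> (r + s *\<^sub>R axis k 1) + phase q p C \<zeta> r = of_real s * C $ j $ k"
    using 1[of "r + axis j 1" k] 1[of r k] by (simp add: algebra_simps sym[of k j])
qed

section \<open>Regularity of integrals and potentials\<close>

lemma exp_diff_le:
  fixes a b :: real
  shows "\<bar>exp (- a) - exp (- b)\<bar> \<le> \<bar>a - b\<bar> * (exp (- a) + exp (- b))"
proof -
  have "exp (- a) - exp (- b) \<le> \<bar>a - b\<bar> * (exp (- a) + exp (- b))" if "a \<le> b" for a b :: real
  proof -
    have "exp (- a) * (1 - (b - a)) \<le> exp (- a) * exp (- (b - a))"
    proof (rule mult_left_mono)
      show "1 - (b - a) \<le> exp (- (b - a))"
        using exp_ge_add_one_self[of "- (b - a)"] by linarith
    qed simp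
    also have "exp (- a) * exp (- (b - a)) = exp (- b)"
      by (simp flip: exp_add)
    finally have "exp (- a) - exp (- b) \<le> (b - a) * exp (- a)"
      by (simp add: algebra_simps)
    also have "\<dots> \<le> (b - a) * (exp (- a) + exp (- b))"
      using that by (intro mult_left_mono) auto
    finally show ?thesis
      using that by simp
  qed
  from this[of a b] this[of b a] show ?thesis
    by (cases "a \<le> b") (auto simp: abs_if add.commute)
qed

text \<open>Dominated convergence, where the exponents themselves vary. For small \<open>h n\<close>
  the perturbation, of quadratic growth, consumes at most half of the coercivity of P; the finitely
  many earlier indices are dropped.\<close>

lemma integral_exp_difference_quotient:
  fixes P :: "'a::euclidean_space \<Rightarrow> real" and h :: "nat \<Rightarrow> real"
  assumes cont: "continuous_on UNIV P" "\<And>n. continuous_on UNIV (Pn n)"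
    and c: "0 < c" "\<And>x. c * (norm x)\<^sup>2 - K \<le> P x"
    and h: "h \<longlonglongrightarrow> 0" "\<And>n. h n \<noteq> 0"
    and le: "\<And>n x. \<bar>Pn n x - P x\<bar> \<le> L * \<bar>h n\<bar> * (1 + norm x)\<^sup>2"
    and D: "\<And>x. (\<lambda>n. (Pn n x - P x) / h n) \<longlonglongrightarrow> D x"
  shows "(\<lambda>n. (integral\<^sup>L lborel (\<lambda>x. exp (- Pn n x)) - integral\<^sup>L lborel (\<lambda>x. exp (- P x))) / h n)
    \<longlonglongrightarrow> - integral\<^sup>L lborel (\<lambda>x. D x * exp (- P x))"
proof -
  \<comment> \<open>A perturbation of at most (c/4) (1 + |x|)^2 \<le> (c/4) (2 + 2 |x|^2) lowers c
    |x|^2 - K to this function.\<close>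
  let ?b = "\<lambda>x. c / 2 * (norm x)\<^sup>2 - (K + c / 2)"
  have "(\<lambda>n. L * \<bar>h n\<bar>) \<longlonglongrightarrow> L * \<bar>0\<bar>"
    by (intro tendsto_intros h)
  then have "eventually (\<lambda>n. L * \<bar>h n\<bar> < c / 4) sequentially"
    using c(1) by (intro order_tendstoD) auto
  then obtain n0 where n0: "\<And>n. n \<ge> n0 \<Longrightarrow> L * \<bar>h n\<bar> < c / 4"
    by (auto simp: eventually_sequentially)
  have L: "0 \<le> L"
    using le[of 0 0] h(2)[of 0] by (smt (verit) mult_neg_pos zero_less_abs_iff norm_zero one_power2 mult.right_neutral)
  have lower: "?b x \<le> Pn n x" if "n \<ge> n0" for n x
  proof -
    have "(1 + norm x)\<^sup>2 \<le> 2 + 2 * (norm x)\<^sup>2"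
      using zero_le_power2[of "1 - norm x"] by (simp add: power2_sum power2_diff)
    then have "L * \<bar>h n\<bar> * (1 + norm x)\<^sup>2 \<le> c / 4 * (2 + 2 * (norm x)\<^sup>2)"
      using n0[OF that] L c(1) by (intro mult_mono) auto
    then have "P x - Pn n x \<le> c / 4 * (2 + 2 * (norm x)\<^sup>2)"
      using le[of n x] by linarith
    then show ?thesis
      using c(2)[of x] by (simp add: algebra_simps)
  qed
  have dec: "gaussian_decay (\<lambda>x. exp (- Q x) *\<^sub>R (1::real))" if "\<And>x. c / 2 * (norm x)\<^sup>2 - K' \<le> Q x" for Q :: "'a \<Rightarrow> real" and K'
    using c(1) that by (intro exp_quadratic_gaussian_decay[of "c / 2"] poly_bounded_const) auto
  have int: "integrable lborel (\<lambda>x. exp (- Q x))"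
    if "\<And>x. c / 2 * (norm x)\<^sup>2 - K' \<le> Q x" "continuous_on UNIV Q" for Q :: "'a \<Rightarrow> real" and K'
  proof -
    have "continuous_on UNIV (\<lambda>x. exp (- Q x) *\<^sub>R (1::real))"
      by (intro continuous_intros that(2))
    from gaussian_decay_integrable[OF dec[OF that(1)] this] show ?thesis
      by simp
  qed
  have intPn: "integrable lborel (\<lambda>x. exp (- Pn (n + n0) x))" for n
    by (rule int[OF lower cont(2)]) simp
  have intP: "integrable lborel (\<lambda>x. exp (- P x))"
  proof (rule int[OF _ cont(1)])
    have "c / 2 * (norm x)\<^sup>2 \<le> c * (norm x)\<^sup>2" for x :: 'a
      using c(1) by (intro mult_right_mono) auto
    then show "c / 2 * (norm x)\<^sup>2 - K \<le> P x" for x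
      using c(2)[of x] by (meson diff_right_mono order_trans)
  qed
  let ?Q = "\<lambda>n x. (exp (- Pn (n + n0) x) - exp (- P x)) / h (n + n0)"
  define H where "H x = exp (- ?b x) *\<^sub>R ((1 + norm x)\<^sup>2)" for x :: 'a
  have bound: "norm (?Q n x) \<le> 2 * L * H x" for n x
  proof -
    have PH: "exp (- Q) \<le> exp (- ?b x)" if "?b x \<le> Q" for Q
      using that by simp
    have "c / 2 * (norm x)\<^sup>2 \<le> c * (norm x)\<^sup>2"
      using c(1) by (intro mult_right_mono) auto
    then have "?b x \<le> P x"
      using c(2)[of x] c(1) by linarith
    then have "exp (- Pn (n + n0) x) + exp (- P x) \<le> 2 * exp (- ?b x)"
      using PH[OF lower[of "n + n0" x]] PH[of "P x"] by (simp del: exp_le_cancel_iff)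
    then have "\<bar>Pn (n + n0) x - P x\<bar> * (exp (- Pn (n + n0) x) + exp (- P x))
        \<le> (L * \<bar>h (n + n0)\<bar> * (1 + norm x)\<^sup>2) * (2 * exp (- ?b x))"
      using le[of "n + n0" x] by (intro mult_mono) (auto intro: add_nonneg_nonneg)
    then have "\<bar>exp (- Pn (n + n0) x) - exp (- P x)\<bar> \<le> \<bar>h (n + n0)\<bar> * (2 * L * H x)"
      using exp_diff_le[of "Pn (n + n0) x" "P x"] by (simp add: H_def mult_ac)
    then show ?thesis
      using h(2)[of "n + n0"] by (simp add: divide_simps mult.commute)
  qed
  have "(\<lambda>n. integral\<^sup>L lborel (?Q n)) \<longlonglongrightarrow> integral\<^sup>L lborel (\<lambda>x. - (D x * exp (- P x)))"
  proof (rule integral_dominated_convergence[where w = "\<lambda>x. 2 * L * H x"])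
    have "poly_bounded (\<lambda>x::'a. (1 + norm x)\<^sup>2)"
      by (rule poly_boundedI[where K = 1 and k = 2]) (auto intro!: continuous_intros)
    then have "gaussian_decay H"
      unfolding H_def using c(1) by (intro exp_quadratic_gaussian_decay[of "c / 2" "K + c / 2"]) auto
    then have "integrable lborel H"
      by (rule gaussian_decay_integrable) (auto simp: H_def intro!: continuous_intros)
    then show "integrable lborel (\<lambda>x. 2 * L * H x)"
      by (rule integrable_mult_right)
    have lim: "(\<lambda>n. ?Q n x) \<longlonglongrightarrow> - (D x * exp (- P x))" for x
    proof -
      have Pl: "(\<lambda>n. Pn n x - P x) \<longlonglongrightarrow> 0"
      proof -
        have "(\<lambda>n. (Pn n x - P x) / h n * h n) \<longlonglongrightarrow> D x * 0"
          by (intro tendsto_mult D h)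
        then show ?thesis
          using h(2) by simp
      qed
      have "((\<lambda>y. exp (- y)) has_vector_derivative - exp (- P x)) (at (P x))"
        by (auto intro!: derivative_eq_intros simp: has_real_derivative_iff_has_vector_derivative[symmetric])
      then have q: "((\<lambda>y. (exp (- y) - exp (- P x)) /\<^sub>R (y - P x)) \<longlongrightarrow> - exp (- P x)) (at (P x))"
        by (simp add: has_vector_derivative_iff_tendsto)
      \<comment> \<open>The difference quotient of exp (-y), extended continuously to
        \<open>P x\<close>, so that the factorisation also covers indices with
        \<open>Pn n x = P x\<close>.\<close>
      define g where "g y = (if y = P x then - exp (- P x) else (exp (- y) - exp (- P x)) / (y - P x))" for y
      have "(g \<longlongrightarrow> - exp (- P x)) (at (P x))"
        using q by (rule Lim_transform_eventually) (auto simp: g_def eventually_at_filter divide_inverse mult.commute)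
      moreover have "g (P x) = - exp (- P x)"
        by (simp add: g_def)
      ultimately have "isCont g (P x)"
        by (simp only: isCont_def)
      moreover have "(\<lambda>n. Pn n x) \<longlonglongrightarrow> P x"
        using Pl by (simp add: LIM_zero_iff)
      ultimately have "(\<lambda>n. g (Pn n x)) \<longlonglongrightarrow> g (P x)"
        by (rule isCont_tendsto_compose)
      from tendsto_mult[OF D[of x] this]
      have "(\<lambda>n. (Pn n x - P x) / h n * g (Pn n x)) \<longlonglongrightarrow> - (D x * exp (- P x))"
        by (simp add: g_def)
      moreover have "(Pn n x - P x) / h n * g (Pn n x) = (exp (- Pn n x) - exp (- P x)) / h n" for n
        by (simp add: g_def)
      ultimately have "(\<lambda>n. (exp (- Pn n x) - exp (- P x)) / h n) \<longlonglongrightarrow> - (D x * exp (- P x))"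
        by (simp only:)
      then show ?thesis
        by (rule LIMSEQ_ignore_initial_segment)
    qed
    then show "AE x in lborel. (\<lambda>n. ?Q n x) \<longlonglongrightarrow> - (D x * exp (- P x))"
      by simp
    show mQ: "?Q n \<in> borel_measurable lborel" for n
      using cont by (simp, intro borel_measurable_continuous_onI continuous_intros) (auto simp: h)
    show "(\<lambda>x. - (D x * exp (- P x))) \<in> borel_measurable lborel"
      by (rule borel_measurable_LIMSEQ_real[OF lim mQ])
    show "AE x in lborel. norm (?Q n x) \<le> 2 * L * H x" for n
      using bound by simp
  qed
  then have "(\<lambda>n. (integral\<^sup>L lborel (\<lambda>x. exp (- Pn (n + n0) x)) - integral\<^sup>L lborel (\<lambda>x. exp (- P x))) / h (n + n0))
    \<longlonglongrightarrow> - integral\<^sup>L lborel (\<lambda>x. D x * exp (- P x))"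
    using intPn intP by simp
  then show ?thesis
    by (rule LIMSEQ_offset)
qed

section \<open>Tameness of admissible potentials\<close>

lemma smooth_frechet:
  assumes "smooth f"
  shows "f differentiable (at x)" "continuous_on UNIV f" "smooth (\<lambda>x. frechet_derivative f (at x) v)"
proof -
  have "Ck (Suc k) f" "Ck 0 f" for k
    using assms unfolding smooth_def by blast+
  then show "f differentiable (at x)" "continuous_on UNIV f" "smooth (\<lambda>x. frechet_derivative f (at x) v)"
    unfolding smooth_def by auto
qed

lemma section_differentiable:
  fixes g :: "real \<times> (real^'n::finite) \<Rightarrow> 'b::real_normed_vector"
  assumes "g differentiable (at (t, x))"
  shows "(\<lambda>x. g (t, x)) differentiable (at x)"
    and "pd j (\<lambda>x. g (t, x)) x = frechet_derivative g (at (t, x)) (0, axis j 1)"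
proof -
  have "((\<lambda>x. (t, x)) has_derivative (\<lambda>h. (0, h))) (at x)"
    by (auto intro!: derivative_eq_intros)
  from has_derivative_compose[OF this, of g "frechet_derivative g (at (t, x))"]
  have *: "((\<lambda>x. g (t, x)) has_derivative (\<lambda>h. frechet_derivative g (at (t, x)) (0, h))) (at x)"
    using assms frechet_derivative_works by blast
  then show "(\<lambda>x. g (t, x)) differentiable (at x)"
    by (rule differentiableI)
  show "pd j (\<lambda>x. g (t, x)) x = frechet_derivative g (at (t, x)) (0, axis j 1)"
    by (rule pd_eqI[OF *])
qed

text \<open>The induction keeps joint smoothness in (t, x): a spatial partial derivative at fixed t
  is the section of a Frechet derivative in the direction \<open>(0, axis j 1)\<close>.\<close>

lemma pds_section_smooth:
  fixes f :: "real \<times> (real^'n::finite) \<Rightarrow> 'b::real_normed_vector"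
  assumes "smooth f"
  shows "\<exists>g. smooth g \<and> (\<forall>t x. pds js (\<lambda>x. f (t, x)) x = g (t, x))"
proof (induction js)
  case Nil
  show ?case
    using assms by (intro exI[of _ f]) (simp add: pds_def)
next
  case (Cons j js)
  then obtain g where g: "smooth g" "\<And>t x. pds js (\<lambda>x. f (t, x)) x = g (t, x)"
    by blast
  have "pds (j # js) (\<lambda>x. f (t, x)) x = frechet_derivative g (at (t, x)) (0, axis j 1)" for t x
  proof -
    have "pds js (\<lambda>x. f (t, x)) = (\<lambda>x. g (t, x))"
      using g(2) by auto
    moreover have "pds (j # js) (\<lambda>x. f (t, x)) = pd j (pds js (\<lambda>x. f (t, x)))"
      by (simp add: pds_def)
    ultimately have "pds (j # js) (\<lambda>x. f (t, x)) x = pd j (\<lambda>x. g (t, x)) x"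
      by (simp only:)
    then show ?thesis
      using section_differentiable(2)[OF smooth_frechet(1)[OF g(1)]] by simp
  qed
  then show ?case
    using smooth_frechet(3)[OF g(1)] by blast
qed

lemma pds_section:
  fixes f :: "real \<times> (real^'n::finite) \<Rightarrow> 'b::real_normed_vector"
  assumes "smooth f"
  shows "pds js (\<lambda>x. f (t, x)) differentiable (at x)" "continuous_on UNIV (pds js (\<lambda>x. f (t, x)))"
proof -
  obtain g where g: "smooth g" "\<And>t x. pds js (\<lambda>x. f (t, x)) x = g (t, x)"
    using pds_section_smooth[OF assms] by blast
  have eq: "pds js (\<lambda>x. f (t, x)) = (\<lambda>x. g (t, x))"
    using g(2) by auto
  show *: "pds js (\<lambda>x. f (t, x)) differentiable (at x)" for x
    unfolding eq by (rule section_differentiable(1)[OF smooth_frechet(1)[OF g(1)]])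
  show "continuous_on UNIV (pds js (\<lambda>x. f (t, x)))"
    using * by (simp add: continuous_on_eq_continuous_at differentiable_imp_continuous_within)
qed

lemma pds_tame:
  fixes f :: "real \<times> (real^'n::finite) \<Rightarrow> 'b::real_normed_vector"
  assumes "smooth f" and bdd: "\<And>js. length js \<ge> m \<Longrightarrow> bounded (range (\<lambda>(t, x). pds js (\<lambda>x. f (t, x)) x))"
  shows "length js \<ge> m \<Longrightarrow> tame n (pds js (\<lambda>x. f (t, x)))"
proof (induction n arbitrary: js)
  have pb: "poly_bounded (pds js (\<lambda>x. f (t, x)))" if "length js \<ge> m" for js
  proof (rule poly_bounded_bounded)
    show "bounded (range (pds js (\<lambda>x. f (t, x))))"
      by (rule bounded_subset[OF bdd[OF that]]) auto
  qed (rule pds_section[OF assms(1)])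
  {
    case 0
    then show ?case
      using pb by simp
  next
    case (Suc n)
    have "pd j (pds js (\<lambda>x. f (t, x))) = pds (j # js) (\<lambda>x. f (t, x))" for j
      by (simp add: pds_def)
    then show ?case
      using Suc pb pds_section(1)[OF assms(1)] by (simp del: pds_def)
  }
qed

lemma tame_from_pd:
  assumes "\<And>x. f differentiable (at x)" "\<And>j. tame n (pd j f)"
  shows "tame (Suc n) f"
  using assms poly_bounded_from_pd[OF assms(1)] tame_poly_bounded[OF assms(2)] by simp

text \<open>Derivatives of A are bounded from order one on and those of \<open>Vtilde\<close> from
  order two on. The lower orders gain polynomial growth by using \<open>tame_from_pd\<close> once
  for A and twice for \<open>Vtilde\<close>.\<close>

lemma admissible_potentials_tame:
  assumes "admissible_potentials A V"
  shows "tame 3 (A t)" "tame 2 (Vtilde A V t)"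
    and "(\<Sum>j\<in>UNIV. pd j (\<lambda>y. A t y $ j) x) = 0"
proof -
  have sA: "smooth (\<lambda>(t, x). A t x)" and sV: "smooth (\<lambda>(t, x). Vtilde A V t x)"
    and bV: "\<And>js. length js \<ge> 2 \<Longrightarrow> bounded (range (\<lambda>(t, x). pds js (Vtilde A V t) x))"
    and bA: "\<And>js. length js \<ge> 1 \<Longrightarrow> bounded (range (\<lambda>(t, x). pds js (A t) x))"
    using assms unfolding admissible_potentials_def by blast+
  have tA: "tame n (pds js (A t))" if "length js \<ge> 1" for js n
    using pds_tame[OF sA, of 1 js n t] bA that by simp
  have tV: "tame n (pds js (Vtilde A V t))" if "length js \<ge> 2" for js n
    using pds_tame[OF sV, of 2 js n t] bV that by simp
  have dA: "pds js (A t) differentiable (at x)" for js x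
    using pds_section(1)[OF sA, of js t x] by simp
  have dV: "pds js (Vtilde A V t) differentiable (at x)" for js x
    using pds_section(1)[OF sV, of js t x] by simp
  have "tame (Suc 2) (A t)"
  proof (rule tame_from_pd)
    show "A t differentiable (at x)" for x
      using dA[of "[]" x] by (simp add: pds_def)
    show "tame 2 (pd j (A t))" for j
      using tA[of "[j]" 2] by (simp add: pds_def)
  qed
  then show "tame 3 (A t)"
    by (simp only: eval_nat_numeral)
  have "tame (Suc (Suc 0)) (Vtilde A V t)"
  proof (intro tame_from_pd)
    show "Vtilde A V t differentiable (at x)" for x
      using dV[of "[]" x] by (simp add: pds_def)
    show "pd j (Vtilde A V t) differentiable (at x)" for j x
      using dV[of "[j]" x] by (simp add: pds_def)
    show "tame 0 (pd k (pd j (Vtilde A V t)))" for j k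
      using tV[of "[k, j]" 0] by (simp add: pds_def)
  qed
  then show "tame 2 (Vtilde A V t)"
    by (simp only: numeral_2_eq_2)
  show "(\<Sum>j\<in>UNIV. pd j (\<lambda>y. A t y $ j) x) = 0"
    using assms unfolding admissible_potentials_def by blast
qed

section \<open>The equations of motion\<close>

lemma width_matrix_det: "width_matrix C \<Longrightarrow> det (map_matrix Im C) \<noteq> 0"
  unfolding invertible_det_nz[symmetric] width_matrix_def
  by (rule positive_definite_invertible) blast

lemma Im_phase_slope:
  "Im (phase_slope q p C r j) = (map_matrix Im C *v (r - q)) $ j"
  by (simp add: phase_slope_def matrix_vector_nth)

text \<open>Quotients of values of the packets exponentiate finite differences of their phases. The
  order is forced: C comes first, then the slope at 0, whose imaginary part -(Im C) q determines q,
  and p is what is left of the real part.\<close>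

lemma parameters_tendsto_sequentially:
  fixes q p :: "nat \<Rightarrow> real^'n::finite"
  assumes eps: "0 < \<epsilon>" and width: "\<And>n. width_matrix (C n)" "width_matrix C0"
    and lim: "\<And>x. (\<lambda>n. gwp \<epsilon> (q n) (p n) (C n) (\<zeta> n) x) \<longlonglongrightarrow> gwp \<epsilon> q0 p0 C0 \<zeta>0 x"
  shows "q \<longlonglongrightarrow> q0" and "p \<longlonglongrightarrow> p0" and "C \<longlonglongrightarrow> C0"
proof -
  let ?P = "\<lambda>n. phase (q n) (p n) (C n) (\<zeta> n)" and ?Q = "phase q0 p0 C0 \<zeta>0"
  let ?e = "\<lambda>z. exp (\<i> / of_real \<epsilon> * z)"
  note sym = width_matrix_sym[OF width(1)] width_matrix_sym[OF width(2)]
  have e: "(\<lambda>n. ?e (?P n x)) \<longlonglongrightarrow> ?e (?Q x)" for x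
    using lim[of x] by (simp only: gwp_phase)
  have Im: "(\<lambda>n. Im (?P n x)) \<longlonglongrightarrow> Im (?Q x)" for x
    using e eps by (rule exp_i_mult_tendsto_Im)
  have C2: "(\<lambda>n. ?e (of_real s * C n $ j $ k)) \<longlonglongrightarrow> ?e (of_real s * C0 $ j $ k)" for s j k
  proof -
    let ?a = "axis j 1 + s *\<^sub>R axis k 1" and ?b = "axis j (1::real)" and ?c = "s *\<^sub>R axis k (1::real)"
    have "(\<lambda>n. ?e (?P n ?a) / ?e (?P n ?b) / ?e (?P n ?c) * ?e (?P n 0))
        \<longlonglongrightarrow> ?e (?Q ?a) / ?e (?Q ?b) / ?e (?Q ?c) * ?e (?Q 0)"
      by (rule tendsto_mult[OF tendsto_divide[OF tendsto_divide[OF e e exp_not_eq_zero] e exp_not_eq_zero] e])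
    moreover have "?e a / ?e b / ?e c * ?e d = ?e (a - b - c + d)" for a b c d
      by (simp only: exp_diff exp_add ring_distribs)
    moreover have "?P n ?a - ?P n ?b - ?P n ?c + ?P n 0 = of_real s * C n $ j $ k" for n
      using phase_translate_axis(2)[OF sym(1), where r = 0 and j = j and k = k and s = s] by simp
    moreover have "?Q ?a - ?Q ?b - ?Q ?c + ?Q 0 = of_real s * C0 $ j $ k"
      using phase_translate_axis(2)[OF sym(2), where r = 0 and j = j and k = k and s = s] by simp
    ultimately show ?thesis
      by (simp only:)
  qed
  have C_Im: "(\<lambda>n. Im (C n $ j $ k)) \<longlonglongrightarrow> Im (C0 $ j $ k)" for j k
    by (rule exp_i_mult_tendsto_Im[OF _ eps]) (use C2[of 1 j k] in simp)
  have C: "(\<lambda>n. C n $ j $ k) \<longlonglongrightarrow> C0 $ j $ k" for j k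
  proof (rule tendsto_exponent[OF C_Im])
    show "(\<lambda>n. exp (\<i> * of_real s * C n $ j $ k)) \<longlonglongrightarrow> exp (\<i> * of_real s * C0 $ j $ k)" for s
      using C2[of "\<epsilon> * s" j k] eps by (simp add: mult.assoc)
  qed
  then show "C \<longlonglongrightarrow> C0"
    by (intro vec_tendstoI)
  let ?S = "\<lambda>n. phase_slope (q n) (p n) (C n) 0" and ?R = "phase_slope q0 p0 C0 0"
  \<comment> \<open>Besides the slope the first difference contains s^2/2 times a diagonal entry of
    C; its exponential can be divided out because C is already known to converge.\<close>
  have S2: "(\<lambda>n. ?e (of_real s * ?S n j)) \<longlonglongrightarrow> ?e (of_real s * ?R j)" for s j
  proof -
    let ?a = "s *\<^sub>R axis j (1::real)"
    have "(\<lambda>n. ?e (?P n ?a) / ?e (?P n 0) / ?e (of_real (s\<^sup>2) / 2 * C n $ j $ j))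
        \<longlonglongrightarrow> ?e (?Q ?a) / ?e (?Q 0) / ?e (of_real (s\<^sup>2) / 2 * C0 $ j $ j)"
      by (rule tendsto_divide[OF tendsto_divide[OF e e exp_not_eq_zero]
            tendsto_exp[OF tendsto_mult[OF tendsto_const tendsto_mult[OF tendsto_const C]]] exp_not_eq_zero])
    moreover have "?e a / ?e b / ?e c = ?e (a - b - c)" for a b c
      by (simp only: exp_diff exp_add ring_distribs)
    moreover have "?P n ?a - ?P n 0 - of_real (s\<^sup>2) / 2 * C n $ j $ j = of_real s * ?S n j" for n
      using phase_translate_axis(1)[OF sym(1), where r = 0 and j = j and s = s] by simp
    moreover have "?Q ?a - ?Q 0 - of_real (s\<^sup>2) / 2 * C0 $ j $ j = of_real s * ?R j"
      using phase_translate_axis(1)[OF sym(2), where r = 0 and j = j and s = s] by simp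
    ultimately show ?thesis
      by (simp only:)
  qed
  have S_Im: "(\<lambda>n. Im (?S n j)) \<longlonglongrightarrow> Im (?R j)" for j
    by (rule exp_i_mult_tendsto_Im[OF _ eps]) (use S2[of 1 j] in simp)
  have S: "(\<lambda>n. ?S n j) \<longlonglongrightarrow> ?R j" for j
  proof (rule tendsto_exponent[OF S_Im])
    show "(\<lambda>n. exp (\<i> * of_real s * ?S n j)) \<longlonglongrightarrow> exp (\<i> * of_real s * ?R j)" for s
      using S2[of "\<epsilon> * s" j] eps by (simp add: mult.assoc)
  qed
  have q_neg: "(\<lambda>n. 0 - q n) \<longlonglongrightarrow> 0 - q0"
  proof (rule tendsto_linear_solution[where G = "\<lambda>n. map_matrix Im (C n)" and ?G0.0 = "map_matrix Im C0"])
    show "(\<lambda>n. map_matrix Im (C n) $ i $ j) \<longlonglongrightarrow> map_matrix Im C0 $ i $ j" for i j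
      using C_Im by (simp only: nth_map_matrix)
    show "(\<lambda>n. (map_matrix Im (C n) *v (0 - q n)) $ i) \<longlonglongrightarrow> (map_matrix Im C0 *v (0 - q0)) $ i" for i
      using S_Im by (simp only: Im_phase_slope)
  qed (rule width_matrix_det[OF width(1)] width_matrix_det[OF width(2)])+
  from tendsto_minus[OF this] show q: "q \<longlonglongrightarrow> q0"
    by simp
  show "p \<longlonglongrightarrow> p0"
  proof (rule vec_tendstoI)
    fix j
    have p_eq: "p $ j = Re (phase_slope q p C 0 j - (\<Sum>k\<in>UNIV. C $ j $ k * of_real (0 - q $ k)))"
      for q p :: "real^'n" and C
      by (simp add: phase_slope_def)
    have "(\<lambda>n. Re (?S n j - (\<Sum>k\<in>UNIV. C n $ j $ k * of_real (0 - q n $ k))))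
        \<longlonglongrightarrow> Re (?R j - (\<Sum>k\<in>UNIV. C0 $ j $ k * of_real (0 - q0 $ k)))"
      by (rule tendsto_Re[OF tendsto_diff[OF S tendsto_sum[OF tendsto_mult[OF C
            tendsto_of_real[OF tendsto_diff[OF tendsto_const tendsto_vec_nth[OF q]]]]]]])
    then show "(\<lambda>n. p n $ j) \<longlonglongrightarrow> p0 $ j"
      by (simp only: p_eq[symmetric])
  qed
qed

lemma parameters_tendsto:
  fixes q p :: "real \<Rightarrow> real^'n::finite"
  assumes eps: "0 < \<epsilon>" and width: "\<And>s. s \<in> I \<Longrightarrow> width_matrix (C s)" and t: "t \<in> I"
    and lim: "\<And>x. ((\<lambda>s. gwp \<epsilon> (q s) (p s) (C s) (\<zeta> s) x) \<longlongrightarrow> gwp \<epsilon> (q t) (p t) (C t) (\<zeta> t) x) (at t within I)"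
  shows "(q \<longlongrightarrow> q t) (at t within I)" and "(p \<longlongrightarrow> p t) (at t within I)" and "(C \<longlongrightarrow> C t) (at t within I)"
proof -
  have "(\<lambda>n. q (X n)) \<longlonglongrightarrow> q t \<and> (\<lambda>n. p (X n)) \<longlonglongrightarrow> p t \<and> (\<lambda>n. C (X n)) \<longlonglongrightarrow> C t"
    if X: "\<forall>i. X i \<in> I - {t}" "X \<longlonglongrightarrow> t" for X
  proof -
    have "(\<lambda>n. gwp \<epsilon> (q (X n)) (p (X n)) (C (X n)) (\<zeta> (X n)) x) \<longlonglongrightarrow> gwp \<epsilon> (q t) (p t) (C t) (\<zeta> t) x" for x
      using lim[of x] X unfolding tendsto_at_iff_sequentially by (auto simp: o_def)
    from parameters_tendsto_sequentially[OF eps _ _ this] show ?thesis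
      using X width t by auto
  qed
  then show "(q \<longlongrightarrow> q t) (at t within I)" "(p \<longlongrightarrow> p t) (at t within I)" "(C \<longlongrightarrow> C t) (at t within I)"
    unfolding tendsto_at_iff_sequentially by (auto simp: o_def)
qed

text \<open>A constant sequence converges only to its own value, so uniqueness is a case of the
  convergence statement.\<close>

lemma parameters_unique:
  assumes "0 < \<epsilon>" "width_matrix C" "width_matrix C'" "gwp \<epsilon> q p C \<zeta> = gwp \<epsilon> q' p' C' \<zeta>'"
  shows "q = q'" "p = p'" "C = C'"
proof -
  have "(\<lambda>n::nat. gwp \<epsilon> q p C \<zeta> x) \<longlonglongrightarrow> gwp \<epsilon> q' p' C' \<zeta>' x" for x
    using assms(4) by simp
  from parameters_tendsto_sequentially[OF assms(1) _ _ this] show "q = q'" "p = p'" "C = C'"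
    using assms(2,3) LIMSEQ_const_iff by blast+
qed

section \<open>Differentiating the parameters\<close>

lemma has_vector_derivative_vec:
  fixes f :: "real \<Rightarrow> 'b::real_normed_vector^'n::finite"
  assumes "\<And>j. ((\<lambda>s. f s $ j) has_vector_derivative D $ j) (at t within I)"
  shows "(f has_vector_derivative D) (at t within I)"
  unfolding has_vector_derivative_iff_tendsto
  by (rule vec_tendstoI) (use assms in \<open>simp add: has_vector_derivative_iff_tendsto\<close>)

lemma has_vector_derivative_Im:
  "(f has_vector_derivative D) F \<Longrightarrow> ((\<lambda>s. Im (f s)) has_vector_derivative Im D) F"
  using bounded_linear.has_vector_derivative[OF bounded_linear_Im] .

lemma has_vector_derivative_Re:
  "(f has_vector_derivative D) F \<Longrightarrow> ((\<lambda>s. Re (f s)) has_vector_derivative Re D) F"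
  using bounded_linear.has_vector_derivative[OF bounded_linear_Re] .

text \<open>Convergent quotients are bounded. The bound holds along the whole sequence, which is
  what domination under the integral requires.\<close>

lemma has_vector_derivative_lipschitz:
  assumes "(f has_vector_derivative D) (at t within I)" "\<And>n. X n \<in> I - {t}" "X \<longlonglongrightarrow> t"
  obtains B where "\<And>n. norm (f (X n) - f t) \<le> B * \<bar>X n - t\<bar>"
proof -
  have "(\<lambda>n. (f (X n) - f t) /\<^sub>R (X n - t)) \<longlonglongrightarrow> D"
    using assms unfolding has_vector_derivative_iff_tendsto tendsto_at_iff_sequentially by (auto simp: o_def)
  from convergent_imp_Bseq[OF convergentI[OF this]]
  obtain B where B: "\<And>n. norm ((f (X n) - f t) /\<^sub>R (X n - t)) \<le> B"
    unfolding Bseq_def by blast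
  have "norm (f (X n) - f t) \<le> B * \<bar>X n - t\<bar>" for n
  proof -
    have "X n - t \<noteq> 0"
      using assms(2)[of n] by auto
    then show ?thesis
      using B[of n] by (simp add: divide_simps)
  qed
  then show ?thesis
    using that by blast
qed

lemma phase_tendsto:
  assumes "(q \<longlongrightarrow> q0) F" "(p \<longlongrightarrow> p0) F" "(C \<longlongrightarrow> C0) F" "(\<zeta> \<longlongrightarrow> \<zeta>0) F"
  shows "((\<lambda>s. phase (q s) (p s) (C s) (\<zeta> s) x) \<longlongrightarrow> phase q0 p0 C0 \<zeta>0 x) F"
  unfolding phase_def by (intro tendsto_intros assms)

text \<open>
  The values of the phase at finitely many points determine the parameters, and the phase is
  differentiable because it is continuous and its exponential is differentiable.
\<close>
context
  fixes \<epsilon> :: real and I :: "real set" and u :: "real \<Rightarrow> real^'n::finite \<Rightarrow> complex" and t :: real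
    and u' :: "real^'n \<Rightarrow> complex"
    and q p :: "real \<Rightarrow> real^'n" and C :: "real \<Rightarrow> complex^'n^'n" and \<zeta> :: "real \<Rightarrow> complex"
    and a :: complex and b :: "complex^'n" and M :: "complex^'n^'n" and v :: "real^'n"
  assumes eps: "0 < \<epsilon>" and t: "t \<in> I"
    and width: "\<And>s. s \<in> I \<Longrightarrow> width_matrix (C s)"
    and u_eq: "\<And>s. s \<in> I \<Longrightarrow> u s = gwp \<epsilon> (q s) (p s) (C s) (\<zeta> s)"
    and cont: "(\<zeta> \<longlongrightarrow> \<zeta> t) (at t within I)"
    and der: "\<And>x. ((\<lambda>s. u s x) has_vector_derivative u' x) (at t within I)"
    and eq: "\<And>x. \<i> * of_real \<epsilon> * u' x = wave_packet.quad (q t) a b M x * u t x"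
    and M_sym: "\<And>j k. M $ j $ k = M $ k $ j"
begin

private abbreviation "net \<equiv> at t within I"
private abbreviation "ph s \<equiv> phase (q s) (p s) (C s) (\<zeta> s)"
private abbreviation "w \<equiv> wave_packet.quad (q t) a b M"

lemma gwp_parameters_tendsto:
  "((\<lambda>s. gwp \<epsilon> (q s) (p s) (C s) (\<zeta> s) x) \<longlongrightarrow> gwp \<epsilon> (q t) (p t) (C t) (\<zeta> t) x) net"
proof -
  have "((\<lambda>s. u s x) \<longlongrightarrow> u t x) net"
    using has_vector_derivative_continuous[OF der] unfolding continuous_within .
  moreover have "eventually (\<lambda>s. u s x = gwp \<epsilon> (q s) (p s) (C s) (\<zeta> s) x) net"
    using u_eq by (auto simp: eventually_at_filter)
  ultimately show ?thesis
    using u_eq[OF t] by (simp add: tendsto_cong)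
qed

lemmas parameters_cont = parameters_tendsto[OF eps width t gwp_parameters_tendsto, simplified]

lemma phase_has_derivative: "((\<lambda>s. ph s x) has_vector_derivative - w x) net"
proof -
  have "((\<lambda>s. exp (\<i> / of_real \<epsilon> * ph s x)) has_vector_derivative u' x) net"
    using der[of x] unfolding has_vector_derivative_def
    by (rule has_derivative_transform[OF t, rotated]) (simp add: u_eq gwp_phase)
  moreover have "continuous net (\<lambda>s. \<i> / of_real \<epsilon> * ph s x)"
    unfolding continuous_within by (intro tendsto_intros phase_tendsto parameters_cont cont)
  ultimately have "((\<lambda>s. \<i> / of_real \<epsilon> * ph s x) has_vector_derivative u' x / exp (\<i> / of_real \<epsilon> * ph t x)) net"
    using t by (intro has_vector_derivative_log)
  from has_vector_derivative_mult_right[OF this, of "of_real \<epsilon> / \<i>"]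
  have "((\<lambda>s. ph s x) has_vector_derivative of_real \<epsilon> / \<i> * (u' x / u t x)) net"
    using eps by (simp add: u_eq[OF t] gwp_phase)
  moreover have "of_real \<epsilon> / \<i> * (u' x / u t x) = - w x"
  proof -
    have "u t x \<noteq> 0"
      by (simp add: u_eq[OF t] gwp_def)
    then have "of_real \<epsilon> / \<i> * (u' x / u t x) = - (\<i> * of_real \<epsilon> * u' x) / u t x"
      by (simp add: field_simps)
    then show ?thesis
      using \<open>u t x \<noteq> 0\<close> by (simp add: eq)
  qed
  ultimately show ?thesis
    by simp
qed

lemma w_translate_axis:
  "w (q t + axis j 1) - w (q t) = b $ j + 1/2 * M $ j $ j"
  "w (q t + axis j 1 + axis k 1) - w (q t + axis j 1) - w (q t + axis k 1) + w (q t) = M $ j $ k"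
proof -
  interpret wave_packet \<epsilon> "q t" "p t" "C t" "\<zeta> t"
    using eps width[OF t] by unfold_locales
  have d: "complex_of_real ((q t + axis j 1) $ i - q t $ i) = (if i = j then 1 else 0)"
    "complex_of_real ((q t) $ i - q t $ i) = 0"
    "complex_of_real ((q t + axis j 1 + axis k 1) $ i - q t $ i) = (if i = j then 1 else 0) + (if i = k then 1 else 0)" for i j k
    by (auto simp: axis_def)
  have d1: "(\<Sum>i\<in>UNIV. f i * (if i = j then 1 else 0)) = (f j :: complex)" for f :: "'n \<Rightarrow> complex" and j
    by (simp add: if_distrib[where f = "\<lambda>c. _ * c"] cong: if_cong)
  have d2: "(\<Sum>i\<in>UNIV. \<Sum>m\<in>UNIV. M $ i $ m * (if i = j then 1 else 0) * (if m = k then 1 else 0)) = M $ j $ k" for j k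
    unfolding d1 by (simp only: d1)
  show "w (q t + axis j 1) - w (q t) = b $ j + 1/2 * M $ j $ j"
    unfolding quad_def d by (simp only: d1 d2) simp
  show "w (q t + axis j 1 + axis k 1) - w (q t + axis j 1) - w (q t + axis k 1) + w (q t) = M $ j $ k"
    unfolding quad_def d by (simp only: distrib_left distrib_right sum.distrib d1 d2) (simp add: M_sym[of k j])
qed

text \<open>The four points are fixed in time, so the mixed difference can be differentiated
  termwise; it equals the entry of C at every time in I.\<close>

lemma C_has_derivative: "(C has_vector_derivative - M) net"
proof (intro has_vector_derivative_vec)
  fix j k
  let ?f = "\<lambda>s. ph s (q t + axis j 1 + axis k 1) - ph s (q t + axis j 1) - ph s (q t + axis k 1) + ph s (q t)"
  have "(?f has_vector_derivative - w (q t + axis j 1 + axis k 1) - - w (q t + axis j 1) - - w (q t + axis k 1) + - w (q t)) net"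
    by (rule has_vector_derivative_add[OF has_vector_derivative_diff[OF has_vector_derivative_diff[OF
          phase_has_derivative phase_has_derivative] phase_has_derivative] phase_has_derivative])
  moreover have "?f s = C s $ j $ k" if "s \<in> I" for s
    using phase_translate_axis(2)[OF width_matrix_sym[OF width[OF that]], where s = 1] by simp
  moreover have "- w (q t + axis j 1 + axis k 1) - - w (q t + axis j 1) - - w (q t + axis k 1) + - w (q t) = (- M) $ j $ k"
    using w_translate_axis(2)[of j k] by (simp add: algebra_simps)
  ultimately show "((\<lambda>s. C s $ j $ k) has_vector_derivative (- M) $ j $ k) net"
    by (simp only: has_vector_derivative_transform[OF t, of "\<lambda>s. C s $ j $ k" ?f])
qed

lemma C_nth_has_derivative: "((\<lambda>s. C s $ j $ k) has_vector_derivative - (M $ j $ k)) net"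
  using bounded_linear.has_vector_derivative[OF bounded_linear_vec_nth[of k] bounded_linear.has_vector_derivative[OF bounded_linear_vec_nth[of j] C_has_derivative]]
  by simp

lemma slope_has_derivative:
  "((\<lambda>s. phase_slope (q s) (p s) (C s) (q t) j) has_vector_derivative - (b $ j)) net"
proof -
  let ?f = "\<lambda>s. ph s (q t + axis j 1) - ph s (q t) - 1/2 * C s $ j $ j"
  have "(?f has_vector_derivative - w (q t + axis j 1) - - w (q t) - 1/2 * - (M $ j $ j)) net"
    by (rule has_vector_derivative_diff[OF has_vector_derivative_diff[OF phase_has_derivative phase_has_derivative]
          has_vector_derivative_mult_right[OF C_nth_has_derivative]])
  moreover have "?f s = phase_slope (q s) (p s) (C s) (q t) j" if "s \<in> I" for s
    using phase_translate_axis(1)[OF width_matrix_sym[OF width[OF that]], where s = 1] by simp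
  moreover have "- w (q t + axis j 1) - - w (q t) - 1/2 * - (M $ j $ j) = - (b $ j)"
    using w_translate_axis(1)[of j] by (simp add: algebra_simps)
  ultimately show ?thesis
    by (simp only: has_vector_derivative_transform[OF t, of "\<lambda>s. phase_slope (q s) (p s) (C s) (q t) j" ?f])
qed

text \<open>The imaginary part of the slope at \<open>q t\<close> is Im C(s) (q(t) - q(s)) and
  vanishes at s = t. Hence the difference quotient of q solves a linear system whose matrix and
  right-hand side converge, which uses only continuity of C.\<close>

lemma q_has_derivative:
  assumes v: "\<And>j. (map_matrix Im (C t) *v v) $ j = Im (b $ j)"
  shows "(q has_vector_derivative v) net"
proof -
  \<comment> \<open>Outside I the matrix \<open>C s\<close> is arbitrary; the substitute keeps the
    determinant nonzero for every s, as Cramer's rule demands.\<close>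
  let ?G = "\<lambda>s. if s \<in> I then map_matrix Im (C s) else map_matrix Im (C t)"
  let ?Q = "\<lambda>s. (q s - q t) /\<^sub>R (s - t)"
  have "(?Q \<longlongrightarrow> v) net"
  proof (rule tendsto_linear_solution[where G = ?G and ?G0.0 = "map_matrix Im (C t)"])
    have "((\<lambda>s. Im (C s $ i $ j)) \<longlongrightarrow> Im (C t $ i $ j)) net" for i j
      by (intro tendsto_intros parameters_cont)
    then have "((\<lambda>s. ?G s $ i $ j) \<longlongrightarrow> Im (C t $ i $ j)) net" for i j
      by (rule Lim_transform_eventually) (auto simp: eventually_at_filter)
    then show "((\<lambda>s. ?G s $ i $ j) \<longlongrightarrow> map_matrix Im (C t) $ i $ j) net" for i j
      by (simp only: nth_map_matrix)
    show "((\<lambda>s. (?G s *v ?Q s) $ j) \<longlongrightarrow> (map_matrix Im (C t) *v v) $ j) net" for j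
    proof -
      have "((\<lambda>s. - Im (phase_slope (q s) (p s) (C s) (q t) j)) has_vector_derivative - Im (- (b $ j))) net"
        by (rule has_vector_derivative_minus[OF has_vector_derivative_Im[OF slope_has_derivative]])
      then have "((\<lambda>s. (- Im (phase_slope (q s) (p s) (C s) (q t) j)) /\<^sub>R (s - t)) \<longlongrightarrow> Im (b $ j)) net"
        by (simp add: has_vector_derivative_iff_tendsto Im_phase_slope)
      moreover have "eventually (\<lambda>s. (- Im (phase_slope (q s) (p s) (C s) (q t) j)) /\<^sub>R (s - t) = (?G s *v ?Q s) $ j) net"
      proof -
        have "(- Im (phase_slope (q s) (p s) (C s) (q t) j)) /\<^sub>R (s - t) = (map_matrix Im (C s) *v ?Q s) $ j" for s
          by (simp add: Im_phase_slope matrix_vector_nth sum_distrib_left sum_negf[symmetric] algebra_simps)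
        then show ?thesis
          by (auto simp: eventually_at_filter)
      qed
      ultimately show ?thesis
        unfolding v by (rule Lim_transform_eventually)
    qed
    show "det (?G s) \<noteq> 0" for s
      by (cases "s \<in> I") (simp_all add: width_matrix_det[OF width] width_matrix_det[OF width[OF t]])
  qed (rule width_matrix_det[OF width[OF t]])
  then show ?thesis
    by (simp add: has_vector_derivative_iff_tendsto)
qed

lemma q_nth_has_derivative:
  assumes v: "\<And>j. (map_matrix Im (C t) *v v) $ j = Im (b $ j)"
  shows "((\<lambda>s. q s $ j) has_vector_derivative v $ j) net"
  by (rule bounded_linear.has_vector_derivative[OF bounded_linear_vec_nth q_has_derivative[OF v]])

text \<open>The real part of the slope at \<open>q t\<close> differs from p by Re C(s) (q(s) -
  q(t)). Its second factor vanishes at s = t, so the derivative of C does not enter.\<close>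

lemma p_has_derivative:
  assumes v: "\<And>j. (map_matrix Im (C t) *v v) $ j = Im (b $ j)"
  shows "(p has_vector_derivative (\<chi> j. - Re (b $ j)) + map_matrix Re (C t) *v v) net"
proof (rule has_vector_derivative_vec)
  fix j
  have p_eq: "p s $ j = Re (phase_slope (q s) (p s) (C s) (q t) j) + (\<Sum>k\<in>UNIV. Re (C s $ j $ k) * (q s $ k - q t $ k))" for s
    by (simp add: phase_slope_def sum.distrib[symmetric] algebra_simps)
  have "((\<lambda>s. Re (C s $ j $ k) * (q s $ k - q t $ k)) has_vector_derivative Re (C t $ j $ k) * v $ k) net" for k
    using has_vector_derivative_mult[OF has_vector_derivative_Re[OF C_nth_has_derivative[of j k]]
        has_vector_derivative_diff[OF q_nth_has_derivative[OF v, of k] has_vector_derivative_const[of "q t $ k"]]]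
    by simp
  then have "((\<lambda>s. \<Sum>k\<in>UNIV. Re (C s $ j $ k) * (q s $ k - q t $ k)) has_vector_derivative
      (\<Sum>k\<in>UNIV. Re (C t $ j $ k) * v $ k)) net"
    by (rule has_vector_derivative_sum)
  from has_vector_derivative_add[OF has_vector_derivative_Re[OF slope_has_derivative[of j]] this]
  have "((\<lambda>s. p s $ j) has_vector_derivative Re (- (b $ j)) + (\<Sum>k\<in>UNIV. Re (C t $ j $ k) * v $ k)) net"
    by (simp only: p_eq)
  then show "((\<lambda>s. p s $ j) has_vector_derivative ((\<chi> j. - Re (b $ j)) + map_matrix Re (C t) *v v) $ j) net"
    by (simp add: matrix_vector_nth)
qed

lemma zeta_has_derivative:
  assumes v: "\<And>j. (map_matrix Im (C t) *v v) $ j = Im (b $ j)"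
  shows "(\<zeta> has_vector_derivative - a + of_real (v \<bullet> p t)) net"
proof -
  interpret wave_packet \<epsilon> "q t" "p t" "C t" "\<zeta> t"
    using eps width[OF t] by unfold_locales
  define R where "R s = ph s (q t)
      - 1/2 * (\<Sum>j\<in>UNIV. \<Sum>k\<in>UNIV. of_real (q t $ j - q s $ j) * C s $ j $ k * of_real (q t $ k - q s $ k))
      - (\<Sum>j\<in>UNIV. of_real (q t $ j - q s $ j) * of_real (p s $ j))" for s
  have R: "R = \<zeta>"
    by (simp add: R_def phase_def inner_vec_def fun_eq_iff)
  have pn: "((\<lambda>s. complex_of_real (p s $ j)) has_vector_derivative
      of_real (((\<chi> j. - Re (b $ j)) + map_matrix Re (C t) *v v) $ j)) net" for j
    by (intro bounded_linear.has_vector_derivative[OF bounded_linear_of_real]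
        bounded_linear.has_vector_derivative[OF bounded_linear_vec_nth p_has_derivative[OF v]])
  have qn: "((\<lambda>s. complex_of_real (q t $ j - q s $ j)) has_vector_derivative of_real (0 - v $ j)) net" for j
    by (intro bounded_linear.has_vector_derivative[OF bounded_linear_of_real] has_vector_derivative_diff
        has_vector_derivative_const q_nth_has_derivative[OF v])
  have quadratic: "((\<lambda>s. of_real (q t $ j - q s $ j) * C s $ j $ k * of_real (q t $ k - q s $ k)) has_vector_derivative 0) net" for j k
    using has_vector_derivative_mult[OF has_vector_derivative_mult[OF qn C_nth_has_derivative[of j k]] qn[of k]] by simp
  have linear: "((\<lambda>s. complex_of_real (q t $ j - q s $ j) * of_real (p s $ j)) has_vector_derivative - of_real (v $ j * p t $ j)) net" for j
    using has_vector_derivative_mult[OF qn pn, of j j] by simp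
  have "((\<lambda>s. \<Sum>k\<in>UNIV. of_real (q t $ j - q s $ j) * C s $ j $ k * of_real (q t $ k - q s $ k))
      has_vector_derivative (\<Sum>k\<in>(UNIV :: 'n set). 0)) net" for j
    by (rule has_vector_derivative_sum) (rule quadratic)
  then have "((\<lambda>s. \<Sum>j\<in>UNIV. \<Sum>k\<in>UNIV. of_real (q t $ j - q s $ j) * C s $ j $ k * of_real (q t $ k - q s $ k))
      has_vector_derivative (\<Sum>j\<in>(UNIV :: 'n set). \<Sum>k\<in>(UNIV :: 'n set). 0)) net"
    by (rule has_vector_derivative_sum)
  note quadratics = this
  have linears: "((\<lambda>s. \<Sum>j\<in>UNIV. complex_of_real (q t $ j - q s $ j) * of_real (p s $ j))
      has_vector_derivative (\<Sum>j\<in>UNIV. - of_real (v $ j * p t $ j))) net"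
    by (rule has_vector_derivative_sum) (rule linear)
  have "(R has_vector_derivative - w (q t) - 1/2 * (\<Sum>j\<in>(UNIV :: 'n set). \<Sum>k\<in>(UNIV :: 'n set). 0)
      - (\<Sum>j\<in>UNIV. - of_real (v $ j * p t $ j))) net"
    unfolding R_def[abs_def]
    by (rule has_vector_derivative_diff[OF has_vector_derivative_diff[OF phase_has_derivative
          has_vector_derivative_mult_right[OF quadratics]] linears])
  moreover have "w (q t) = a"
    by (simp add: quad_def)
  ultimately show ?thesis
    unfolding R by (simp add: inner_vec_def sum_negf)
qed

text \<open>Expanded about \<open>q t\<close>, the phase has coefficients that are Lipschitz along
  the sequence. This gives the quadratic bound in x that
  \<open>integral_exp_difference_quotient\<close> asks for.\<close>

lemma phase_difference_le:
  assumes X: "\<And>n. X n \<in> I - {t}" "X \<longlonglongrightarrow> t"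
  obtains L where "\<And>n x. norm (ph (X n) x - ph t x) \<le> L * \<bar>X n - t\<bar> * (1 + norm x)\<^sup>2"
proof -
  note lip = has_vector_derivative_lipschitz[OF _ X]
  obtain B0 where B0: "\<And>n. norm (ph (X n) (q t) - ph t (q t)) \<le> B0 * \<bar>X n - t\<bar>"
    using lip[OF phase_has_derivative] by blast
  let ?S = "\<lambda>s. phase_slope (q s) (p s) (C s) (q t)"
  have "\<exists>B. \<forall>n. norm (?S (X n) j - ?S t j) \<le> B * \<bar>X n - t\<bar>" for j
    using lip[OF slope_has_derivative[of j]] by blast
  then obtain B1 where B1: "\<And>j n. norm (?S (X n) j - ?S t j) \<le> B1 j * \<bar>X n - t\<bar>"
    by metis
  have "\<exists>B. \<forall>n. norm (C (X n) $ j $ k - C t $ j $ k) \<le> B * \<bar>X n - t\<bar>" for j k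
    using lip[OF C_nth_has_derivative[of j k]] by blast
  then obtain B2 where B2: "\<And>j k n. norm (C (X n) $ j $ k - C t $ j $ k) \<le> B2 j k * \<bar>X n - t\<bar>"
    by metis
  define L where "L = B0 + (\<Sum>j\<in>UNIV. B1 j) + (\<Sum>j\<in>UNIV. \<Sum>k\<in>UNIV. B2 j k)"
  have "norm (ph (X n) x - ph t x) \<le> (L * (1 + norm (q t))\<^sup>2) * \<bar>X n - t\<bar> * (1 + norm x)\<^sup>2" for n x
  proof -
    define v where "v = x - q t"
    let ?A = "\<Sum>j\<in>UNIV. of_real (v $ j) * (?S (X n) j - ?S t j)"
    let ?B = "\<Sum>j\<in>UNIV. \<Sum>k\<in>UNIV. (C (X n) $ j $ k - C t $ j $ k) * of_real (v $ j) * of_real (v $ k)"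
    define h where "h = \<bar>X n - t\<bar>"
    define r where "r = 1 + norm v"
    have "1 \<le> r"
      by (simp add: r_def)
    then have r: "1 \<le> r" "1 \<le> r\<^sup>2" "r \<le> r\<^sup>2"
      using self_le_power[of r 2] by (auto intro: one_le_power)
    have vr: "\<bar>v $ j\<bar> \<le> r" for j
      using component_le_norm_cart[of v j] by (simp add: r_def)
    have r0: "0 \<le> r"
      using r(1) by simp
    have b0: "norm (ph (X n) (q t) - ph t (q t)) \<le> B0 * h"
      and b1: "norm (?S (X n) j - ?S t j) \<le> B1 j * h"
      and b2: "norm (C (X n) $ j $ k - C t $ j $ k) \<le> B2 j k * h" for j k
      unfolding h_def by (rule B0 B1 B2)+
    have nn: "0 \<le> B0 * h" "0 \<le> B1 j * h" "0 \<le> B2 j k * h" for j k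
      by (rule order_trans[OF norm_ge_zero b0] order_trans[OF norm_ge_zero b1] order_trans[OF norm_ge_zero b2])+
    have x: "x = q t + v"
      by (simp add: v_def)
    have e: "ph s x = ph s (q t) + (\<Sum>j\<in>UNIV. of_real (v $ j) * ?S s j)
      + 1/2 * (\<Sum>j\<in>UNIV. \<Sum>k\<in>UNIV. C s $ j $ k * of_real (v $ j) * of_real (v $ k))" if "s \<in> I" for s
      unfolding x by (rule phase_translate[OF width_matrix_sym[OF width[OF that]]])
    have diff: "(a + b + 1/2 * c) - (a' + b' + 1/2 * c') = (a - a') + (b - b') + 1/2 * (c - c')"
      for a b c a' b' c' :: complex
      by (simp add: diff_divide_distrib)
    have S1: "norm (ph (X n) (q t) - ph t (q t)) \<le> B0 * h * r\<^sup>2"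
      by (rule order_trans[OF b0 mult_left_mono[OF r(2) nn(1), unfolded mult_1_right]])
    have S2: "norm ?A \<le> (\<Sum>j\<in>UNIV. B1 j * h * r\<^sup>2)"
    proof (rule sum_norm_le)
      fix j
      have "norm (of_real (v $ j) * (?S (X n) j - ?S t j)) \<le> r * (B1 j * h)"
        unfolding norm_mult norm_of_real by (rule mult_mono[OF vr b1 r0 norm_ge_zero])
      also have "\<dots> \<le> r\<^sup>2 * (B1 j * h)"
        using r(3) nn(2) by (rule mult_right_mono)
      finally show "norm (of_real (v $ j) * (?S (X n) j - ?S t j)) \<le> B1 j * h * r\<^sup>2"
        by (simp only: mult_ac)
    qed
    have S3: "norm ?B
        \<le> (\<Sum>j\<in>UNIV. \<Sum>k\<in>UNIV. B2 j k * h * r\<^sup>2)"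
    proof (rule sum_norm_le, rule sum_norm_le)
      fix j k
      have "norm ((C (X n) $ j $ k - C t $ j $ k) * of_real (v $ j) * of_real (v $ k)) \<le> (B2 j k * h) * r * r"
        unfolding norm_mult norm_of_real
        by (rule mult_mono[OF mult_mono[OF b2 vr nn(3) abs_ge_zero] vr mult_nonneg_nonneg[OF nn(3) r0] abs_ge_zero])
      then show "norm ((C (X n) $ j $ k - C t $ j $ k) * of_real (v $ j) * of_real (v $ k)) \<le> B2 j k * h * r\<^sup>2"
        by (simp only: power2_eq_square mult.assoc)
    qed
    have half: "norm (1/2 * z) \<le> norm z" for z :: complex
      by (simp add: norm_mult)
    have "X n \<in> I"
      using X(1)[of n] by simp
    then have "norm (ph (X n) x - ph t x) = norm ((ph (X n) (q t) - ph t (q t))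
      + ?A
      + 1/2 * ?B)"
      by (simp only: e[OF t] e diff right_diff_distrib left_diff_distrib sum_subtractf)
    also have "\<dots> \<le> norm (ph (X n) (q t) - ph t (q t))
      + norm ?A
      + norm (1/2 * ?B)"
      by (rule order_trans[OF norm_triangle_ineq add_right_mono[OF norm_triangle_ineq]])
    also have "\<dots> \<le> B0 * h * r\<^sup>2 + (\<Sum>j\<in>UNIV. B1 j * h * r\<^sup>2) + (\<Sum>j\<in>UNIV. \<Sum>k\<in>UNIV. B2 j k * h * r\<^sup>2)"
      by (rule add_mono[OF add_mono[OF S1 S2] order_trans[OF half S3]])
    also have "\<dots> = (L * h) * r\<^sup>2"
      by (simp only: L_def distrib_right sum_distrib_right)
    \<comment> \<open>Moves the centre from \<open>q t\<close> to the origin, at the price of the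
      factor (1 + |q(t)|)^2 in the constant.\<close>
    also have "\<dots> \<le> (L * h) * ((1 + norm (q t)) * (1 + norm x))\<^sup>2"
    proof (intro mult_left_mono power_mono)
      have "norm v \<le> norm x + norm (q t)"
        unfolding v_def by (rule norm_triangle_ineq4)
      moreover have "0 \<le> norm (q t) * norm x"
        by simp
      ultimately show "r \<le> (1 + norm (q t)) * (1 + norm x)"
        unfolding r_def distrib_left distrib_right by linarith
      have "L * h = B0 * h + (\<Sum>j\<in>UNIV. B1 j * h) + (\<Sum>j\<in>UNIV. \<Sum>k\<in>UNIV. B2 j k * h)"
        by (simp only: L_def distrib_right sum_distrib_right)
      then show "0 \<le> L * h"
        by (simp only:) (intro add_nonneg_nonneg sum_nonneg nn)
      show "0 \<le> r"
        by (rule r0)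
    qed
    finally show ?thesis
      by (simp only: h_def power_mult_distrib mult_ac)
  qed
  then show ?thesis
    by (rule that)
qed

text \<open>The weight is exp (-P) with P equal to 2/\<epsilon> times the imaginary part of the
  phase. As the phase has derivative -w, differentiation under the integral yields the averaged
  imaginary part of w.\<close>

lemma mass_has_derivative:
  "((\<lambda>s. avg (u s) (\<lambda>x. 1::real)) has_vector_derivative 2 / \<epsilon> * Im (avg (u t) w)) net"
  unfolding has_vector_derivative_iff_tendsto tendsto_at_iff_sequentially
proof (intro allI impI)
  fix X
  assume X: "\<forall>i. X i \<in> I - {t}" "X \<longlonglongrightarrow> t"
  interpret wave_packet \<epsilon> "q t" "p t" "C t" "\<zeta> t"
    using eps width[OF t] by unfold_locales
  define P where "P s x = 2 / \<epsilon> * Im (ph s x)" for s x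
  have mass: "(cmod (u s x))\<^sup>2 = exp (- P s x)" if "s \<in> I" for s x
  proof -
    have "cmod (u s x) = exp (- (Im (ph s x) / \<epsilon>))"
      using that by (simp add: u_eq gwp_phase norm_exp_eq_Re Re_divide_of_real)
    then have "(cmod (u s x))\<^sup>2 = exp (2 * - (Im (ph s x) / \<epsilon>))"
      by (simp only: exp_double)
    then show ?thesis
      by (simp add: P_def)
  qed
  have P_cont: "continuous_on UNIV (P s)" for s
    unfolding P_def phase_def by (intro continuous_intros)
  obtain c K where c: "0 < c"
    "\<And>x. c * (norm x)\<^sup>2 - K \<le> ((x - q t) \<bullet> (map_matrix Im (C t) *v (x - q t))) / \<epsilon> + 2 * Im (\<zeta> t) / \<epsilon>"
    using weight_exponent_ge by blast
  have P_ge: "c * (norm x)\<^sup>2 - K \<le> P t x" for x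
  proof -
    have "exp (- P t x) = exp (- (((x - q t) \<bullet> (map_matrix Im (C t) *v (x - q t))) / \<epsilon> + 2 * Im (\<zeta> t) / \<epsilon>))"
      by (simp only: mass[OF t, symmetric] u_eq[OF t] weight_eq)
    then show ?thesis
      using c(2)[of x] by simp
  qed
  obtain L where L: "\<And>n x. norm (ph (X n) x - ph t x) \<le> L * \<bar>X n - t\<bar> * (1 + norm x)\<^sup>2"
    using phase_difference_le[of X] X by blast
  have "(\<lambda>n. (integral\<^sup>L lborel (\<lambda>x. exp (- P (X n) x)) - integral\<^sup>L lborel (\<lambda>x. exp (- P t x))) / (X n - t))
    \<longlonglongrightarrow> - integral\<^sup>L lborel (\<lambda>x. (2 / \<epsilon> * Im (- w x)) * exp (- P t x))"
  proof (rule integral_exp_difference_quotient[where L = "2 / \<epsilon> * L", OF P_cont P_cont c(1) P_ge])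
    show "(\<lambda>n. X n - t) \<longlonglongrightarrow> 0"
      using X(2) by (simp add: LIM_zero)
    show "X n - t \<noteq> 0" for n
      using X(1) by auto
    show "\<bar>P (X n) x - P t x\<bar> \<le> 2 / \<epsilon> * L * \<bar>X n - t\<bar> * (1 + norm x)\<^sup>2" for n x
    proof -
      have "\<bar>Im (ph (X n) x - ph t x)\<bar> \<le> L * \<bar>X n - t\<bar> * (1 + norm x)\<^sup>2"
        using L[of n x] abs_Im_le_cmod[of "ph (X n) x - ph t x"] by linarith
      then have "2 / \<epsilon> * \<bar>Im (ph (X n) x - ph t x)\<bar> \<le> 2 / \<epsilon> * (L * \<bar>X n - t\<bar> * (1 + norm x)\<^sup>2)"
        using eps by (intro mult_left_mono) auto
      moreover have "P (X n) x - P t x = 2 / \<epsilon> * Im (ph (X n) x - ph t x)"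
        by (simp add: P_def right_diff_distrib diff_divide_distrib)
      ultimately show ?thesis
        using eps by (simp only: abs_mult mult.assoc) simp
    qed
    show "(\<lambda>n. (P (X n) x - P t x) / (X n - t)) \<longlonglongrightarrow> 2 / \<epsilon> * Im (- w x)" for x
    proof -
      have "((\<lambda>s. P s x) has_vector_derivative 2 / \<epsilon> * Im (- w x)) net"
        unfolding P_def by (rule has_vector_derivative_mult_right[OF has_vector_derivative_Im[OF phase_has_derivative]])
      then show ?thesis
        using X unfolding has_vector_derivative_iff_tendsto tendsto_at_iff_sequentially
        by (auto simp: o_def divide_inverse mult.commute)
    qed
  qed
  moreover have "- integral\<^sup>L lborel (\<lambda>x. (2 / \<epsilon> * Im (- w x)) * exp (- P t x)) = 2 / \<epsilon> * Im (avg (u t) w)"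
  proof -
    have "- integral\<^sup>L lborel (\<lambda>x. (2 / \<epsilon> * Im (- w x)) * exp (- P t x)) = avg (u t) (\<lambda>x. (2 / \<epsilon>) *\<^sub>R Im (w x))"
      by (simp add: avg_def mass[OF t] mult_ac)
    also have "\<dots> = (2 / \<epsilon>) *\<^sub>R avg (u t) (\<lambda>x. Im (w x))"
      unfolding u_eq[OF t]
      by (rule E_scaleR[OF poly_bounded_linear[OF bounded_linear_Im tame_poly_bounded[OF quad_tame]]])
    also have "avg (u t) (\<lambda>x. Im (w x)) = Im (avg (u t) w)"
      unfolding u_eq[OF t] by (rule E_linear[OF bounded_linear_Im tame_poly_bounded[OF quad_tame]])
    finally show ?thesis
      by simp
  qed
  moreover have "avg (u s) (\<lambda>x. 1::real) = integral\<^sup>L lborel (\<lambda>x. exp (- P s x))" if "s \<in> I" for s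
    using mass[OF that] by (simp add: avg_def)
  ultimately show "((\<lambda>s. (avg (u s) (\<lambda>x. 1::real) - avg (u t) (\<lambda>x. 1)) /\<^sub>R (s - t)) \<circ> X) \<longlonglongrightarrow> 2 / \<epsilon> * Im (avg (u t) w)"
    using X(1) t by (simp add: o_def divide_inverse mult.commute)
qed

end

section \<open>Mass conservation, existence of parameters and the equations of motion\<close>

lemma variational_solution_derivative:
  assumes eps: "0 < \<epsilon>" and adm: "admissible_potentials A V"
    and sol: "variational_solution \<epsilon> A V I u" and t: "t \<in> I"
    and width: "width_matrix C" and u: "u t = gwp \<epsilon> q p C \<zeta>"
  obtains u' where "\<And>x. ((\<lambda>s. u s x) has_vector_derivative u' x) (at t within I)"
    "\<And>x. \<i> * of_real \<epsilon> * u' x = wave_packet.quad q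
        (wave_packet_potential.wa \<epsilon> q p C \<zeta> (A t) (Vtilde A V t))
        (wave_packet_potential.wb \<epsilon> q p C \<zeta> (A t) (Vtilde A V t))
        (wave_packet_potential.wM \<epsilon> q p C \<zeta> (A t) (Vtilde A V t)) x * u t x"
proof -
  interpret wave_packet_potential \<epsilon> q p C \<zeta> "A t" "Vtilde A V t"
    using eps width admissible_potentials_tame[OF adm] by unfold_locales
  obtain u' where u': "\<And>x. ((\<lambda>s. u s x) has_vector_derivative u' x) (at t within I)"
    "(\<lambda>x. \<i> * of_real \<epsilon> * u' x) = tangent_proj (u t) (hamiltonian \<epsilon> (A t) (V t) (u t))"
    using sol t unfolding variational_solution_def by blast
  have "tangent_proj (u t) (hamiltonian \<epsilon> (A t) (V t) (u t)) = (\<lambda>x. quad wa wb wM x * u t x)"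
    unfolding u hamiltonian_gwp[of "V t", OF Vtilde_def] by (rule tangent_proj_h)
  with u'(2) have "\<i> * of_real \<epsilon> * u' x = quad wa wb wM x * u t x" for x
    by metis
  with u'(1) that show ?thesis
    by blast
qed

text \<open>\<open>Im_E_w\<close> is valid for every value of the mass, so it may be used before
  normalisation is known and there is no circularity.\<close>

lemma mass_derivative_zero:
  assumes eps: "0 < \<epsilon>" and adm: "admissible_potentials A V"
    and sol: "variational_solution \<epsilon> A V I u" and t: "t \<in> I"
    and par: "parameters_of \<epsilon> I u \<zeta>0 q p C \<zeta>"
  shows "((\<lambda>s. avg (u s) (\<lambda>x. 1::real)) has_vector_derivative 0) (at t within I)"
proof -
  have wm: "\<And>s. s \<in> I \<Longrightarrow> width_matrix (C s)" and u: "\<And>s. s \<in> I \<Longrightarrow> u s = gwp \<epsilon> (q s) (p s) (C s) (\<zeta> s)"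
    and cont: "(\<zeta> \<longlongrightarrow> \<zeta> t) (at t within I)"
    using par t unfolding parameters_of_def continuous_on_def by blast+
  interpret wave_packet_potential \<epsilon> "q t" "p t" "C t" "\<zeta> t" "A t" "Vtilde A V t"
    using eps wm[OF t] admissible_potentials_tame[OF adm] by unfold_locales
  obtain u' where u': "\<And>x. ((\<lambda>s. u s x) has_vector_derivative u' x) (at t within I)"
    "\<And>x. \<i> * of_real \<epsilon> * u' x = quad wa wb wM x * u t x"
    using variational_solution_derivative[OF eps adm sol t wm[OF t] u[OF t]] by blast
  from mass_has_derivative[OF eps t wm u cont u' wM_sym] show ?thesis
    unfolding u[OF t] Im_E_w by simp
qed

text \<open>Parameters are first chosen separately at each time. Then q, p and C are continuous
  whatever branch of \<zeta> was chosen, and only \<zeta> has to be corrected, by a continuous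
  logarithm on the interval.\<close>

lemma parameters_of_exists:
  assumes eps: "0 < \<epsilon>" and sol: "variational_solution \<epsilon> A V I u"
    and I: "is_interval I" "0 \<in> I"
    and width0: "width_matrix C0" and u0: "u 0 = gwp \<epsilon> q0 p0 C0 \<zeta>0"
  shows "\<exists>q p C \<zeta>. parameters_of \<epsilon> I u \<zeta>0 q p C \<zeta>"
proof -
  have "\<forall>t. \<exists>q p C \<zeta>. t \<in> I \<longrightarrow> width_matrix C \<and> u t = gwp \<epsilon> q p C \<zeta>"
    using sol unfolding variational_solution_def gwp_manifold_def by blast
  then obtain q p C z where "\<forall>t. t \<in> I \<longrightarrow> width_matrix (C t) \<and> u t = gwp \<epsilon> (q t) (p t) (C t) (z t)"
    unfolding choice_iff by blast
  then have wm: "\<And>t. t \<in> I \<Longrightarrow> width_matrix (C t)" and u: "\<And>t. t \<in> I \<Longrightarrow> u t = gwp \<epsilon> (q t) (p t) (C t) (z t)"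
    by blast+
  have u_cont: "((\<lambda>s. u s x) \<longlongrightarrow> u t x) (at t within I)" if t: "t \<in> I" for t x
  proof -
    obtain u' where "\<And>x. ((\<lambda>s. u s x) has_vector_derivative u' x) (at t within I)"
      using sol t unfolding variational_solution_def by blast
    from has_vector_derivative_continuous[OF this] show ?thesis
      unfolding continuous_within .
  qed
  have "((\<lambda>s. gwp \<epsilon> (q s) (p s) (C s) (z s) x) \<longlongrightarrow> gwp \<epsilon> (q t) (p t) (C t) (z t) x) (at t within I)"
    if t: "t \<in> I" for t x
  proof -
    have "eventually (\<lambda>s. u s x = gwp \<epsilon> (q s) (p s) (C s) (z s) x) (at t within I)"
      using u by (auto simp: eventually_at_filter)
    with u_cont[OF t, of x] show ?thesis
      unfolding u[OF t] by (rule Lim_transform_eventually)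
  qed
  note par = parameters_tendsto[OF eps wm _ this]
  \<comment> \<open>Dividing the value at x = 0 by the factor that q, p and C determine leaves the
    exponential of i \<zeta> / \<epsilon>, which is continuous and independent of the
    branch.\<close>
  define f where "f s = u s 0 * exp (- (\<i> / of_real \<epsilon> * phase (q s) (p s) (C s) 0 0))" for s
  have f_eq: "f s = exp (\<i> / of_real \<epsilon> * z s)" if "s \<in> I" for s
  proof -
    have "phase (q s) (p s) (C s) (z s) 0 = phase (q s) (p s) (C s) 0 0 + z s"
      by (simp add: phase_def)
    then show ?thesis
      unfolding f_def u[OF that] gwp_phase by (simp add: distrib_left flip: exp_add)
  qed
  have f_cont: "continuous_on I f"
    unfolding continuous_on_def
  proof
    fix t assume t: "t \<in> I"
    have "((\<lambda>s. phase (q s) (p s) (C s) 0 0) \<longlongrightarrow> phase (q t) (p t) (C t) 0 0) (at t within I)"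
      by (rule phase_tendsto[OF par(1)[OF _ t] par(2)[OF _ t] par(3)[OF _ t] tendsto_const]) (use t in auto)
    then show "(f \<longlongrightarrow> f t) (at t within I)"
      unfolding f_def by (intro tendsto_mult u_cont[OF t] tendsto_exp tendsto_minus tendsto_const)
  qed
  have contr: "contractible I"
    using I by (intro convex_imp_contractible) (simp add: is_interval_convex)
  have nz: "f s \<noteq> 0" if "s \<in> I" for s
    unfolding f_eq[OF that] by simp
  from continuous_logarithm_on_contractible[OF f_cont contr nz]
  obtain g where g: "continuous_on I g" "\<And>s. s \<in> I \<Longrightarrow> f s = exp (g s)"
    by blast
  \<comment> \<open>The logarithm g is fixed only up to a constant. Subtracting \<open>g 0\<close>
    prescribes the initial value, and \<open>f0\<close> ensures that the exponentials still agree at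
    all times.\<close>
  define \<zeta> where "\<zeta> s = \<zeta>0 + of_real \<epsilon> / \<i> * (g s - g 0)" for s
  have par0: "q 0 = q0" "p 0 = p0" "C 0 = C0"
    by (rule parameters_unique[OF eps wm[OF I(2)] width0 trans[OF u[OF I(2), symmetric] u0]])+
  have f0: "f 0 = exp (\<i> / of_real \<epsilon> * \<zeta>0)"
  proof -
    have "phase q0 p0 C0 \<zeta>0 0 = phase q0 p0 C0 0 0 + \<zeta>0"
      by (simp add: phase_def)
    then show ?thesis
      unfolding f_def par0 u0 gwp_phase by (simp add: distrib_left flip: exp_add)
  qed
  have z: "exp (\<i> / of_real \<epsilon> * \<zeta> s) = exp (\<i> / of_real \<epsilon> * z s)" if "s \<in> I" for s
  proof -
    have "\<i> / of_real \<epsilon> * \<zeta> s = \<i> / of_real \<epsilon> * \<zeta>0 + g s - g 0"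
      using eps by (simp add: \<zeta>_def field_simps)
    then have "exp (\<i> / of_real \<epsilon> * \<zeta> s) = f 0 * f s / f 0"
      by (simp only: exp_diff exp_add f0 g(2)[OF that, symmetric] g(2)[OF I(2), symmetric])
    then show ?thesis
      using f_eq[OF that] f0 by simp
  qed
  have "gwp \<epsilon> (q s) (p s) (C s) (\<zeta> s) = gwp \<epsilon> (q s) (p s) (C s) (z s)" if "s \<in> I" for s
  proof
    fix x
    have "phase (q s) (p s) (C s) w x = phase (q s) (p s) (C s) 0 x + w" for w
      by (simp add: phase_def)
    from this[of "\<zeta> s"] this[of "z s"]
    show "gwp \<epsilon> (q s) (p s) (C s) (\<zeta> s) x = gwp \<epsilon> (q s) (p s) (C s) (z s) x"
      unfolding gwp_phase by (simp only: distrib_left exp_add z[OF that])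
  qed
  moreover have "continuous_on I \<zeta>"
    unfolding \<zeta>_def by (intro continuous_intros g)
  moreover have "\<zeta> 0 = \<zeta>0"
    by (simp add: \<zeta>_def)
  ultimately have "parameters_of \<epsilon> I u \<zeta>0 q p C \<zeta>"
    unfolding parameters_of_def using wm u by simp
  then show ?thesis
    by blast
qed

theorem theorem3p1:
  fixes A :: "real \<Rightarrow> real^'n::finite \<Rightarrow> real^'n"
    and V :: "real \<Rightarrow> real^'n \<Rightarrow> real"
    and \<epsilon> :: real
    and I :: "real set"
    and u :: "real \<Rightarrow> real^'n \<Rightarrow> complex"
    and q0 p0 :: "real^'n" and C0 :: "complex^'n^'n" and \<zeta>0 :: complex
  assumes "0 < \<epsilon>" and "\<epsilon> \<le> 1"
    and "admissible_potentials A V"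
    and "is_interval I" and "0 \<in> I"
    and "width_matrix C0"
    and "L2_norm (gwp \<epsilon> q0 p0 C0 \<zeta>0) = 1"
    and "variational_solution \<epsilon> A V I u"
    and "u 0 = gwp \<epsilon> q0 p0 C0 \<zeta>0"
  shows "(\<exists>q p C \<zeta>. parameters_of \<epsilon> I u \<zeta>0 q p C \<zeta>) \<and>
    (\<forall>q p C \<zeta>. parameters_of \<epsilon> I u \<zeta>0 q p C \<zeta> \<longrightarrow>
      (\<forall>t\<in>I.
        (let CR = map_matrix Re (C t); CI = map_matrix Im (C t);
             At = A t; Vt = Vtilde A V t; T = tr_term At (C t);
             J = avg (u t) (jac At)
         in
          (q has_vector_derivative p t - avg (u t) At) (at t within I) \<and>
          (p has_vector_derivative
             (\<epsilon>/2) *\<^sub>R avg (u t) (grad T) + transpose J *v p t - avg (u t) (grad Vt))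
             (at t within I) \<and>
          (C has_vector_derivative
             - (C t ** C t) + cmat (avg (u t) (D2 At (p t)))
             + cmat (transpose J) ** C t + C t ** cmat J
             - cmat (avg (u t) (hess Vt)) + cmat ((\<epsilon>/2) *\<^sub>R avg (u t) (hess T)))
             (at t within I) \<and>
          (\<zeta> has_vector_derivative
             of_real (1/2 * (norm (p t))\<^sup>2) + of_real (\<epsilon>/2 * avg (u t) T)
             + \<i> * of_real \<epsilon> / 2 * trace (C t)
             - of_real (\<epsilon>/4 * trace (matrix_inv CI **
                 ((\<epsilon>/2) *\<^sub>R avg (u t) (hess T) + transpose J ** CR + CR ** J
                  + avg (u t) (D2 At (p t)))))
             - of_real (avg (u t) Vt)
             + of_real (\<epsilon>/4 * trace (matrix_inv CI ** avg (u t) (hess Vt))))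
             (at t within I))) \<and>
      q 0 = q0 \<and> p 0 = p0 \<and> C 0 = C0 \<and> \<zeta> 0 = \<zeta>0)"
proof (intro conjI allI impI)
  let "_ \<and> (\<forall>q p C \<zeta>. _ q p C \<zeta> \<longrightarrow> (\<forall>t\<in>I. ?F q p C \<zeta> t) \<and> _ q p C \<zeta>)" = ?thesis
  note eps = assms(1) and adm = assms(3) and sol = assms(8)
  show "\<exists>q p C \<zeta>. parameters_of \<epsilon> I u \<zeta>0 q p C \<zeta>"
    by (rule parameters_of_exists[OF eps sol assms(4,5,6,9)])
  fix q p C \<zeta>
  assume par: "parameters_of \<epsilon> I u \<zeta>0 q p C \<zeta>"
  then have wm: "\<And>s. s \<in> I \<Longrightarrow> width_matrix (C s)" and u: "\<And>s. s \<in> I \<Longrightarrow> u s = gwp \<epsilon> (q s) (p s) (C s) (\<zeta> s)"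
    and cont: "\<And>t. t \<in> I \<Longrightarrow> (\<zeta> \<longlongrightarrow> \<zeta> t) (at t within I)"
    unfolding parameters_of_def continuous_on_def by blast+
  show "q 0 = q0" "p 0 = p0" "C 0 = C0"
    by (rule parameters_unique[OF eps wm[OF assms(5)] assms(6) trans[OF u[OF assms(5), symmetric] assms(9)]])+
  show "\<zeta> 0 = \<zeta>0"
    using par unfolding parameters_of_def by blast
  \<comment> \<open>A vanishing derivative on a convex set makes the mass constant; its value is the
    squared norm of the initial packet.\<close>
  have "\<exists>c. \<forall>t\<in>I. avg (u t) (\<lambda>x. 1::real) = c"
    using mass_derivative_zero[OF eps adm sol _ par] assms(4)
    by (intro has_derivative_zero_constant) (auto simp: is_interval_convex has_vector_derivative_def)
  moreover have "avg (u 0) (\<lambda>x. 1::real) = 1"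
    using assms(7) by (simp add: assms(9) L2_norm_def avg_def)
  ultimately have mass: "avg (u t) (\<lambda>x. 1::real) = 1" if "t \<in> I" for t
    using that assms(5) by metis
  show "\<forall>t\<in>I. ?F q p C \<zeta> t"
  proof
    fix t assume t: "t \<in> I"
    interpret wave_packet_potential \<epsilon> "q t" "p t" "C t" "\<zeta> t" "A t" "Vtilde A V t"
      using eps wm[OF t] admissible_potentials_tame[OF adm] by unfold_locales
    obtain u' where u': "\<And>x. ((\<lambda>s. u s x) has_vector_derivative u' x) (at t within I)"
      "\<And>x. \<i> * of_real \<epsilon> * u' x = quad wa wb wM x * u t x"
      using variational_solution_derivative[OF eps adm sol t wm[OF t] u[OF t]] by blast
    note context_assms = eps t wm u cont[OF t] u' wM_sym
    have N: "N = 1"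
      using mass[OF t] by (simp only: u[OF t])
    have v: "(G *v (p t - E (A t))) $ j = Im (wb $ j)" for j
      using Im_wb[of j] by (simp only: N) simp
    show "?F q p C \<zeta> t"
      \<comment> \<open>The stated right-hand sides are folded back into \<open>wa\<close>,
        \<open>wb\<close> and \<open>wM\<close>, so that the derivative rules apply with velocity p
        minus the average of A.\<close>
      unfolding Let_def u[OF t] wa_eq[OF N, symmetric] wM_eq[OF N, symmetric] Re_wb[OF N, symmetric]
      by (intro conjI q_has_derivative[OF context_assms v] p_has_derivative[OF context_assms v]
          C_has_derivative[OF context_assms] zeta_has_derivative[OF context_assms v])
  qed
qed

end
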